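(* Let $(M^m,c)$ be a conformal manifold of dimension $m\ge3$ or a M\"obius surface. Let $N^n\subset M^m$ be a submanifold ($m>n\ge 1$) such that $n\ge3$, or $N$ is a M\"obius surface with the same underlying conformal structure as the one induced by $M$, or $N$ is a Laplace curve. Let $\nabla$ be any Weyl structure on $M$, with Schouten-Weyl tensor $h^M:=h^\nabla$ on $M$ and mean curvature $H^\nabla\in\nu^*$ of $N\subset M$, and let $h^N$ be the Schouten-Weyl tensor of $N$ corresponding to the Weyl structure $\nabla^N$ on $N$ induced by $\nabla$. Then the relative Schouten-Weyl tensor $\rho\in S^2T^*N$, defined by $$\rho(X,Y):=(h^M-h^N)(X,Y)+\frac12c(H^\nabla,H^\nabla)c(X,Y)+H^\nabla(B_0(X,Y)),\quad\forall X,Y\in TN,$$ is independent of the Weyl structure $\nabla$.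
   Context: All objects are smooth. On an $m$-manifold $M$, for $k\in\mathbb R$, $L^k$ is the oriented real line bundle associated with the frame bundle and the representation $|\det|^{k/m}$. A conformal structure $c$ is a positive-definite section of $S^2T^*M\otimes L^2$, normalized by $|\det c|=1$; equivalently it is the conformal class of metrics $l^{-2}c$, for $l$ a positive section of $L$. Via $c$, $T^*M\cong TM\otimes L^{-2}$; inner products and traces $\mathrm{tr}_c$ are taken with these weights. A Weyl structure $\nabla$ is a torsion-free connection on $TM$ with $\nabla c=0$ (with the induced connection on $L$). $F^\nabla\in\Lambda^2T^*M$ (Faraday form) is the curvature of the connection induced by $\nabla$ on $L$. Put $R^\nabla_{X,Y}Z=\nabla_X\nabla_YZ-\nabla_Y\nabla_XZ-\nabla_{[X,Y]}Z$, $\mathrm{Ric}^\nabla(X,Y)=\mathrm{tr}(Z\mapsto R^\nabla_{Z,X}Y)$, $\mathrm{Scal}^\nabla=\mathrm{tr}_c\mathrm{Ric}^\nabla$, and $\sigma^\nabla=\frac{1}{2(m-1)}\mathrm{Scal}^\nabla$ for $m\ge2$. Schouten-Weyl tensor $h^\nabla\in T^*M\otimes T^*M$. For $m\ge3$: $h^\nabla=\frac1{m-2}\mathrm{Ric}^{\nabla,s}_0+\frac1m\sigma^\nabla c-\frac12F^\nabla$, where $\mathrm{Ric}^{\nabla,s}_0$ is the symmetric trace-free part of $\mathrm{Ric}^\nabla$. For sections $l$ of $L^k$, $\mathrm{Hess}^\nabla(X,Y)l=\nabla_X\nabla_Yl-\nabla_{\nabla_XY}l$, and $\mathrm{Hess}^\nabla_0$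 is its symmetric trace-free part. A M\"obius structure on $(M,c)$, $m\ge2$, is a linear second order differential operator $\mathcal M:C^\infty(L)\to C^\infty(S^2_0T^*M\otimes L)$ such that $\mathcal M-\mathrm{Hess}_0^\nabla$ is of order zero for some (hence every) Weyl structure $\nabla$. On a M\"obius surface ($m=2$ with a fixed $\mathcal M$): $h^\nabla=h_0^{\mathcal M,\nabla}+\frac12\sigma^\nabla c-\frac12F^\nabla$ with $h_0^{\mathcal M,\nabla}:=\mathcal M-\mathrm{Hess}^\nabla_0$. A Laplace structure on a curve ($m=1$) is a linear second order operator $\mathcal L:C^\infty(L^{1/2})\to C^\infty(L^{-3/2})$ such that $\mathcal L-\mathrm{tr}_c\mathrm{Hess}^\nabla$ is of order zero for some (hence every) $\nabla$; a Laplace curve is a curve with a fixed Laplace structure, and then $h^\nabla=\sigma^{\mathcal L,\nabla}c$ with $\sigma^{\mathcal L,\nabla}:=2(\mathcal L-\mathrm{tr}_c\mathrm{Hess}^\nabla)$. The same definitions apply to $N$. Submanifolds. $N^n\subset M^m$ carries the induced conformal structure $c$; $\nu$ is its normal bundle, $TM|_N=TN\oplus\nu$, with components denoted by $(\cdot)^N,(\cdot)^\perp$. For a Weyl structure $\nabla$ on $M$: $\nabla^N_XY=(\nabla_XY)^N$ is the induced Weyl structure on $N$; $B^\nabla(X,Y)=(\nabla_XY)^\perp$ ($X,Y\in TN$) is the fundamental form; $H^\nabla\in\nu^*\cong\nu\otimes L^{-2}$, $H^\nabla(\xi)=-\frac1n\mathrm{tr}(X\mapsto(\nabla_X\xi)^N)$,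 is the mean curvature; $B^\nabla=H^\nabla\cdot c+B_0$ with $B_0\in S^2_0T^*N\otimes\nu$ trace-free, independent of $\nabla$. *)

theory Defs
  imports "HOL-Analysis.Analysis"
begin

section \<open>Smooth manifolds\<close>

primrec Ck_on :: "nat \<Rightarrow> 'v::real_normed_vector set \<Rightarrow> ('v \<Rightarrow> 'w::real_normed_vector) \<Rightarrow> bool" where
  "Ck_on 0 S f \<longleftrightarrow> continuous_on S f"
| "Ck_on (Suc k) S f \<longleftrightarrow> (\<forall>x\<in>S. f differentiable (at x)) \<and>
     (\<forall>v. Ck_on k S (\<lambda>x. frechet_derivative f (at x) v))"

definition smooth_on :: "'v::real_normed_vector set \<Rightarrow> ('v \<Rightarrow> 'w::real_normed_vector) \<Rightarrow> bool" where
  "smooth_on S f \<longleftrightarrow> (\<forall>k. Ck_on k S f)"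

type_synonym ('a, 'v) chart = "'a set \<times> ('a \<Rightarrow> 'v)"

text \<open>
  Besides its atlas, a manifold carries a preferred chart around every point.  Fibres of natural
  bundles at a point are identified with their model fibres by the preferred chart at that point:
  a tangent vector at \<open>p\<close> is a vector of the model space, namely its coordinates with respect to
  \<open>chart_at M p\<close>.  No continuity in \<open>p\<close> is required of the preferred charts; smoothness
  of sections always refers to components in one fixed chart.
\<close>

record ('a, 'v) manifold =
  mtop :: "'a topology"
  atlas :: "('a, 'v) chart set"
  chart_at :: "'a \<Rightarrow> ('a, 'v) chart"

definition points :: "('a, 'v) manifold \<Rightarrow> 'a set" where
  "points M = topspace (mtop M)"

definition in_chart :: "('a, 'v) chart \<Rightarrow> ('a \<Rightarrow> 'w) \<Rightarrow> 'v \<Rightarrow> 'w" where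
  "in_chart \<phi> f = (\<lambda>x. f (inv_into (fst \<phi>) (snd \<phi>) x))"

definition smooth_manifold :: "('a, real^'m) manifold \<Rightarrow> bool" where
  "smooth_manifold M \<longleftrightarrow>
     Hausdorff_space (mtop M) \<and> second_countable (mtop M) \<and>
     (\<forall>\<phi>\<in>atlas M. openin (mtop M) (fst \<phi>) \<and> open (snd \<phi> ` fst \<phi>) \<and>
        homeomorphic_map (subtopology (mtop M) (fst \<phi>)) (top_of_set (snd \<phi> ` fst \<phi>)) (snd \<phi>)) \<and>
     (\<forall>\<phi>\<in>atlas M. \<forall>\<psi>\<in>atlas M. smooth_on (snd \<phi> ` (fst \<phi> \<inter> fst \<psi>)) (in_chart \<phi> (snd \<psi>))) \<and>
     (\<forall>p\<in>points M. chart_at M p \<in> atlas M \<and> p \<in> fst (chart_at M p))"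

definition smooth_map_on ::
    "('a, real^'m) manifold \<Rightarrow> 'a set \<Rightarrow> ('a \<Rightarrow> 'w::real_normed_vector) \<Rightarrow> bool" where
  "smooth_map_on M U f \<longleftrightarrow> (\<forall>\<phi>\<in>atlas M. smooth_on (snd \<phi> ` (U \<inter> fst \<phi>)) (in_chart \<phi> f))"

definition near :: "('a, 'v) manifold \<Rightarrow> 'a \<Rightarrow> ('a set \<Rightarrow> bool) \<Rightarrow> bool" where
  "near M p P \<longleftrightarrow> (\<exists>U. openin (mtop M) U \<and> p \<in> U \<and> P U)"

text \<open>
  Differential at \<open>q\<close> of the coordinate expression, in charts \<open>\<phi>\<close> and \<open>\<psi>\<close>, of the identity or
  of an inclusion; the two charts may thus belong to different manifolds.
\<close>

definition jac :: "('a, real^'n) chart \<Rightarrow> ('a, real^'m) chart \<Rightarrow> 'a \<Rightarrow> real^'n \<Rightarrow> real^'m" where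
  "jac \<phi> \<psi> q = frechet_derivative (in_chart \<phi> (snd \<psi>)) (at (snd \<phi> q))"

definition dir_deriv ::
    "('a, real^'m) manifold \<Rightarrow> 'a \<Rightarrow> real^'m \<Rightarrow> ('a \<Rightarrow> 'w::real_normed_vector) \<Rightarrow> 'w" where
  "dir_deriv M p v f =
     frechet_derivative (in_chart (chart_at M p) f) (at (snd (chart_at M p) p)) v"


section \<open>Vector fields, densities and tensors\<close>

definition vec_comp ::
    "('a, real^'m) manifold \<Rightarrow> ('a, real^'m) chart \<Rightarrow> ('a \<Rightarrow> real^'m) \<Rightarrow> 'a \<Rightarrow> real^'m" where
  "vec_comp M \<phi> X q = jac (chart_at M q) \<phi> q (X q)"

definition smooth_vf :: "('a, real^'m) manifold \<Rightarrow> 'a set \<Rightarrow> ('a \<Rightarrow> real^'m) \<Rightarrow> bool" where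
  "smooth_vf M U X \<longleftrightarrow>
     (\<forall>\<phi>\<in>atlas M. smooth_on (snd \<phi> ` (U \<inter> fst \<phi>)) (in_chart \<phi> (vec_comp M \<phi> X)))"

text \<open>The local vector field extending \<open>v\<close> with constant components in the preferred chart at \<open>p\<close>.\<close>

definition vec_ext :: "('a, real^'m) manifold \<Rightarrow> 'a \<Rightarrow> real^'m \<Rightarrow> 'a \<Rightarrow> real^'m" where
  "vec_ext M p v q = jac (chart_at M p) (chart_at M q) q v"

definition lie_bracket ::
    "('a, real^'m) manifold \<Rightarrow> ('a \<Rightarrow> real^'m) \<Rightarrow> ('a \<Rightarrow> real^'m) \<Rightarrow> 'a \<Rightarrow> real^'m" where
  "lie_bracket M X Y p =
     dir_deriv M p (X p) (vec_comp M (chart_at M p) Y)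
     - dir_deriv M p (Y p) (vec_comp M (chart_at M p) X)"

text \<open>
  A section of \<open>L\<^sup>k\<close>, the bundle associated with the representation \<open>A \<mapsto> \<bar>det A\<bar> powr (k / m)\<close>
  of the structure group of the frame bundle, is a real function: its value at \<open>q\<close> is the component
  with respect to the coordinate frame of \<open>chart_at M q\<close>.  Tensor products of weighted fibres are
  therefore ordinary products.
\<close>

definition dens_comp ::
    "('a, real^'m) manifold \<Rightarrow> real \<Rightarrow> ('a, real^'m) chart \<Rightarrow> ('a \<Rightarrow> real) \<Rightarrow> 'a \<Rightarrow> real" where
  "dens_comp M k \<phi> s q =
     \<bar>det (matrix (jac (chart_at M q) \<phi> q))\<bar> powr (k / real CARD('m)) * s q"

definition smooth_dens ::
    "('a, real^'m) manifold \<Rightarrow> real \<Rightarrow> 'a set \<Rightarrow> ('a \<Rightarrow> real) \<Rightarrow> bool" where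
  "smooth_dens M k U s \<longleftrightarrow>
     (\<forall>\<phi>\<in>atlas M. smooth_on (snd \<phi> ` (U \<inter> fst \<phi>)) (in_chart \<phi> (dens_comp M k \<phi> s)))"

text \<open>Smooth sections of \<open>T\<^sup>*M \<otimes> T\<^sup>*M \<otimes> L\<^sup>k\<close>.\<close>

definition smooth_bil ::
    "('a, real^'m) manifold \<Rightarrow> real \<Rightarrow> ('a \<Rightarrow> real^'m \<Rightarrow> real^'m \<Rightarrow> real) \<Rightarrow> bool" where
  "smooth_bil M k b \<longleftrightarrow>
     (\<forall>p\<in>points M. bilinear (b p)) \<and>
     (\<forall>U X Y. openin (mtop M) U \<longrightarrow> smooth_vf M U X \<longrightarrow> smooth_vf M U Y \<longrightarrow>
        smooth_dens M k U (\<lambda>q. b q (X q) (Y q)))"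

definition endo_trace :: "(real^'m \<Rightarrow> real^'m) \<Rightarrow> real" where
  "endo_trace f = trace (matrix f)"

definition gram :: "(real^'m \<Rightarrow> real^'m \<Rightarrow> real) \<Rightarrow> real^'m^'m" where
  "gram b = (\<chi> i j. b (axis i 1) (axis j 1))"

definition tr_c :: "(real^'m \<Rightarrow> real^'m \<Rightarrow> real) \<Rightarrow> (real^'m \<Rightarrow> real^'m \<Rightarrow> real) \<Rightarrow> real" where
  "tr_c c b = trace (matrix_inv (gram c) ** gram b)"

definition sym0 ::
    "(real^'m \<Rightarrow> real^'m \<Rightarrow> real) \<Rightarrow> (real^'m \<Rightarrow> real^'m \<Rightarrow> real) \<Rightarrow> real^'m \<Rightarrow> real^'m \<Rightarrow> real" where
  "sym0 c b u v = (b u v + b v u) / 2 - tr_c c b / real CARD('m) * c u v"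


section \<open>Conformal structures and Weyl structures\<close>

text \<open>
  \<open>det c\<close> is a section of \<open>(\<Lambda>\<^sup>mT\<^sup>*M)\<^sup>2 \<otimes> L\<^sup>2\<^sup>m\<close>, which is canonically trivial, so the
  normalization may be expressed in the preferred frame.
\<close>

definition conformal_structure ::
    "('a, real^'m) manifold \<Rightarrow> ('a \<Rightarrow> real^'m \<Rightarrow> real^'m \<Rightarrow> real) \<Rightarrow> bool" where
  "conformal_structure M c \<longleftrightarrow>
     smooth_bil M 2 c \<and>
     (\<forall>p\<in>points M. (\<forall>u v. c p u v = c p v u) \<and> (\<forall>u. u \<noteq> 0 \<longrightarrow> c p u u > 0) \<and>
        \<bar>det (gram (c p))\<bar> = 1)"

text \<open>
  A connection \<open>D\<close> on \<open>TM\<close> acts on locally defined vector fields: \<open>D p v Y\<close> is the derivative of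
  \<open>Y\<close>, a vector field smooth near \<open>p\<close>, in the direction \<open>v\<close> at \<open>p\<close>, and only depends on the germ
  of \<open>Y\<close> at \<open>p\<close>.
\<close>

type_synonym ('a, 'v) conn = "'a \<Rightarrow> 'v \<Rightarrow> ('a \<Rightarrow> 'v) \<Rightarrow> 'v"

definition connection :: "('a, real^'m) manifold \<Rightarrow> ('a, real^'m) conn \<Rightarrow> bool" where
  "connection M D \<longleftrightarrow>
     (\<forall>p\<in>points M. \<forall>Y. near M p (\<lambda>U. smooth_vf M U Y) \<longrightarrow>
        linear (\<lambda>v. D p v Y) \<and>
        (\<forall>Z. near M p (\<lambda>U. \<forall>q\<in>U. Z q = Y q) \<longrightarrow> (\<forall>v. D p v Z = D p v Y)) \<and>
        (\<forall>Z. near M p (\<lambda>U. smooth_vf M U Z) \<longrightarrow>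
           (\<forall>v. D p v (\<lambda>q. Y q + Z q) = D p v Y + D p v Z)) \<and>
        (\<forall>f::'a \<Rightarrow> real. near M p (\<lambda>U. smooth_map_on M U f) \<longrightarrow>
           (\<forall>v. D p v (\<lambda>q. f q *\<^sub>R Y q) = dir_deriv M p v f *\<^sub>R Y p + f p *\<^sub>R D p v Y))) \<and>
     (\<forall>U X Y. openin (mtop M) U \<longrightarrow> smooth_vf M U X \<longrightarrow> smooth_vf M U Y \<longrightarrow>
        smooth_vf M U (\<lambda>p. D p (X p) Y))"

text \<open>
  The connection induced on the associated bundle \<open>L\<^sup>k\<close>: the derivative of the representation is
  \<open>(k / m) tr\<close>, here applied to the connection form of the coordinate frame.
\<close>

definition dens_conn ::
    "('a, real^'m) manifold \<Rightarrow> ('a, real^'m) conn \<Rightarrow> real \<Rightarrow> 'a \<Rightarrow> real^'m \<Rightarrow> ('a \<Rightarrow> real) \<Rightarrow> real" where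
  "dens_conn M D k p v s =
     dir_deriv M p v (dens_comp M k (chart_at M p) s)
     + k / real CARD('m) * endo_trace (\<lambda>w. D p v (vec_ext M p w)) * s p"

definition weyl_structure ::
    "('a, real^'m) manifold \<Rightarrow> ('a \<Rightarrow> real^'m \<Rightarrow> real^'m \<Rightarrow> real) \<Rightarrow> ('a, real^'m) conn \<Rightarrow> bool" where
  "weyl_structure M c D \<longleftrightarrow>
     connection M D \<and>
     (\<forall>p\<in>points M. \<forall>X Y. near M p (\<lambda>U. smooth_vf M U X \<and> smooth_vf M U Y) \<longrightarrow>
        D p (X p) Y - D p (Y p) X = lie_bracket M X Y p \<and>
        (\<forall>v. dens_conn M D 2 p v (\<lambda>q. c q (X q) (Y q)) =
           c p (D p v X) (Y p) + c p (X p) (D p v Y)))"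

text \<open>
  Tensors given by differential expressions (curvature, Hessian, and below the fundamental form)
  are evaluated on vectors at \<open>p\<close> by extending these to vector fields near \<open>p\<close>.
\<close>

definition curvature ::
    "('a, real^'m) manifold \<Rightarrow> ('a, real^'m) conn \<Rightarrow> 'a \<Rightarrow> real^'m \<Rightarrow> real^'m \<Rightarrow> real^'m \<Rightarrow> real^'m" where
  "curvature M D p u v w =
     (let X = vec_ext M p u; Y = vec_ext M p v; Z = vec_ext M p w in
       D p (X p) (\<lambda>q. D q (Y q) Z) - D p (Y p) (\<lambda>q. D q (X q) Z) - D p (lie_bracket M X Y p) Z)"

definition ricci ::
    "('a, real^'m) manifold \<Rightarrow> ('a, real^'m) conn \<Rightarrow> 'a \<Rightarrow> real^'m \<Rightarrow> real^'m \<Rightarrow> real" where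
  "ricci M D p u v = endo_trace (\<lambda>w. curvature M D p w u v)"

definition scal ::
    "('a, real^'m) manifold \<Rightarrow> ('a \<Rightarrow> real^'m \<Rightarrow> real^'m \<Rightarrow> real) \<Rightarrow> ('a, real^'m) conn \<Rightarrow> 'a \<Rightarrow> real" where
  "scal M c D p = tr_c (c p) (ricci M D p)"

definition sigma ::
    "('a, real^'m) manifold \<Rightarrow> ('a \<Rightarrow> real^'m \<Rightarrow> real^'m \<Rightarrow> real) \<Rightarrow> ('a, real^'m) conn \<Rightarrow> 'a \<Rightarrow> real" where
  "sigma M c D p = 1 / (2 * (real CARD('m) - 1)) * scal M c D p"

definition faraday ::
    "('a, real^'m) manifold \<Rightarrow> ('a, real^'m) conn \<Rightarrow> 'a \<Rightarrow> real^'m \<Rightarrow> real^'m \<Rightarrow> real" where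
  "faraday M D p u v =
     (let X = vec_ext M p u; Y = vec_ext M p v in
       THE a. \<forall>l. near M p (\<lambda>U. smooth_dens M 1 U l) \<longrightarrow>
         dens_conn M D 1 p (X p) (\<lambda>q. dens_conn M D 1 q (Y q) l)
         - dens_conn M D 1 p (Y p) (\<lambda>q. dens_conn M D 1 q (X q) l)
         - dens_conn M D 1 p (lie_bracket M X Y p) l = a * l p)"

definition hess ::
    "('a, real^'m) manifold \<Rightarrow> ('a, real^'m) conn \<Rightarrow> real \<Rightarrow> ('a \<Rightarrow> real) \<Rightarrow> 'a \<Rightarrow>
     real^'m \<Rightarrow> real^'m \<Rightarrow> real" where
  "hess M D k l p u v =
     (let X = vec_ext M p u; Y = vec_ext M p v in
       dens_conn M D k p (X p) (\<lambda>q. dens_conn M D k q (Y q) l) - dens_conn M D k p (D p (X p) Y) l)"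


section \<open>Moebius and Laplace structures\<close>

text \<open>
  Like connections, the differential operators act on germs: \<open>Q l p\<close> is defined for sections \<open>l\<close>
  that are smooth near \<open>p\<close>.  Two operators differ by an operator of order zero if their difference
  is multiplication by a smooth section of the bundle of homomorphisms, here \<open>S\<^sup>2\<^sub>0T\<^sup>*M\<close> and
  \<open>L\<^sup>-\<^sup>2\<close>, respectively.  Linearity, the order, and smoothness and (for Moebius structures) symmetry
  and trace-freeness of the values are consequences.
\<close>

type_synonym ('a, 'v) moebius_op = "('a \<Rightarrow> real) \<Rightarrow> 'a \<Rightarrow> 'v \<Rightarrow> 'v \<Rightarrow> real"
type_synonym 'a laplace_op = "('a \<Rightarrow> real) \<Rightarrow> 'a \<Rightarrow> real"

definition moebius_structure ::
    "('a, real^'m) manifold \<Rightarrow> ('a \<Rightarrow> real^'m \<Rightarrow> real^'m \<Rightarrow> real) \<Rightarrow> ('a, real^'m) moebius_op \<Rightarrow> bool" where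
  "moebius_structure M c Q \<longleftrightarrow>
     (\<exists>D A. weyl_structure M c D \<and> smooth_bil M 0 A \<and>
        (\<forall>p\<in>points M. (\<forall>u v. A p u v = A p v u) \<and> tr_c (c p) (A p) = 0 \<and>
           (\<forall>l. near M p (\<lambda>U. smooth_dens M 1 U l) \<longrightarrow>
              (\<forall>u v. Q l p u v - sym0 (c p) (hess M D 1 l p) u v = A p u v * l p))))"

definition laplace_structure ::
    "('a, real^'m) manifold \<Rightarrow> ('a \<Rightarrow> real^'m \<Rightarrow> real^'m \<Rightarrow> real) \<Rightarrow> 'a laplace_op \<Rightarrow> bool" where
  "laplace_structure M c Q \<longleftrightarrow>
     (\<exists>D a. weyl_structure M c D \<and> smooth_dens M (-2) (points M) a \<and>
        (\<forall>p\<in>points M. \<forall>l. near M p (\<lambda>U. smooth_dens M (1/2) U l) \<longrightarrow>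
           Q l p - tr_c (c p) (hess M D (1/2) l p) = a p * l p))"

definition h0_moebius ::
    "('a, real^'m) manifold \<Rightarrow> ('a \<Rightarrow> real^'m \<Rightarrow> real^'m \<Rightarrow> real) \<Rightarrow> ('a, real^'m) moebius_op \<Rightarrow>
     ('a, real^'m) conn \<Rightarrow> 'a \<Rightarrow> real^'m \<Rightarrow> real^'m \<Rightarrow> real" where
  "h0_moebius M c Q D p u v =
     (THE a. \<forall>l. near M p (\<lambda>U. smooth_dens M 1 U l) \<longrightarrow>
        Q l p u v - sym0 (c p) (hess M D 1 l p) u v = a * l p)"

definition sigma_laplace ::
    "('a, real^'m) manifold \<Rightarrow> ('a \<Rightarrow> real^'m \<Rightarrow> real^'m \<Rightarrow> real) \<Rightarrow> 'a laplace_op \<Rightarrow>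
     ('a, real^'m) conn \<Rightarrow> 'a \<Rightarrow> real" where
  "sigma_laplace M c Q D p =
     2 * (THE a. \<forall>l. near M p (\<lambda>U. smooth_dens M (1/2) U l) \<longrightarrow>
        Q l p - tr_c (c p) (hess M D (1/2) l p) = a * l p)"

text \<open>The three kinds of conformal manifolds on which a Schouten-Weyl tensor is available.\<close>

datatype ('a, 'v) kind =
    Conformal
  | Moebius_Surface "('a, 'v) moebius_op"
  | Laplace_Curve "'a laplace_op"

definition of_kind ::
    "('a, real^'m) manifold \<Rightarrow> ('a \<Rightarrow> real^'m \<Rightarrow> real^'m \<Rightarrow> real) \<Rightarrow> ('a, real^'m) kind \<Rightarrow> bool" where
  "of_kind M c K \<longleftrightarrow> (case K of
      Conformal \<Rightarrow> CARD('m) \<ge> 3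
    | Moebius_Surface Q \<Rightarrow> CARD('m) = 2 \<and> moebius_structure M c Q
    | Laplace_Curve Q \<Rightarrow> CARD('m) = 1 \<and> laplace_structure M c Q)"

definition schouten_weyl ::
    "('a, real^'m) manifold \<Rightarrow> ('a \<Rightarrow> real^'m \<Rightarrow> real^'m \<Rightarrow> real) \<Rightarrow> ('a, real^'m) kind \<Rightarrow>
     ('a, real^'m) conn \<Rightarrow> 'a \<Rightarrow> real^'m \<Rightarrow> real^'m \<Rightarrow> real" where
  "schouten_weyl M c K D p u v = (case K of
      Conformal \<Rightarrow>
        1 / (real CARD('m) - 2) * sym0 (c p) (ricci M D p) u v
        + 1 / real CARD('m) * sigma M c D p * c p u v - 1 / 2 * faraday M D p u v
    | Moebius_Surface Q \<Rightarrow>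
        h0_moebius M c Q D p u v + 1 / 2 * sigma M c D p * c p u v - 1 / 2 * faraday M D p u v
    | Laplace_Curve Q \<Rightarrow> sigma_laplace M c Q D p * c p u v)"


section \<open>Submanifolds\<close>

definition incl_d ::
    "('a, real^'m) manifold \<Rightarrow> ('a, real^'n) manifold \<Rightarrow> 'a \<Rightarrow> real^'n \<Rightarrow> real^'m" where
  "incl_d M N p = jac (chart_at N p) (chart_at M p) p"

text \<open>
  Immersed submanifolds: the topology of \<open>N\<close> may be finer than the subspace topology.
\<close>

definition submanifold :: "('a, real^'m) manifold \<Rightarrow> ('a, real^'n) manifold \<Rightarrow> bool" where
  "submanifold M N \<longleftrightarrow>
     smooth_manifold N \<and> points N \<subseteq> points M \<and> continuous_map (mtop N) (mtop M) (\<lambda>q. q) \<and>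
     (\<forall>\<phi>\<in>atlas N. \<forall>\<psi>\<in>atlas M. smooth_on (snd \<phi> ` (fst \<phi> \<inter> fst \<psi>)) (in_chart \<phi> (snd \<psi>))) \<and>
     (\<forall>p\<in>points N. inj (incl_d M N p))"

text \<open>
  The restriction of \<open>c\<close> to \<open>TN\<close> takes values in \<open>L\<^sup>2\<close> of the ambient manifold; identifying this
  bundle along \<open>N\<close> with \<open>L\<^sup>2\<close> of \<open>N\<close> amounts to normalizing the determinant.
\<close>

definition induced_conf ::
    "('a, real^'m) manifold \<Rightarrow> ('a \<Rightarrow> real^'m \<Rightarrow> real^'m \<Rightarrow> real) \<Rightarrow> ('a, real^'n) manifold \<Rightarrow>
     'a \<Rightarrow> real^'n \<Rightarrow> real^'n \<Rightarrow> real" where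
  "induced_conf M c N p x y =
     (let g = (\<lambda>x y. c p (incl_d M N p x) (incl_d M N p y)) in
       g x y / det (gram g) powr (1 / real CARD('n)))"

definition normal_space ::
    "('a, real^'m) manifold \<Rightarrow> ('a \<Rightarrow> real^'m \<Rightarrow> real^'m \<Rightarrow> real) \<Rightarrow> ('a, real^'n) manifold \<Rightarrow>
     'a \<Rightarrow> (real^'m) set" where
  "normal_space M c N p = {\<xi>. \<forall>x. c p \<xi> (incl_d M N p x) = 0}"

definition tan_part ::
    "('a, real^'m) manifold \<Rightarrow> ('a \<Rightarrow> real^'m \<Rightarrow> real^'m \<Rightarrow> real) \<Rightarrow> ('a, real^'n) manifold \<Rightarrow>
     'a \<Rightarrow> real^'m \<Rightarrow> real^'n" where
  "tan_part M c N p w = (THE x. w - incl_d M N p x \<in> normal_space M c N p)"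

definition nor_part ::
    "('a, real^'m) manifold \<Rightarrow> ('a \<Rightarrow> real^'m \<Rightarrow> real^'m \<Rightarrow> real) \<Rightarrow> ('a, real^'n) manifold \<Rightarrow>
     'a \<Rightarrow> real^'m \<Rightarrow> real^'m" where
  "nor_part M c N p w = w - incl_d M N p (tan_part M c N p w)"

text \<open>
  Derivative, in a direction tangent to \<open>N\<close>, of a section \<open>W\<close> of \<open>TM\<close> along \<open>N\<close>: expand
  \<open>W\<close> in the coordinate frame of the ambient preferred chart at \<open>p\<close>, then use the Leibniz rule.
\<close>

definition along_conn ::
    "('a, real^'m) manifold \<Rightarrow> ('a, real^'n) manifold \<Rightarrow> ('a, real^'m) conn \<Rightarrow>
     'a \<Rightarrow> real^'n \<Rightarrow> ('a \<Rightarrow> real^'m) \<Rightarrow> real^'m" where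
  "along_conn M N D p x W =
     dir_deriv N p x (vec_comp M (chart_at M p) W) + D p (incl_d M N p x) (vec_ext M p (W p))"

definition induced_conn ::
    "('a, real^'m) manifold \<Rightarrow> ('a \<Rightarrow> real^'m \<Rightarrow> real^'m \<Rightarrow> real) \<Rightarrow> ('a, real^'n) manifold \<Rightarrow>
     ('a, real^'m) conn \<Rightarrow> ('a, real^'n) conn" where
  "induced_conn M c N D p x Y = tan_part M c N p (along_conn M N D p x (\<lambda>q. incl_d M N q (Y q)))"

definition fund_form ::
    "('a, real^'m) manifold \<Rightarrow> ('a \<Rightarrow> real^'m \<Rightarrow> real^'m \<Rightarrow> real) \<Rightarrow> ('a, real^'n) manifold \<Rightarrow>
     ('a, real^'m) conn \<Rightarrow> 'a \<Rightarrow> real^'n \<Rightarrow> real^'n \<Rightarrow> real^'m" where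
  "fund_form M c N D p x y =
     nor_part M c N p (along_conn M N D p x (\<lambda>q. incl_d M N q (vec_ext N p y q)))"

text \<open>For \<open>\<xi>\<close> in the normal space at \<open>p\<close>, extended to a local section of the normal bundle.\<close>

definition mean_curv ::
    "('a, real^'m) manifold \<Rightarrow> ('a \<Rightarrow> real^'m \<Rightarrow> real^'m \<Rightarrow> real) \<Rightarrow> ('a, real^'n) manifold \<Rightarrow>
     ('a, real^'m) conn \<Rightarrow> 'a \<Rightarrow> real^'m \<Rightarrow> real" where
  "mean_curv M c N D p \<xi> =
     - (1 / real CARD('n)) * endo_trace (\<lambda>x. tan_part M c N p
          (along_conn M N D p x (\<lambda>q. nor_part M c N q (vec_ext M p \<xi> q))))"

text \<open>The mean curvature as a section of \<open>\<nu> \<otimes> L\<^sup>-\<^sup>2\<close>.\<close>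

definition mean_curv_vec ::
    "('a, real^'m) manifold \<Rightarrow> ('a \<Rightarrow> real^'m \<Rightarrow> real^'m \<Rightarrow> real) \<Rightarrow> ('a, real^'n) manifold \<Rightarrow>
     ('a, real^'m) conn \<Rightarrow> 'a \<Rightarrow> real^'m" where
  "mean_curv_vec M c N D p =
     (THE \<eta>. \<eta> \<in> normal_space M c N p \<and>
        (\<forall>\<xi>\<in>normal_space M c N p. c p \<eta> \<xi> = mean_curv M c N D p \<xi>))"

definition fund_form0 ::
    "('a, real^'m) manifold \<Rightarrow> ('a \<Rightarrow> real^'m \<Rightarrow> real^'m \<Rightarrow> real) \<Rightarrow> ('a, real^'n) manifold \<Rightarrow>
     ('a, real^'m) conn \<Rightarrow> 'a \<Rightarrow> real^'n \<Rightarrow> real^'n \<Rightarrow> real^'m" where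
  "fund_form0 M c N D p x y =
     fund_form M c N D p x y
     - c p (incl_d M N p x) (incl_d M N p y) *\<^sub>R mean_curv_vec M c N D p"

definition rel_schouten_weyl ::
    "('a, real^'m) manifold \<Rightarrow> ('a \<Rightarrow> real^'m \<Rightarrow> real^'m \<Rightarrow> real) \<Rightarrow> ('a, real^'m) kind \<Rightarrow>
     ('a, real^'n) manifold \<Rightarrow> ('a, real^'n) kind \<Rightarrow> ('a, real^'m) conn \<Rightarrow>
     'a \<Rightarrow> real^'n \<Rightarrow> real^'n \<Rightarrow> real" where
  "rel_schouten_weyl M c K N K' D p x y =
     (schouten_weyl M c K D p (incl_d M N p x) (incl_d M N p y)
      - schouten_weyl N (induced_conf M c N) K' (induced_conn M c N D) p x y)
     + 1 / 2 * c p (mean_curv_vec M c N D p) (mean_curv_vec M c N D p)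
         * c p (incl_d M N p x) (incl_d M N p y)
     + mean_curv M c N D p (fund_form0 M c N D p x y)"

end

theory Submission
  imports Defs
begin

text \<open>
  Two Weyl structures differ by a one-form \<open>\<gamma>\<close>, via
  \<open>D' X Y = D X Y + \<gamma>(X) Y + \<gamma>(Y) X - c(X, Y) \<gamma>\<^sup>#\<close>, and in all three cases the Schouten-Weyl tensor
  changes by \<open>- D\<gamma> + \<gamma> \<otimes> \<gamma> - (1/2) \<bar>\<gamma>\<bar>\<^sup>2 c\<close>.  On \<open>N\<close> the same law holds with the restriction of
  \<open>\<gamma>\<close>.  The two derivatives of \<open>\<gamma>\<close> differ by \<open>\<gamma>(B(X, Y))\<close>, the two norms by that of the normal part
  of \<open>\<gamma>\<close>, while the mean curvature changes by minus this normal part and \<open>B\<^sub>0\<close> not at all; since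
  \<open>B = H c + B\<^sub>0\<close>, everything cancels.  The skew part of \<open>h\<close> is \<open>- F / 2\<close>, and \<open>F\<close> of the induced Weyl
  structure is the restriction of \<open>F\<close>: the two connections on \<open>L\<close> differ along \<open>N\<close> by an exact form,
  namely half the logarithmic derivative of the density comparing the two normalizations of \<open>c\<close>.
\<close>

section \<open>Calculus of smooth functions\<close>

text \<open>The obstacle is the encoding of fibres: the value of a section at \<open>q\<close>
  refers to \<open>chart_at M q\<close>, which may jump with \<open>q\<close>, so no section can be
  differentiated as it stands. Every operator is conjugated by \<open>jac\<close> into one fixed
  chart, where the second derivatives of the transition maps have to cancel. The fixed chart is the
  preferred one at the point \<open>p\<close> in question, so that all conjugations are trivial at
  \<open>p\<close> and tensor identities can be read off there.

  The common law for the three kinds has different origins. The Ricci tensor yields the trace-free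
  part with a factor m - 2 that must be divided out. For m = 2 this factor vanishes and the Moebius
  operator takes over: weight 1 makes the first-order terms drop out of the change of the trace-free
  Hessian. For m = 1 weight 1/2 does the same for the trace of the Hessian.

  Connections and conformal structures are used through local predicates on a chart. The induced
  data on \<open>N\<close> are checked against these predicates directly, so that one computation
  serves both \<open>M\<close> and \<open>N\<close>.\<close>

lemma Ck_on_cong:
  assumes "open S" "\<And>x. x \<in> S \<Longrightarrow> f x = g x" "Ck_on k S f"
  shows "Ck_on k S g"
  using assms(2,3)
proof (induction k arbitrary: f g)
  case 0
  then show ?case by (simp cong: continuous_on_cong)
next
  case (Suc k)
  have fd: "frechet_derivative f (at x) = frechet_derivative g (at x)" and d: "g differentiable (at x)" if "x \<in> S" for x
  proof -
    have df: "f differentiable (at x)" using Suc.prems that by simp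
    show "frechet_derivative f (at x) = frechet_derivative g (at x)"
      using frechet_derivative_transform_within_open[OF df assms(1) that] Suc.prems(1) by blast
    show "g differentiable (at x)"
      using df has_derivative_transform_within_open[OF _ assms(1) that, of f _ UNIV g] Suc.prems(1)
      unfolding differentiable_def by blast
  qed
  have "Ck_on k S (\<lambda>x. frechet_derivative g (at x) v)" for v
    by (rule Suc.IH[of "\<lambda>x. frechet_derivative f (at x) v"]) (use fd Suc.prems in auto)
  then show ?case using d by simp
qed

lemma Ck_on_subset: "Ck_on k S f \<Longrightarrow> T \<subseteq> S \<Longrightarrow> Ck_on k T f"
  by (induction k arbitrary: f) (auto intro: continuous_on_subset)

lemma Ck_on_SucD: "Ck_on (Suc k) S f \<Longrightarrow> Ck_on k S f"
proof (induction k arbitrary: f)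
  case 0
  then show ?case
    by (auto simp: continuous_on_eq_continuous_at differentiable_imp_continuous_within
        intro!: continuous_at_imp_continuous_on)
next
  case (Suc k)
  then show ?case by auto
qed

lemma Ck_on_const: "Ck_on k S (\<lambda>_. a)"
  by (induction k arbitrary: a) (auto simp: frechet_derivative_const)

lemma Ck_on_SucI:
  assumes "open S" "\<And>x. x \<in> S \<Longrightarrow> (f has_derivative f' x) (at x)" "\<And>v. Ck_on k S (\<lambda>x. f' x v)"
  shows "Ck_on (Suc k) S f"
proof -
  have "frechet_derivative f (at x) = f' x" if "x \<in> S" for x
    using frechet_derivative_at[OF assms(2)[OF that]] by simp
  moreover have "f differentiable (at x)" if "x \<in> S" for x
    using assms(2) that differentiable_def by blast
  ultimately show ?thesis
    by (auto intro!: Ck_on_cong[OF assms(1) _ assms(3)])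
qed

lemma Ck_on_has_derivative:
  assumes "Ck_on (Suc k) S f" "x \<in> S"
  shows "(f has_derivative frechet_derivative f (at x)) (at x)"
  using assms by (simp add: frechet_derivative_works[symmetric])

lemma Ck_on_bounded_linear:
  assumes "bounded_linear h" "open S" "Ck_on k S f"
  shows "Ck_on k S (\<lambda>x. h (f x))"
  using assms(3)
proof (induction k arbitrary: f)
  case 0
  then show ?case by (simp add: bounded_linear.continuous_on[OF assms(1)])
next
  case (Suc k)
  show ?case
  proof (rule Ck_on_SucI[OF assms(2)])
    show "((\<lambda>x. h (f x)) has_derivative (\<lambda>v. h (frechet_derivative f (at x) v))) (at x)" if "x \<in> S" for x
      by (rule bounded_linear.has_derivative[OF assms(1) Ck_on_has_derivative[OF Suc.prems that]])
    show "Ck_on k S (\<lambda>x. h (frechet_derivative f (at x) v))" for v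
      by (rule Suc.IH) (use Suc.prems in simp)
  qed
qed

lemma Ck_on_add:
  assumes "open S" "Ck_on k S f" "Ck_on k S g"
  shows "Ck_on k S (\<lambda>x. f x + g x)"
  using assms(2,3)
proof (induction k arbitrary: f g)
  case 0
  then show ?case by (simp add: continuous_on_add)
next
  case (Suc k)
  show ?case
  proof (rule Ck_on_SucI[OF assms(1)])
    show "((\<lambda>x. f x + g x) has_derivative
        (\<lambda>v. frechet_derivative f (at x) v + frechet_derivative g (at x) v)) (at x)" if "x \<in> S" for x
      by (intro has_derivative_add Ck_on_has_derivative[OF Suc.prems(1) that] Ck_on_has_derivative[OF Suc.prems(2) that])
    show "Ck_on k S (\<lambda>x. frechet_derivative f (at x) v + frechet_derivative g (at x) v)" for v
      by (rule Suc.IH) (use Suc.prems in simp_all)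
  qed
qed

lemma Ck_on_sum:
  assumes "open S" "\<And>i. i \<in> I \<Longrightarrow> Ck_on k S (f i)"
  shows "Ck_on k S (\<lambda>x. \<Sum>i\<in>I. f i x)"
  using assms(2)
  by (induction I rule: infinite_finite_induct) (auto intro!: Ck_on_add Ck_on_const assms(1))

lemma Ck_on_bilinear:
  assumes "bounded_bilinear h" "open S" "Ck_on k S f" "Ck_on k S g"
  shows "Ck_on k S (\<lambda>x. h (f x) (g x))"
  using assms(3,4)
proof (induction k arbitrary: f g)
  case 0
  then show ?case by (simp add: bounded_bilinear.continuous_on[OF assms(1)])
next
  case (Suc k)
  show ?case
  proof (rule Ck_on_SucI[OF assms(2)])
    show "((\<lambda>x. h (f x) (g x)) has_derivative
        (\<lambda>v. h (f x) (frechet_derivative g (at x) v) + h (frechet_derivative f (at x) v) (g x))) (at x)"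
      if "x \<in> S" for x
      by (intro bounded_bilinear.FDERIV[OF assms(1)] Ck_on_has_derivative[OF Suc.prems(1) that] Ck_on_has_derivative[OF Suc.prems(2) that])
    show "Ck_on k S (\<lambda>x. h (f x) (frechet_derivative g (at x) v) + h (frechet_derivative f (at x) v) (g x))" for v
      by (intro Ck_on_add Suc.IH assms(2) Ck_on_SucD[OF Suc.prems(1)] Ck_on_SucD[OF Suc.prems(2)])
        (use Suc.prems in simp_all)
  qed
qed

lemma linear_sum_Basis:
  fixes f :: "'v::euclidean_space \<Rightarrow> 'w::real_vector"
  assumes "linear f"
  shows "f v = (\<Sum>b\<in>Basis. (v \<bullet> b) *\<^sub>R f b)"
proof -
  have "f v = f (\<Sum>b\<in>Basis. (v \<bullet> b) *\<^sub>R b)" by (simp add: euclidean_representation)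
  also have "\<dots> = (\<Sum>b\<in>Basis. (v \<bullet> b) *\<^sub>R f b)"
    by (simp add: linear_sum[OF assms] linear_cmul[OF assms])
  finally show ?thesis .
qed

text \<open>\<open>Ck_on\<close> controls the derivative only in constant directions, whereas the
  chain rule applies the derivative of \<open>f\<close> to the moving vector \<open>g'(x) v\<close>.
  Expanding this vector in \<open>Basis\<close> reduces to partial derivatives of \<open>f\<close>,
  to which the induction hypothesis applies.\<close>

lemma Ck_on_compose:
  fixes f :: "'v::euclidean_space \<Rightarrow> 'w::real_normed_vector" and g :: "'u::real_normed_vector \<Rightarrow> 'v"
  assumes "open S" "open T" "g ` S \<subseteq> T" "Ck_on k T f" "Ck_on k S g"
  shows "Ck_on k S (\<lambda>x. f (g x))"
  using assms(4,5)
proof (induction k arbitrary: f)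
  case 0
  then show ?case using continuous_on_compose2[OF _ _ assms(3)] by auto
next
  case (Suc k)
  show ?case
  proof (rule Ck_on_SucI[OF assms(1)])
    show "((\<lambda>x. f (g x)) has_derivative
        (\<lambda>v. frechet_derivative f (at (g x)) (frechet_derivative g (at x) v))) (at x)" if "x \<in> S" for x
      by (rule has_derivative_compose[OF Ck_on_has_derivative[OF Suc.prems(2) that]
            Ck_on_has_derivative[OF Suc.prems(1)]]) (use that assms(3) in auto)
    have lin: "linear (frechet_derivative f (at (g x)))" if "x \<in> S" for x
      using Suc.prems(1) that assms(3) by (intro linear_frechet_derivative) auto
    have "Ck_on k S (\<lambda>x. \<Sum>b\<in>Basis. (frechet_derivative g (at x) v \<bullet> b) *\<^sub>R frechet_derivative f (at (g x)) b)" for v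
      by (intro Ck_on_sum assms(1) Ck_on_bilinear[OF bounded_bilinear_scaleR]
          Ck_on_bounded_linear[OF bounded_linear_inner_left] Suc.IH
          Ck_on_SucD[OF Suc.prems(2)])
        (use Suc.prems in simp_all)
    then show "Ck_on k S (\<lambda>x. frechet_derivative f (at (g x)) (frechet_derivative g (at x) v))" for v
      by (rule Ck_on_cong[OF assms(1), rotated]) (simp add: linear_sum_Basis[OF lin, symmetric])
  qed
qed

lemma Ck_on_inverse:
  fixes f :: "'v::real_normed_vector \<Rightarrow> real"
  assumes "open S" "\<And>x. x \<in> S \<Longrightarrow> f x \<noteq> 0" "Ck_on k S f"
  shows "Ck_on k S (\<lambda>x. inverse (f x))"
  using assms(3)
proof (induction k)
  case 0
  then show ?case using assms(2) by (auto intro: continuous_on_inverse)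
next
  case (Suc k)
  show ?case
  proof (rule Ck_on_SucI[OF assms(1)])
    \<comment> \<open>The derivative is written with \<open>inverse (f x)\<close> itself, so that
      the induction hypothesis covers every factor.\<close>
    show "((\<lambda>x. inverse (f x)) has_derivative
        (\<lambda>v. - 1 * (inverse (f x) * frechet_derivative f (at x) v * inverse (f x)))) (at x)" if "x \<in> S" for x
      using Deriv.has_derivative_inverse[OF assms(2)[OF that] Ck_on_has_derivative[OF Suc.prems that]] by simp
    show "Ck_on k S (\<lambda>x. - 1 * (inverse (f x) * frechet_derivative f (at x) v * inverse (f x)))" for v
      by (intro Ck_on_bilinear[OF bounded_bilinear_mult] assms(1) Ck_on_const Suc.IH Ck_on_SucD[OF Suc.prems])
        (use Suc.prems in simp)
  qed
qed

text \<open>Differentiation lowers the exponent to \<open>a - 1\<close>, hence the induction over an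
  arbitrary exponent.\<close>

lemma Ck_on_powr:
  fixes f :: "'v::real_normed_vector \<Rightarrow> real"
  assumes "open S" "\<And>x. x \<in> S \<Longrightarrow> f x > 0" "Ck_on k S f"
  shows "Ck_on k S (\<lambda>x. f x powr a)"
  using assms(3)
proof (induction k arbitrary: a)
  case 0
  then show ?case using assms(2) by (auto intro!: continuous_on_powr simp: less_le)
next
  case (Suc k)
  show ?case
  proof (rule Ck_on_SucI[OF assms(1)])
    show "((\<lambda>x. f x powr a) has_derivative
        (\<lambda>v. a * (f x powr (a - 1) * frechet_derivative f (at x) v))) (at x)" if "x \<in> S" for x
      using has_derivative_powr[OF Ck_on_has_derivative[OF Suc.prems that] has_derivative_const, of a]
        assms(2)[OF that] by (simp add: powr_diff field_simps)
    show "Ck_on k S (\<lambda>x. a * (f x powr (a - 1) * frechet_derivative f (at x) v))" for v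
      by (intro Ck_on_bilinear[OF bounded_bilinear_mult] assms(1) Ck_on_const Suc.IH Ck_on_SucD[OF Suc.prems])
        (use Suc.prems in simp)
  qed
qed

section \<open>Closure properties of infinitely differentiable functions\<close>

lemma smooth_on_cong: "open S \<Longrightarrow> (\<And>x. x \<in> S \<Longrightarrow> f x = g x) \<Longrightarrow> smooth_on S f \<Longrightarrow> smooth_on S g"
  unfolding smooth_on_def using Ck_on_cong by blast

lemma smooth_on_subset: "smooth_on S f \<Longrightarrow> T \<subseteq> S \<Longrightarrow> smooth_on T f"
  unfolding smooth_on_def using Ck_on_subset by blast

lemma smooth_on_const: "smooth_on S (\<lambda>_. a)"
  unfolding smooth_on_def by (simp add: Ck_on_const)

lemma smooth_on_bounded_linear: "bounded_linear h \<Longrightarrow> open S \<Longrightarrow> smooth_on S f \<Longrightarrow> smooth_on S (\<lambda>x. h (f x))"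
  unfolding smooth_on_def by (simp add: Ck_on_bounded_linear)

lemma smooth_on_add: "open S \<Longrightarrow> smooth_on S f \<Longrightarrow> smooth_on S g \<Longrightarrow> smooth_on S (\<lambda>x. f x + g x)"
  unfolding smooth_on_def by (simp add: Ck_on_add)

lemma smooth_on_sum: "open S \<Longrightarrow> (\<And>i. i \<in> I \<Longrightarrow> smooth_on S (f i)) \<Longrightarrow> smooth_on S (\<lambda>x. \<Sum>i\<in>I. f i x)"
  unfolding smooth_on_def by (simp add: Ck_on_sum)

lemma smooth_on_bilinear:
  "bounded_bilinear h \<Longrightarrow> open S \<Longrightarrow> smooth_on S f \<Longrightarrow> smooth_on S g \<Longrightarrow> smooth_on S (\<lambda>x. h (f x) (g x))"
  unfolding smooth_on_def by (simp add: Ck_on_bilinear)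

lemma smooth_on_compose:
  fixes f :: "'v::euclidean_space \<Rightarrow> 'w::real_normed_vector"
  shows "open S \<Longrightarrow> open T \<Longrightarrow> g ` S \<subseteq> T \<Longrightarrow> smooth_on T f \<Longrightarrow> smooth_on S g \<Longrightarrow> smooth_on S (\<lambda>x. f (g x))"
  unfolding smooth_on_def by (intro allI, rule Ck_on_compose[of S T g]) auto

lemma smooth_on_inverse:
  fixes f :: "'v::real_normed_vector \<Rightarrow> real"
  shows "open S \<Longrightarrow> (\<And>x. x \<in> S \<Longrightarrow> f x \<noteq> 0) \<Longrightarrow> smooth_on S f \<Longrightarrow> smooth_on S (\<lambda>x. inverse (f x))"
  unfolding smooth_on_def by (simp add: Ck_on_inverse)

lemma smooth_on_powr:
  fixes f :: "'v::real_normed_vector \<Rightarrow> real"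
  shows "open S \<Longrightarrow> (\<And>x. x \<in> S \<Longrightarrow> f x > 0) \<Longrightarrow> smooth_on S f \<Longrightarrow> smooth_on S (\<lambda>x. f x powr a)"
  unfolding smooth_on_def by (simp add: Ck_on_powr)

lemma smooth_on_differentiable: "smooth_on S f \<Longrightarrow> x \<in> S \<Longrightarrow> f differentiable (at x)"
  unfolding smooth_on_def by (auto dest: spec[of _ "Suc 0"])

lemma smooth_on_frechet_derivative: "smooth_on S f \<Longrightarrow> smooth_on S (\<lambda>x. frechet_derivative f (at x) v)"
  unfolding smooth_on_def
proof
  fix k
  assume "\<forall>k. Ck_on k S f"
  then have "Ck_on (Suc k) S f" by blast
  then show "Ck_on k S (\<lambda>x. frechet_derivative f (at x) v)" by simp
qed

lemma smooth_on_mult: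
  fixes f g :: "'v::real_normed_vector \<Rightarrow> real"
  shows "open S \<Longrightarrow> smooth_on S f \<Longrightarrow> smooth_on S g \<Longrightarrow> smooth_on S (\<lambda>x. f x * g x)"
  by (rule smooth_on_bilinear[OF bounded_bilinear_mult])

lemma smooth_on_prod:
  fixes f :: "'i \<Rightarrow> 'v::real_normed_vector \<Rightarrow> real"
  assumes "open S" "\<And>i. i \<in> I \<Longrightarrow> smooth_on S (f i)"
  shows "smooth_on S (\<lambda>x. \<Prod>i\<in>I. f i x)"
  using assms(2)
  by (induction I rule: infinite_finite_induct) (auto intro!: smooth_on_mult smooth_on_const assms(1))

lemma smooth_on_vec_lambda:
  fixes f :: "'v::real_normed_vector \<Rightarrow> 'n::finite \<Rightarrow> real"
  assumes "open S" "\<And>i. smooth_on S (\<lambda>x. f x i)"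
  shows "smooth_on S (\<lambda>x. \<chi> i. f x i)"
proof -
  have "smooth_on S (\<lambda>x. \<Sum>i\<in>UNIV. f x i *\<^sub>R axis i (1::real))"
    by (intro smooth_on_sum assms(1) smooth_on_bilinear[OF bounded_bilinear_scaleR] smooth_on_const assms(2))
  moreover have "(\<Sum>i\<in>UNIV. f x i *\<^sub>R axis i (1::real)) = (\<chi> i. f x i)" for x
    using basis_expansion[of "\<chi> i. f x i"] by (simp add: scalar_mult_eq_scaleR)
  ultimately show ?thesis by simp
qed

lemma smooth_on_det:
  fixes A :: "'v::real_normed_vector \<Rightarrow> 'n::finite \<Rightarrow> 'n \<Rightarrow> real"
  assumes "open S" "\<And>i j. smooth_on S (\<lambda>x. A x i j)"
  shows "smooth_on S (\<lambda>x. det (\<chi> i j. A x i j))"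
  unfolding det_def
  by (simp, intro smooth_on_sum smooth_on_mult smooth_on_prod smooth_on_const assms)

text \<open>Squaring removes the absolute value, which is not differentiable at 0. Powers of a
  nonvanishing Jacobian determinant thereby become powers of a positive smooth function.\<close>

lemma abs_powr_eq: "\<bar>y\<bar> powr a = (y * y) powr (a / 2)" for y :: real
proof -
  have "(y * y) powr (a / 2) = (\<bar>y\<bar> * \<bar>y\<bar>) powr (a / 2)" by simp
  also have "\<dots> = \<bar>y\<bar> powr a"
    by (subst powr_mult) (auto simp flip: powr_add)
  finally show ?thesis by simp
qed

lemma smooth_on_abs_powr:
  fixes f :: "'v::real_normed_vector \<Rightarrow> real"
  assumes "open S" "\<And>x. x \<in> S \<Longrightarrow> f x \<noteq> 0" "smooth_on S f"
  shows "smooth_on S (\<lambda>x. \<bar>f x\<bar> powr a)"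
  unfolding abs_powr_eq
  by (intro smooth_on_powr smooth_on_mult assms) (use assms in \<open>auto simp: zero_less_mult_iff linorder_neq_iff\<close>)

section \<open>Calculus in charts\<close>

text \<open>The mixed second difference is symmetric in \<open>u\<close> and \<open>v\<close>, while
  its limit after division by \<open>t\<^sup>2\<close> is a mixed second derivative in a prescribed
  order. The mean value theorem is applied to the increment in direction \<open>v\<close>, as a
  function of the step in direction \<open>u\<close>; the two values of the first derivative are
  then compared through its linearization at \<open>x\<close>.\<close>

lemma second_difference:
  fixes f :: "'v::real_normed_vector \<Rightarrow> real"
  assumes S: "open S" "x \<in> S" and df: "\<And>y. y \<in> S \<Longrightarrow> f differentiable (at y)"
    and F: "((\<lambda>y. frechet_derivative f (at y) u) has_derivative F') (at x)" and e: "e > 0"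
  shows "\<exists>d>0. \<forall>t. 0 < t \<and> t < d \<longrightarrow>
    \<bar>f (x + t *\<^sub>R u + t *\<^sub>R v) - f (x + t *\<^sub>R u) - f (x + t *\<^sub>R v) + f x - t\<^sup>2 * F' v\<bar> \<le> e * t\<^sup>2"
proof -
  \<comment> \<open>The two linearization errors are at most \<open>e / K\<close> times
    \<open>t * (norm u + norm v)\<close> and \<open>t * norm u\<close>, which accounts for the
    coefficients. The summand 1 keeps \<open>K\<close> positive when both vectors vanish.\<close>
  define K where "K = 2 * norm u + norm v + 1"
  have K: "K > 0" unfolding K_def by (smt (verit) norm_ge_zero)
  define F where "F = (\<lambda>y. frechet_derivative f (at y) u)"
  have linF: "linear F'" using F has_derivative_linear by blast
  obtain r where r: "r > 0" "ball x r \<subseteq> S" using S open_contains_ball by blast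
  have eK: "e / K > 0" using e K by simp
  obtain d where d: "d > 0" "\<And>y. norm (y - x) < d \<Longrightarrow> \<bar>F y - F x - F' (y - x)\<bar> \<le> e / K * norm (y - x)"
    using F eK unfolding has_derivative_at_alt F_def by (metis real_norm_def)
  define d' where "d' = min r d / K"
  have d': "d' > 0" using r d K by (simp add: d'_def)
  show ?thesis
  proof (intro exI[of _ d'] conjI d' allI impI)
    fix t :: real assume t: "0 < t \<and> t < d'"
    have small: "norm (s *\<^sub>R u + a *\<^sub>R v) < min r d" if "0 \<le> s" "s \<le> t" "0 \<le> a" "a \<le> t" for s a
    proof -
      have "norm (s *\<^sub>R u + a *\<^sub>R v) \<le> s * norm u + a * norm v"
        using that norm_triangle_ineq[of "s *\<^sub>R u" "a *\<^sub>R v"] by simp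
      also have "\<dots> \<le> t * norm u + t * norm v"
        by (intro add_mono mult_right_mono that norm_ge_zero)
      also have "\<dots> \<le> t * K"
        using t by (simp add: K_def flip: distrib_left)
      also have "\<dots> < min r d" using t K by (simp add: d'_def field_simps)
      finally show ?thesis .
    qed
    have inS: "x + s *\<^sub>R u + a *\<^sub>R v \<in> S" if "0 \<le> s" "s \<le> t" "0 \<le> a" "a \<le> t" for s a
    proof -
      have "dist x (x + s *\<^sub>R u + a *\<^sub>R v) = norm (s *\<^sub>R u + a *\<^sub>R v)"
        unfolding dist_norm norm_minus_commute[of x] by (simp add: algebra_simps)
      then have "dist x (x + s *\<^sub>R u + a *\<^sub>R v) < r"
        using small[OF that] by simp
      then show ?thesis using r by auto
    qed
    \<comment> \<open>Increment in direction \<open>v\<close> with fixed step \<open>t\<close>; its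
      derivative in \<open>s\<close> is a difference of two values of \<open>F\<close>.\<close>
    define g where "g = (\<lambda>s. f (x + s *\<^sub>R u + t *\<^sub>R v) - f (x + s *\<^sub>R u))"
    have der: "((\<lambda>s. f (x + s *\<^sub>R u + a *\<^sub>R v)) has_real_derivative F (x + s *\<^sub>R u + a *\<^sub>R v)) (at s)"
      if "0 \<le> s" "s \<le> t" "0 \<le> a" "a \<le> t" for s a
    proof -
      have 1: "((\<lambda>s. x + s *\<^sub>R u + a *\<^sub>R v) has_derivative (\<lambda>h. h *\<^sub>R u)) (at s)"
        by (auto intro!: derivative_eq_intros)
      have 2: "(f has_derivative frechet_derivative f (at (x + s *\<^sub>R u + a *\<^sub>R v))) (at (x + s *\<^sub>R u + a *\<^sub>R v))"
        using df[OF inS[OF that]] frechet_derivative_works by blast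
      have "linear (frechet_derivative f (at (x + s *\<^sub>R u + a *\<^sub>R v)))"
        using df[OF inS[OF that]] linear_frechet_derivative by blast
      then show ?thesis
        using has_derivative_compose[OF 1 2]
        by (simp add: has_field_derivative_def F_def linear_cmul mult.commute[of _ "frechet_derivative _ _ _"] mult_commute_abs)
    qed
    have dg: "(g has_real_derivative F (x + s *\<^sub>R u + t *\<^sub>R v) - F (x + s *\<^sub>R u)) (at s)" if "0 \<le> s" "s \<le> t" for s
      unfolding g_def using der[of s 0] der[of s t] that t by (auto intro!: derivative_eq_intros)
    obtain s where s: "0 < s" "s < t" "g t - g 0 = (t - 0) * (F (x + s *\<^sub>R u + t *\<^sub>R v) - F (x + s *\<^sub>R u))"
      using MVT2[of 0 t g "\<lambda>s. F (x + s *\<^sub>R u + t *\<^sub>R v) - F (x + s *\<^sub>R u)"] t dg by auto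
    have n1: "norm (s *\<^sub>R u + t *\<^sub>R v) \<le> t * (norm u + norm v)"
      using norm_triangle_ineq[of "s *\<^sub>R u" "t *\<^sub>R v"] s t
        mult_right_mono[of s t "norm u"] by (simp add: distrib_left)
    have n2: "norm (s *\<^sub>R u) \<le> t * norm u" using s by (simp add: mult_right_mono)
    have b1: "\<bar>F (x + s *\<^sub>R u + t *\<^sub>R v) - F x - F' (s *\<^sub>R u + t *\<^sub>R v)\<bar> \<le> e / K * (t * (norm u + norm v))"
      using d(2)[of "x + s *\<^sub>R u + t *\<^sub>R v"] small[of s t] s t n1 mult_left_mono[OF n1, of "e / K"] eK
      by (simp add: add.assoc)
    have b2: "\<bar>F (x + s *\<^sub>R u) - F x - F' (s *\<^sub>R u)\<bar> \<le> e / K * (t * norm u)"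
      using d(2)[of "x + s *\<^sub>R u"] small[of s 0] s t n2 mult_left_mono[OF n2, of "e / K"] eK
      by simp
    have "F' (s *\<^sub>R u + t *\<^sub>R v) = F' (s *\<^sub>R u) + t * F' v"
      by (simp add: linear_add[OF linF] linear_cmul[OF linF])
    then have b: "\<bar>F (x + s *\<^sub>R u + t *\<^sub>R v) - F (x + s *\<^sub>R u) - t * F' v\<bar> \<le> e / K * (t * (norm u + norm v)) + e / K * (t * norm u)"
      using b1 b2 by linarith
    also have "\<dots> = e / K * t * (2 * norm u + norm v)" by (simp only: distrib_left mult_2 ac_simps)
    also have "\<dots> \<le> e / K * t * K" proof (rule mult_left_mono)
      show "2 * norm u + norm v \<le> K" by (simp add: K_def)
      show "0 \<le> e / K * t" using mult_pos_pos[OF eK, of t] t by simp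
    qed
    also have "\<dots> = e * t" using K by simp
    finally have b: "\<bar>F (x + s *\<^sub>R u + t *\<^sub>R v) - F (x + s *\<^sub>R u) - t * F' v\<bar> \<le> e * t" .
    have "f (x + t *\<^sub>R u + t *\<^sub>R v) - f (x + t *\<^sub>R u) - f (x + t *\<^sub>R v) + f x - t\<^sup>2 * F' v
        = t * (F (x + s *\<^sub>R u + t *\<^sub>R v) - F (x + s *\<^sub>R u) - t * F' v)"
      using s(3) by (simp add: g_def power2_eq_square algebra_simps)
    also have "\<bar>\<dots>\<bar> = t * \<bar>F (x + s *\<^sub>R u + t *\<^sub>R v) - F (x + s *\<^sub>R u) - t * F' v\<bar>"
      using t by (simp add: abs_mult)
    also have "\<dots> \<le> t * (e * t)" using b t by (intro mult_left_mono) auto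
    finally show "\<bar>f (x + t *\<^sub>R u + t *\<^sub>R v) - f (x + t *\<^sub>R u) - f (x + t *\<^sub>R v) + f x - t\<^sup>2 * F' v\<bar> \<le> e * t\<^sup>2"
      by (simp add: power2_eq_square ac_simps)
  qed
qed

text \<open>Both mixed derivatives approximate the same second difference to within an arbitrarily
  small multiple of \<open>t\<^sup>2\<close>.\<close>

lemma second_derivative_symmetric_real:
  fixes f :: "'v::real_normed_vector \<Rightarrow> real"
  assumes S: "open S" "x \<in> S" and sm: "smooth_on S f"
  shows "frechet_derivative (\<lambda>y. frechet_derivative f (at y) u) (at x) v
       = frechet_derivative (\<lambda>y. frechet_derivative f (at y) v) (at x) u" (is "?A = ?B")
proof (rule ccontr)
  assume ne: "?A \<noteq> ?B"
  \<comment> \<open>Two errors of size \<open>e * t\<^sup>2\<close> cannot bridge a gap of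
    \<open>3 * e * t\<^sup>2\<close>.\<close>
  define e where "e = \<bar>?A - ?B\<bar> / 3"
  have e: "e > 0" using ne by (simp add: e_def)
  have df: "\<And>y. y \<in> S \<Longrightarrow> f differentiable (at y)" using sm smooth_on_differentiable by blast
  have D: "((\<lambda>y. frechet_derivative f (at y) w) has_derivative
      frechet_derivative (\<lambda>y. frechet_derivative f (at y) w) (at x)) (at x)" for w
    using smooth_on_differentiable[OF smooth_on_frechet_derivative[OF sm] S(2)] frechet_derivative_works by blast
  obtain d1 d2 where d: "d1 > 0" "d2 > 0"
    and d1: "\<And>t. 0 < t \<Longrightarrow> t < d1 \<Longrightarrow>
      \<bar>f (x + t *\<^sub>R u + t *\<^sub>R v) - f (x + t *\<^sub>R u) - f (x + t *\<^sub>R v) + f x - t\<^sup>2 * ?A\<bar> \<le> e * t\<^sup>2"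
    and d2: "\<And>t. 0 < t \<Longrightarrow> t < d2 \<Longrightarrow>
      \<bar>f (x + t *\<^sub>R v + t *\<^sub>R u) - f (x + t *\<^sub>R v) - f (x + t *\<^sub>R u) + f x - t\<^sup>2 * ?B\<bar> \<le> e * t\<^sup>2"
    using second_difference[OF S df D e, of u v] second_difference[OF S df D e, of v u] by blast
  define t where "t = min d1 d2 / 2"
  have t: "0 < t" "t < d1" "t < d2" using d by (auto simp: t_def)
  have "x + t *\<^sub>R v + t *\<^sub>R u = x + t *\<^sub>R u + t *\<^sub>R v" by simp
  then have "\<bar>t\<^sup>2 * ?A - t\<^sup>2 * ?B\<bar> \<le> 2 * (e * t\<^sup>2)"
    using d1[OF t(1,2)] d2[OF t(1,3)] by (smt (verit))
  moreover have "\<bar>t\<^sup>2 * ?A - t\<^sup>2 * ?B\<bar> = t\<^sup>2 * (3 * e)"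
    by (simp add: e_def abs_mult flip: right_diff_distrib)
  ultimately have "t\<^sup>2 * (3 * e) \<le> 2 * (e * t\<^sup>2)" by simp
  then have "t\<^sup>2 * e \<le> 0" by (simp add: algebra_simps)
  then show False using t e by (simp add: mult_le_0_iff)
qed

lemma second_derivative_symmetric:
  fixes f :: "'v::real_normed_vector \<Rightarrow> 'w::euclidean_space"
  assumes S: "open S" "x \<in> S" and sm: "smooth_on S f"
  shows "frechet_derivative (\<lambda>y. frechet_derivative f (at y) u) (at x) v
       = frechet_derivative (\<lambda>y. frechet_derivative f (at y) v) (at x) u"
proof (rule euclidean_eqI)
  fix b :: 'w assume "b \<in> Basis"
  have D: "frechet_derivative (\<lambda>y. g y \<bullet> b) (at y) w = frechet_derivative g (at y) w \<bullet> b"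
    if "g differentiable (at y)" for g :: "'v \<Rightarrow> 'w" and y w
  proof -
    have "((\<lambda>y. g y \<bullet> b) has_derivative (\<lambda>w. frechet_derivative g (at y) w \<bullet> b)) (at y)"
      using that by (intro has_derivative_inner_left) (simp add: frechet_derivative_works)
    from frechet_derivative_at[OF this] show ?thesis by metis
  qed
  have smb: "smooth_on S (\<lambda>y. f y \<bullet> b)"
    by (rule smooth_on_bounded_linear[OF bounded_linear_inner_left S(1) sm])
  have *: "frechet_derivative (\<lambda>y. frechet_derivative f (at y) u) (at x) v \<bullet> b =
      frechet_derivative (\<lambda>y. frechet_derivative (\<lambda>y. f y \<bullet> b) (at y) u) (at x) v" for u v
  proof -
    have d: "(\<lambda>y. frechet_derivative f (at y) u \<bullet> b) differentiable (at x)"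
      by (intro smooth_on_differentiable[OF _ S(2)] smooth_on_bounded_linear[OF bounded_linear_inner_left S(1)]
          smooth_on_frechet_derivative sm)
    have "frechet_derivative (\<lambda>y. frechet_derivative f (at y) u) (at x) v \<bullet> b =
       frechet_derivative (\<lambda>y. frechet_derivative f (at y) u \<bullet> b) (at x) v"
      by (rule D[symmetric]) (rule smooth_on_differentiable[OF smooth_on_frechet_derivative[OF sm] S(2)])
    also have "\<dots> = frechet_derivative (\<lambda>y. frechet_derivative (\<lambda>y. f y \<bullet> b) (at y) u) (at x) v"
      by (rule fun_cong[OF frechet_derivative_transform_within_open[OF d S]])
        (use D smooth_on_differentiable[OF sm] in metis)
    finally show ?thesis .
  qed
  show "frechet_derivative (\<lambda>y. frechet_derivative f (at y) u) (at x) v \<bullet> b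
       = frechet_derivative (\<lambda>y. frechet_derivative f (at y) v) (at x) u \<bullet> b"
    unfolding * by (rule second_derivative_symmetric_real[OF S smb])
qed

text \<open>The properties of a chart on which differential calculus rests, stated without a
  manifold or a topology on the points. The same rules then serve charts of \<open>M\<close> and of
  \<open>N\<close>.\<close>

definition chart_open :: "('a, 'v::topological_space) chart \<Rightarrow> 'a set \<Rightarrow> bool" where
  "chart_open \<phi> U \<longleftrightarrow> U \<subseteq> fst \<phi> \<and> inj_on (snd \<phi>) (fst \<phi>) \<and> open (snd \<phi> ` U)"

definition smooth_in ::
    "('a, 'v::real_normed_vector) chart \<Rightarrow> 'a set \<Rightarrow> ('a \<Rightarrow> 'w::real_normed_vector) \<Rightarrow> bool" where
  "smooth_in \<phi> U f \<longleftrightarrow> smooth_on (snd \<phi> ` U) (in_chart \<phi> f)"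

definition has_dchart ::
    "('a, 'v::real_normed_vector) chart \<Rightarrow> ('a \<Rightarrow> 'w::real_normed_vector) \<Rightarrow> ('v \<Rightarrow> 'w) \<Rightarrow> 'a \<Rightarrow> bool" where
  "has_dchart \<phi> f f' q \<longleftrightarrow> (in_chart \<phi> f has_derivative f') (at (snd \<phi> q))"

text \<open>A common form of \<open>jac\<close> and \<open>dir_deriv\<close>, which differ only in
  the function differentiated and in the chart.\<close>

definition dchart ::
    "('a, 'v::real_normed_vector) chart \<Rightarrow> ('a \<Rightarrow> 'w::real_normed_vector) \<Rightarrow> 'a \<Rightarrow> 'v \<Rightarrow> 'w" where
  "dchart \<phi> f q = frechet_derivative (in_chart \<phi> f) (at (snd \<phi> q))"

lemma jac_eq_dchart: "jac \<phi> \<psi> q = dchart \<phi> (snd \<psi>) q"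
  by (simp add: jac_def dchart_def)

lemma dir_deriv_eq_dchart: "dir_deriv M p v f = dchart (chart_at M p) f p v"
  by (simp add: dir_deriv_def dchart_def)

lemma in_chart_at: "chart_open \<phi> U \<Longrightarrow> q \<in> U \<Longrightarrow> in_chart \<phi> f (snd \<phi> q) = f q"
  unfolding chart_open_def in_chart_def by (metis inv_into_f_f subsetD)

lemma has_dchartD: "has_dchart \<phi> f f' q \<Longrightarrow> dchart \<phi> f q = f'"
  unfolding has_dchart_def dchart_def by (metis frechet_derivative_at)

lemma has_dchart_linear: "has_dchart \<phi> f f' q \<Longrightarrow> linear f'"
  unfolding has_dchart_def by (rule has_derivative_linear)

lemma has_dchart_cong:
  assumes "chart_open \<phi> U" "q \<in> U" "\<And>r. r \<in> U \<Longrightarrow> f r = g r"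
  shows "has_dchart \<phi> f f' q \<longleftrightarrow> has_dchart \<phi> g f' q"
proof -
  have "in_chart \<phi> f x = in_chart \<phi> g x" if "x \<in> snd \<phi> ` U" for x
    using that assms(3) by (auto simp: in_chart_at[OF assms(1)])
  then show ?thesis
    using has_derivative_transform_within_open[of _ _ "snd \<phi> q" UNIV "snd \<phi> ` U"] assms(1,2)
    unfolding has_dchart_def chart_open_def by (metis imageI)
qed

lemma dchart_cong:
  assumes "chart_open \<phi> U" "q \<in> U" "\<And>r. r \<in> U \<Longrightarrow> f r = g r"
  shows "dchart \<phi> f q = dchart \<phi> g q"
  using has_dchart_cong[OF assms]
  unfolding has_dchart_def dchart_def frechet_derivative_def by simp

lemma smooth_in_cong:
  assumes "chart_open \<phi> U" "\<And>r. r \<in> U \<Longrightarrow> f r = g r" "smooth_in \<phi> U f"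
  shows "smooth_in \<phi> U g"
  using assms(3) unfolding smooth_in_def
  by (rule smooth_on_cong[rotated 2]) (use assms in \<open>auto simp: chart_open_def in_chart_at[OF assms(1)]\<close>)

lemma smooth_in_subset: "smooth_in \<phi> U f \<Longrightarrow> V \<subseteq> U \<Longrightarrow> smooth_in \<phi> V f"
  unfolding smooth_in_def by (meson image_mono smooth_on_subset)

lemma smooth_in_has_dchart: "smooth_in \<phi> U f \<Longrightarrow> q \<in> U \<Longrightarrow> has_dchart \<phi> f (dchart \<phi> f q) q"
  unfolding smooth_in_def has_dchart_def dchart_def
  using smooth_on_differentiable frechet_derivative_works by blast

lemma linear_dchart: "smooth_in \<phi> U f \<Longrightarrow> q \<in> U \<Longrightarrow> linear (dchart \<phi> f q)"
  by (rule has_dchart_linear[OF smooth_in_has_dchart])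

lemma smooth_in_dchart:
  assumes "chart_open \<phi> U" "smooth_in \<phi> U f"
  shows "smooth_in \<phi> U (\<lambda>q. dchart \<phi> f q v)"
  unfolding smooth_in_def
proof (rule smooth_on_cong)
  show "open (snd \<phi> ` U)" using assms(1) by (simp add: chart_open_def)
  show "smooth_on (snd \<phi> ` U) (\<lambda>x. frechet_derivative (in_chart \<phi> f) (at x) v)"
    using assms(2) unfolding smooth_in_def by (rule smooth_on_frechet_derivative)
  show "frechet_derivative (in_chart \<phi> f) (at x) v = in_chart \<phi> (\<lambda>q. dchart \<phi> f q v) x" if "x \<in> snd \<phi> ` U" for x
    using that by (auto simp: dchart_def in_chart_at[OF assms(1)])
qed

lemma dchart_symmetric:
  fixes f :: "'a \<Rightarrow> 'w::euclidean_space"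
  assumes "chart_open \<phi> U" "smooth_in \<phi> U f" "q \<in> U"
  shows "dchart \<phi> (\<lambda>r. dchart \<phi> f r u) q v = dchart \<phi> (\<lambda>r. dchart \<phi> f r v) q u"
proof -
  have o: "open (snd \<phi> ` U)" and i: "snd \<phi> q \<in> snd \<phi> ` U" using assms by (auto simp: chart_open_def)
  have "dchart \<phi> (\<lambda>r. dchart \<phi> f r u) q v =
      frechet_derivative (\<lambda>x. frechet_derivative (in_chart \<phi> f) (at x) u) (at (snd \<phi> q)) v" for u v
    unfolding dchart_def
    by (rule fun_cong[OF frechet_derivative_transform_within_open[OF _ o i, symmetric]])
      (use in_chart_at[OF assms(1), of _ "\<lambda>q. frechet_derivative (in_chart \<phi> f) (at (snd \<phi> q)) u"]
          smooth_on_differentiable[OF smooth_on_frechet_derivative[OF assms(2)[unfolded smooth_in_def]] i] in auto)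
  then show ?thesis
    using second_derivative_symmetric[OF o i assms(2)[unfolded smooth_in_def]] by metis
qed

section \<open>Rules for derivatives and smoothness in a chart\<close>

lemma has_dchart_const: "has_dchart \<phi> (\<lambda>_. a) (\<lambda>_. 0) q"
  unfolding has_dchart_def in_chart_def by (rule has_derivative_const)

lemma has_dchart_add:
  "has_dchart \<phi> f f' q \<Longrightarrow> has_dchart \<phi> g g' q \<Longrightarrow> has_dchart \<phi> (\<lambda>r. f r + g r) (\<lambda>v. f' v + g' v) q"
  unfolding has_dchart_def in_chart_def by (rule has_derivative_add)

lemma has_dchart_diff:
  "has_dchart \<phi> f f' q \<Longrightarrow> has_dchart \<phi> g g' q \<Longrightarrow> has_dchart \<phi> (\<lambda>r. f r - g r) (\<lambda>v. f' v - g' v) q"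
  unfolding has_dchart_def in_chart_def by (rule has_derivative_diff)

lemma has_dchart_sum:
  "(\<And>i. i \<in> I \<Longrightarrow> has_dchart \<phi> (f i) (f' i) q) \<Longrightarrow>
   has_dchart \<phi> (\<lambda>r. \<Sum>i\<in>I. f i r) (\<lambda>v. \<Sum>i\<in>I. f' i v) q"
  unfolding has_dchart_def in_chart_def by (rule has_derivative_sum)

lemma has_dchart_bounded_linear:
  "bounded_linear h \<Longrightarrow> has_dchart \<phi> f f' q \<Longrightarrow> has_dchart \<phi> (\<lambda>r. h (f r)) (\<lambda>v. h (f' v)) q"
  unfolding has_dchart_def in_chart_def by (rule bounded_linear.has_derivative)

lemma has_dchart_linear_image:
  fixes h :: "'w::euclidean_space \<Rightarrow> 'x::real_normed_vector"
  shows "linear h \<Longrightarrow> has_dchart \<phi> f f' q \<Longrightarrow> has_dchart \<phi> (\<lambda>r. h (f r)) (\<lambda>v. h (f' v)) q"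
  by (rule has_dchart_bounded_linear) (simp add: linear_conv_bounded_linear)

lemma has_dchart_bounded_bilinear:
  assumes "bounded_bilinear h" "chart_open \<phi> U" "q \<in> U" "has_dchart \<phi> f f' q" "has_dchart \<phi> g g' q"
  shows "has_dchart \<phi> (\<lambda>r. h (f r) (g r)) (\<lambda>v. h (f q) (g' v) + h (f' v) (g q)) q"
  using bounded_bilinear.FDERIV[OF assms(1) assms(4,5)[unfolded has_dchart_def]]
  unfolding in_chart_at[OF assms(2,3)] unfolding has_dchart_def in_chart_def .

lemma has_dchart_mult:
  fixes f g :: "'a \<Rightarrow> real"
  shows "chart_open \<phi> U \<Longrightarrow> q \<in> U \<Longrightarrow> has_dchart \<phi> f f' q \<Longrightarrow> has_dchart \<phi> g g' q \<Longrightarrow>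
   has_dchart \<phi> (\<lambda>r. f r * g r) (\<lambda>v. f q * g' v + f' v * g q) q"
  by (rule has_dchart_bounded_bilinear[OF bounded_bilinear_mult])

lemma has_dchart_scaleR:
  "chart_open \<phi> U \<Longrightarrow> q \<in> U \<Longrightarrow> has_dchart \<phi> f f' q \<Longrightarrow> has_dchart \<phi> g g' q \<Longrightarrow>
   has_dchart \<phi> (\<lambda>r. f r *\<^sub>R g r) (\<lambda>v. f q *\<^sub>R g' v + f' v *\<^sub>R g q) q"
  by (rule has_dchart_bounded_bilinear[OF bounded_bilinear_scaleR])

lemma smooth_in_const: "smooth_in \<phi> U (\<lambda>_. a)"
  unfolding smooth_in_def in_chart_def by (rule smooth_on_const)

lemma smooth_in_add:
  "chart_open \<phi> U \<Longrightarrow> smooth_in \<phi> U f \<Longrightarrow> smooth_in \<phi> U g \<Longrightarrow> smooth_in \<phi> U (\<lambda>r. f r + g r)"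
  unfolding smooth_in_def in_chart_def chart_open_def by (rule smooth_on_add) auto

lemma smooth_in_bounded_linear:
  "bounded_linear h \<Longrightarrow> chart_open \<phi> U \<Longrightarrow> smooth_in \<phi> U f \<Longrightarrow> smooth_in \<phi> U (\<lambda>r. h (f r))"
  unfolding smooth_in_def in_chart_def chart_open_def by (rule smooth_on_bounded_linear) auto

lemma smooth_in_bounded_bilinear:
  "bounded_bilinear h \<Longrightarrow> chart_open \<phi> U \<Longrightarrow> smooth_in \<phi> U f \<Longrightarrow> smooth_in \<phi> U g \<Longrightarrow>
   smooth_in \<phi> U (\<lambda>r. h (f r) (g r))"
  unfolding smooth_in_def in_chart_def chart_open_def by (rule smooth_on_bilinear) auto

lemmas smooth_in_mult = smooth_in_bounded_bilinear[OF bounded_bilinear_mult]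
lemmas smooth_in_scaleR = smooth_in_bounded_bilinear[OF bounded_bilinear_scaleR]

lemma smooth_in_sum:
  "chart_open \<phi> U \<Longrightarrow> (\<And>i. i \<in> I \<Longrightarrow> smooth_in \<phi> U (f i)) \<Longrightarrow> smooth_in \<phi> U (\<lambda>r. \<Sum>i\<in>I. f i r)"
  unfolding smooth_in_def in_chart_def chart_open_def by (rule smooth_on_sum) auto

lemma smooth_in_minus:
  fixes f g :: "'a \<Rightarrow> 'w::real_normed_vector"
  assumes "chart_open \<phi> U" "smooth_in \<phi> U f" "smooth_in \<phi> U g"
  shows "smooth_in \<phi> U (\<lambda>r. f r - g r)"
proof -
  have "smooth_in \<phi> U (\<lambda>r. f r + (- 1) *\<^sub>R g r)"
    by (intro smooth_in_add smooth_in_scaleR smooth_in_const assms)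
  then show ?thesis by simp
qed

lemma smooth_in_inverse:
  fixes f :: "'a \<Rightarrow> real"
  assumes "chart_open \<phi> U" "smooth_in \<phi> U f" "\<And>r. r \<in> U \<Longrightarrow> f r \<noteq> 0"
  shows "smooth_in \<phi> U (\<lambda>r. inverse (f r))"
  unfolding smooth_in_def in_chart_def
  by (rule smooth_on_inverse)
    (use assms in_chart_at[OF assms(1), of _ f] in \<open>auto simp: smooth_in_def in_chart_def chart_open_def\<close>)

lemma smooth_in_abs_powr:
  fixes f :: "'a \<Rightarrow> real"
  assumes "chart_open \<phi> U" "smooth_in \<phi> U f" "\<And>r. r \<in> U \<Longrightarrow> f r \<noteq> 0"
  shows "smooth_in \<phi> U (\<lambda>r. \<bar>f r\<bar> powr a)"
  unfolding smooth_in_def in_chart_def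
  by (rule smooth_on_abs_powr)
    (use assms in_chart_at[OF assms(1), of _ f] in \<open>auto simp: smooth_in_def in_chart_def chart_open_def\<close>)

lemma smooth_in_det:
  fixes A :: "'a \<Rightarrow> 'n::finite \<Rightarrow> 'n \<Rightarrow> real"
  shows "chart_open \<phi> U \<Longrightarrow> (\<And>i j. smooth_in \<phi> U (\<lambda>r. A r i j)) \<Longrightarrow> smooth_in \<phi> U (\<lambda>r. det (\<chi> i j. A r i j))"
  unfolding smooth_in_def in_chart_def chart_open_def by (rule smooth_on_det) auto

lemma smooth_in_vec_lambda:
  fixes f :: "'a \<Rightarrow> 'n::finite \<Rightarrow> real"
  shows "chart_open \<phi> U \<Longrightarrow> (\<And>i. smooth_in \<phi> U (\<lambda>r. f r i)) \<Longrightarrow> smooth_in \<phi> U (\<lambda>r. \<chi> i. f r i)"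
  unfolding smooth_in_def in_chart_def chart_open_def by (rule smooth_on_vec_lambda) auto

lemma smooth_in_vec_nth: "chart_open \<phi> U \<Longrightarrow> smooth_in \<phi> U f \<Longrightarrow> smooth_in \<phi> U (\<lambda>r. f r $ i)"
  by (rule smooth_in_bounded_linear[OF bounded_linear_vec_nth])

text \<open>The charts may live on different manifolds, the first one immersed in the second.\<close>

definition trans_on :: "('a, 'u::real_normed_vector) chart \<Rightarrow> ('a, 'v::real_normed_vector) chart \<Rightarrow> 'a set \<Rightarrow> bool" where
  "trans_on \<phi> \<psi> U \<longleftrightarrow> chart_open \<phi> U \<and> U \<subseteq> fst \<psi> \<and> inj_on (snd \<psi>) (fst \<psi>) \<and> smooth_in \<phi> U (snd \<psi>)"

lemma trans_on_open: "trans_on \<phi> \<psi> U \<Longrightarrow> chart_open \<phi> U"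
  by (simp add: trans_on_def)

lemma in_chart_trans:
  assumes "trans_on \<phi> \<psi> U" "x \<in> snd \<phi> ` U"
  shows "in_chart \<phi> f x = in_chart \<psi> f (in_chart \<phi> (snd \<psi>) x)"
proof -
  obtain r where r: "r \<in> U" "x = snd \<phi> r" using assms by blast
  have "in_chart \<psi> f (snd \<psi> r) = f r"
    using assms(1) r unfolding trans_on_def in_chart_def by (metis inv_into_f_f subsetD)
  then show ?thesis using in_chart_at[OF trans_on_open[OF assms(1)] r(1)] r(2) by metis
qed

lemma has_dchart_trans:
  assumes "trans_on \<phi> \<psi> U" "q \<in> U" "has_dchart \<psi> f f' q"
  shows "has_dchart \<phi> f (\<lambda>v. f' (dchart \<phi> (snd \<psi>) q v)) q"
proof -
  have at: "in_chart \<phi> (snd \<psi>) (snd \<phi> q) = snd \<psi> q"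
    by (rule in_chart_at[OF trans_on_open[OF assms(1)] assms(2)])
  have s: "has_dchart \<phi> (snd \<psi>) (dchart \<phi> (snd \<psi>) q) q"
    using assms(1) unfolding trans_on_def by (intro smooth_in_has_dchart[OF _ assms(2)]) auto
  have "((\<lambda>x. in_chart \<psi> f (in_chart \<phi> (snd \<psi>) x)) has_derivative (\<lambda>v. f' (dchart \<phi> (snd \<psi>) q v))) (at (snd \<phi> q))"
    by (rule has_derivative_compose[OF s[unfolded has_dchart_def]])
      (use assms(3) in \<open>simp add: has_dchart_def at\<close>)
  then show ?thesis
    unfolding has_dchart_def
    by (rule has_derivative_transform_within_open[of _ _ _ UNIV "snd \<phi> ` U"])
      (use assms in_chart_trans[OF assms(1), of _ f] trans_on_open[OF assms(1)] in \<open>auto simp: chart_open_def\<close>)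
qed

lemma dchart_trans:
  assumes "trans_on \<phi> \<psi> U" "q \<in> U" "has_dchart \<psi> f f' q"
  shows "dchart \<phi> f q v = dchart \<psi> f q (dchart \<phi> (snd \<psi>) q v)"
  using has_dchartD[OF has_dchart_trans[OF assms]] has_dchartD[OF assms(3)] by simp

lemma smooth_in_trans:
  fixes \<psi> :: "('a, 'v::euclidean_space) chart"
  assumes "trans_on \<phi> \<psi> U" "chart_open \<psi> V" "U \<subseteq> V" "smooth_in \<psi> V f"
  shows "smooth_in \<phi> U f"
proof -
  have "smooth_on (snd \<phi> ` U) (\<lambda>x. in_chart \<psi> f (in_chart \<phi> (snd \<psi>) x))"
    by (rule smooth_on_compose[of _ "snd \<psi> ` V"])
      (use assms in_chart_at[OF trans_on_open[OF assms(1)]] in \<open>auto simp: trans_on_def chart_open_def smooth_in_def\<close>)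
  then show ?thesis
    unfolding smooth_in_def
    by (rule smooth_on_cong[rotated 2])
      (use in_chart_trans[OF assms(1), of _ f] trans_on_open[OF assms(1)] in \<open>auto simp: chart_open_def\<close>)
qed

lemma jac_trans:
  assumes "trans_on \<phi> \<psi> U" "trans_on \<psi> \<theta> V" "q \<in> U" "q \<in> V"
  shows "jac \<phi> \<theta> q v = jac \<psi> \<theta> q (jac \<phi> \<psi> q v)"
  unfolding jac_eq_dchart
  by (rule dchart_trans[OF assms(1,3)], rule smooth_in_has_dchart[OF _ assms(4)])
    (use assms(2) in \<open>simp add: trans_on_def\<close>)

lemma jac_refl:
  assumes "chart_open \<phi> U" "q \<in> U"
  shows "jac \<phi> \<phi> q v = v"
proof -
  have "((\<lambda>x. x) has_derivative (\<lambda>v. v)) (at (snd \<phi> q))" by (rule has_derivative_ident)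
  then have "has_dchart \<phi> (snd \<phi>) (\<lambda>v. v) q"
    unfolding has_dchart_def
    by (rule has_derivative_transform_within_open[of _ _ _ UNIV "snd \<phi> ` U"])
      (use assms in_chart_at[OF assms(1), of _ "snd \<phi>"] in \<open>auto simp: chart_open_def\<close>)
  from has_dchartD[OF this] show ?thesis by (simp add: jac_eq_dchart)
qed

lemma linear_jac: "trans_on \<phi> \<psi> U \<Longrightarrow> q \<in> U \<Longrightarrow> linear (jac \<phi> \<psi> q)"
  unfolding jac_eq_dchart trans_on_def by (rule linear_dchart) auto

lemma smooth_in_jac: "trans_on \<phi> \<psi> U \<Longrightarrow> smooth_in \<phi> U (\<lambda>q. jac \<phi> \<psi> q v)"
  unfolding jac_eq_dchart trans_on_def by (rule smooth_in_dchart) auto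

section \<open>Traces, determinants and inner products\<close>

lemma linear_expand_axis:
  fixes f :: "real^'n \<Rightarrow> 'w::real_vector"
  assumes "linear f"
  shows "f v = (\<Sum>i\<in>UNIV. v $ i *\<^sub>R f (axis i 1))"
proof -
  have "f v = f (\<Sum>i\<in>UNIV. v $ i *\<^sub>R axis i 1)"
    by (simp flip: scalar_mult_eq_scaleR add: basis_expansion)
  also have "\<dots> = (\<Sum>i\<in>UNIV. v $ i *\<^sub>R f (axis i 1))"
    by (simp add: linear_sum[OF assms] linear_cmul[OF assms])
  finally show ?thesis .
qed

lemma endo_trace_eq_sum: "endo_trace f = (\<Sum>i\<in>UNIV. f (axis i 1) $ i)"
  by (simp add: endo_trace_def trace_def matrix_def)

lemma endo_trace_add: "endo_trace (\<lambda>u. f u + g u) = endo_trace f + endo_trace g"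
  by (simp add: endo_trace_eq_sum sum.distrib)

lemma endo_trace_diff: "endo_trace (\<lambda>u. f u - g u) = endo_trace f - endo_trace g"
  by (simp add: endo_trace_eq_sum sum_subtractf)

lemma endo_trace_scaleR: "endo_trace (\<lambda>u. a *\<^sub>R f u) = a * endo_trace f"
  by (simp add: endo_trace_eq_sum sum_distrib_left)

lemma endo_trace_ident: "endo_trace (\<lambda>u::real^'n. u) = real CARD('n)"
  by (simp add: endo_trace_eq_sum)

lemma endo_trace_rank_one:
  assumes "linear l"
  shows "endo_trace (\<lambda>u. l u *\<^sub>R w) = l w"
  using linear_expand_axis[OF assms, of w] by (simp add: endo_trace_eq_sum mult.commute)

lemma endo_trace_commute:
  fixes f :: "real^'n \<Rightarrow> real^'m" and g :: "real^'m \<Rightarrow> real^'n"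
  assumes "linear f" "linear g"
  shows "endo_trace (\<lambda>u. f (g u)) = endo_trace (\<lambda>u. g (f u))"
  unfolding endo_trace_def matrix_compose[OF assms(2,1), unfolded comp_def]
    matrix_compose[OF assms, unfolded comp_def] by (rule trace_mul_sym)

lemma endo_trace_conj:
  fixes f :: "real^'n \<Rightarrow> real^'n" and J :: "real^'n \<Rightarrow> real^'m" and I :: "real^'m \<Rightarrow> real^'n"
  assumes "linear f" "linear J" "linear I" "\<And>u. I (J u) = u"
  shows "endo_trace (\<lambda>u. J (f (I u))) = endo_trace f"
  using endo_trace_commute[OF assms(2) linear_compose[OF assms(3,1)]] assms(4) by (simp add: comp_def)

text \<open>Jacobi's formula. Multiplication by the constant matrix \<open>B\<close> reduces it to a
  family that is the identity at \<open>q\<close>, where the expansion over permutations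
  collapses.\<close>

lemma has_dchart_det:
  fixes A :: "'a \<Rightarrow> real^'n^'n"
  assumes "chart_open \<phi> U" "q \<in> U" and d: "\<And>i j. has_dchart \<phi> (\<lambda>r. A r $ i $ j) (\<lambda>v. A' v $ i $ j) q"
    and B: "B ** A q = mat 1"
  shows "has_dchart \<phi> (\<lambda>r. det (A r)) (\<lambda>v. det (A q) * trace (B ** A' v)) q"
proof -
  define E where "E = (\<lambda>r. B ** A r)"
  define E' where "E' = (\<lambda>v. B ** A' v)"
  have Eq: "E q $ i $ j = (if i = j then 1 else 0)" for i j by (simp add: E_def B mat_def)
  have dE: "has_dchart \<phi> (\<lambda>r. E r $ i $ j) (\<lambda>v. E' v $ i $ j) q" for i j
    unfolding E_def E'_def matrix_matrix_mult_def
    by (simp, intro has_dchart_sum has_dchart_linear_image[OF _ d]) (simp add: linear_times)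
  have prod: "has_dchart \<phi> (\<lambda>r. \<Prod>i\<in>UNIV. E r $ i $ p i)
      (\<lambda>v. \<Sum>i\<in>UNIV. E' v $ i $ p i * (\<Prod>j\<in>UNIV - {i}. E q $ j $ p j)) q" for p
    using has_derivative_prod[of UNIV "\<lambda>i. in_chart \<phi> (\<lambda>r. E r $ i $ p i)", OF dE[unfolded has_dchart_def]]
    unfolding in_chart_at[OF assms(1,2)] unfolding has_dchart_def in_chart_def by simp
  \<comment> \<open>A permutation other than the identity moves at least two indices. After one
    factor has been differentiated and removed, an off-diagonal entry of the identity matrix
    remains.\<close>
  have zero: "(\<Prod>j\<in>UNIV - {i}. E q $ j $ p j) = 0" if p: "p permutes UNIV" "p \<noteq> id" for p i
  proof -
    obtain j where j: "p j \<noteq> j" using p(2) by (metis eq_id_iff)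
    then have "p (p j) \<noteq> p j" using p(1) by (metis permutes_inj injD)
    then obtain k where "k \<noteq> i" "p k \<noteq> k" using j by metis
    then show ?thesis by (intro prod_zero) (auto simp: Eq intro!: bexI[of _ k])
  qed
  have "has_dchart \<phi> (\<lambda>r. \<Sum>p | p permutes UNIV. of_int (sign p) * (\<Prod>i\<in>UNIV. E r $ i $ p i))
      (\<lambda>v. \<Sum>p | p permutes UNIV. of_int (sign p) *
          (\<Sum>i\<in>UNIV. E' v $ i $ p i * (\<Prod>j\<in>UNIV - {i}. E q $ j $ p j))) q"
    by (intro has_dchart_sum has_dchart_linear_image[OF _ prod]) (simp add: linear_times)
  moreover have "(\<Sum>p | p permutes UNIV. of_int (sign p) *
          (\<Sum>i\<in>UNIV. E' v $ i $ p i * (\<Prod>j\<in>UNIV - {i}. E q $ j $ p j))) = trace (E' v)" for v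
  proof -
    have "(\<Sum>p | p permutes UNIV. of_int (sign p) *
          (\<Sum>i\<in>UNIV. E' v $ i $ p i * (\<Prod>j\<in>UNIV - {i}. E q $ j $ p j))) =
      (\<Sum>p\<in>{id}. of_int (sign p) *
          (\<Sum>i\<in>UNIV. E' v $ i $ p i * (\<Prod>j\<in>UNIV - {i}. E q $ j $ p j)))"
      by (intro sum.mono_neutral_right) (auto simp: zero permutes_id finite_permutations)
    then show ?thesis by (simp add: sign_id trace_def Eq)
  qed
  ultimately have "has_dchart \<phi> (\<lambda>r. det (E r)) (\<lambda>v. trace (E' v)) q"
    by (simp add: det_def)
  then have "has_dchart \<phi> (\<lambda>r. det (A q) * det (E r)) (\<lambda>v. det (A q) * trace (E' v)) q"
    by (rule has_dchart_linear_image[rotated]) (simp add: linear_times)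
  moreover have "det (A q) * det (E r) = det (A r)" for r
  proof -
    have "det B * det (A q) = 1" using B det_mul[of B "A q"] by simp
    then show ?thesis unfolding E_def det_mul by (metis mult.assoc mult.commute mult_1)
  qed
  ultimately show ?thesis by (simp add: E'_def)
qed

lemma has_dchart_abs_powr:
  fixes f :: "'a \<Rightarrow> real"
  assumes "chart_open \<phi> U" "q \<in> U" "has_dchart \<phi> f f' q" "f q \<noteq> 0"
  shows "has_dchart \<phi> (\<lambda>r. \<bar>f r\<bar> powr a) (\<lambda>v. a * \<bar>f q\<bar> powr a * (f' v / f q)) q"
proof -
  define g where "g = in_chart \<phi> f"
  have g: "(g has_derivative f') (at (snd \<phi> q))" "g (snd \<phi> q) = f q"
    using assms(3) in_chart_at[OF assms(1,2)] by (simp_all add: has_dchart_def g_def)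
  have sq: "0 < g (snd \<phi> q) * g (snd \<phi> q)"
    using assms(4) g(2) by (auto simp: zero_less_mult_iff linorder_neq_iff)
  have "((\<lambda>x. (g x * g x) powr (a / 2)) has_derivative
      (\<lambda>v. (f q * f q) powr (a / 2) * (0 * ln (f q * f q) + (f q * f' v + f' v * f q) * (a / 2) / (f q * f q)))) (at (snd \<phi> q))"
    using has_derivative_powr[OF has_derivative_mult[OF g(1) g(1)] has_derivative_const sq UNIV_I, of "a / 2"]
    unfolding g(2) by simp
  moreover have "(f q * f q) powr (a / 2) * (0 * ln (f q * f q) + (f q * x + x * f q) * (a / 2) / (f q * f q)) =
      a * \<bar>f q\<bar> powr a * (x / f q)" for x
    using assms(4) by (simp add: abs_powr_eq field_simps)
  ultimately show ?thesis by (simp add: has_dchart_def in_chart_def g_def abs_powr_eq)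
qed

text \<open>The derivative of a determinant factor is turned into an endomorphism trace; this is how
  the transition of densities meets the trace of the connection form.\<close>

lemma has_dchart_det_powr:
  fixes L :: "'a \<Rightarrow> real^'n \<Rightarrow> real^'n"
  assumes "chart_open \<phi> U" "q \<in> U" and d: "\<And>u. has_dchart \<phi> (\<lambda>r. L r u) (\<lambda>v. L' v u) q"
    and lin: "linear (L q)" "linear K" "\<And>v. linear (L' v)" and K: "\<And>u. K (L q u) = u"
  shows "has_dchart \<phi> (\<lambda>r. \<bar>det (matrix (L r))\<bar> powr a)
    (\<lambda>v. a * \<bar>det (matrix (L q))\<bar> powr a * endo_trace (\<lambda>u. K (L' v u))) q"
proof -
  have KL: "matrix K ** matrix (L q) = mat 1"
    using matrix_compose[OF lin(1,2)] K by (metis comp_apply eq_id_iff matrix_id_mat_1)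
  then have nz: "det (matrix (L q)) \<noteq> 0"
    using det_mul[of "matrix K" "matrix (L q)"] by auto
  have d': "has_dchart \<phi> (\<lambda>r. matrix (L r) $ i $ j) (\<lambda>v. matrix (L' v) $ i $ j) q" for i j
    unfolding matrix_def using has_dchart_bounded_linear[OF bounded_linear_vec_nth d] by simp
  have "matrix K ** matrix (L' v) = matrix (\<lambda>u. K (L' v u))" for v
    using matrix_compose[OF lin(3,2)] by (simp add: o_def)
  then show ?thesis
    using has_dchart_abs_powr[OF assms(1,2) has_dchart_det[OF assms(1,2) d' KL] nz] nz
    by (simp add: endo_trace_def)
qed

section \<open>Inner products, duality and metric traces\<close>

definition inner_form :: "(real^'n \<Rightarrow> real^'n \<Rightarrow> real) \<Rightarrow> bool" where
  "inner_form g \<longleftrightarrow> bilinear g \<and> (\<forall>u v. g u v = g v u) \<and> (\<forall>u. u \<noteq> 0 \<longrightarrow> g u u > 0)"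

lemma inner_formD:
  assumes "inner_form g"
  shows "bilinear g" "g u v = g v u" "u \<noteq> 0 \<Longrightarrow> g u u > 0" "linear (g u)" "linear (\<lambda>u. g u v)"
  using assms by (auto simp: inner_form_def bilinear_def)

lemma inner_form_simps:
  assumes "inner_form g"
  shows "g (u + v) w = g u w + g v w" "g w (u + v) = g w u + g w v"
    "g (u - v) w = g u w - g v w" "g w (u - v) = g w u - g w v"
    "g (a *\<^sub>R u) w = a * g u w" "g w (a *\<^sub>R u) = a * g w u" "g 0 w = 0" "g w 0 = 0"
  using inner_formD(1)[OF assms]
  by (auto simp: bilinear_ladd bilinear_radd bilinear_lsub bilinear_rsub bilinear_lmul bilinear_rmul
      bilinear_lzero bilinear_rzero)

lemma inner_form_eqI:
  assumes "inner_form g" "\<And>v. g u v = g w v"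
  shows "u = w"
proof (rule ccontr)
  assume "u \<noteq> w"
  then have "g (u - w) (u - w) > 0" using inner_formD(3)[OF assms(1)] by simp
  then show False using assms(2) by (simp add: inner_form_simps[OF assms(1)])
qed

lemma inner_form_pullback:
  assumes "inner_form g" "linear i" "inj i"
  shows "inner_form (\<lambda>u v. g (i u) (i v))"
proof -
  have "bilinear (\<lambda>u v. g (i u) (i v))"
    using linear_compose[OF assms(2) inner_formD(4)[OF assms(1)]]
      linear_compose[OF assms(2) inner_formD(5)[OF assms(1)]] by (simp add: bilinear_def o_def)
  moreover have "i u \<noteq> 0" if "u \<noteq> 0" for u
    using that assms(2,3) by (metis injD linear_0)
  ultimately show ?thesis using assms(1) by (simp add: inner_form_def)
qed

lemma inner_form_scale: "inner_form g \<Longrightarrow> a > 0 \<Longrightarrow> inner_form (\<lambda>u v. a * g u v)"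
  by (auto simp: inner_form_def bilinear_def linear_compose[of _ "(*) a", unfolded o_def] linear_times
      intro: linear_compose[of _ "(*) a", unfolded o_def])

lemma gram_mult:
  assumes "inner_form g"
  shows "gram g *v z = (\<chi> r. g z (axis r 1))"
proof -
  have "g (axis r 1) z = (\<Sum>i\<in>UNIV. g (axis r 1) (axis i 1) * z $ i)" for r
    by (subst linear_expand_axis[OF inner_formD(4)[OF assms]]) (simp add: mult.commute)
  then show ?thesis
    by (simp add: vec_eq_iff gram_def matrix_vector_mult_def inner_formD(2)[OF assms, of z])
qed

lemma gram_invertible:
  assumes "inner_form g"
  shows "invertible (gram g)"
proof -
  have "z = 0" if "gram g *v z = 0" for z
  proof (rule inner_form_eqI[OF assms])
    fix v
    have "g z (axis r 1) = 0" for r using that gram_mult[OF assms, of z] by (simp add: vec_eq_iff)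
    then show "g z v = g 0 v"
      by (subst linear_expand_axis[OF inner_formD(4)[OF assms]]) (simp add: inner_form_simps[OF assms])
  qed
  then show ?thesis
    unfolding invertible_left_inverse by (simp add: matrix_left_invertible_ker)
qed

text \<open>Cramer's rule gives existence and uniqueness of the dual vector and also exhibits it as
  a quotient of determinants, from which smooth dependence on parameters follows.\<close>

lemma inner_form_solve:
  assumes g: "inner_form g" and l: "linear l"
  shows "(\<forall>y. g z y = l y) \<longleftrightarrow>
    z = (\<chi> k. det (\<chi> r s. if s = k then l (axis r 1) else g (axis r 1) (axis s 1)) /
          det (\<chi> r s. g (axis r 1) (axis s 1)))"
proof -
  have nz: "det (gram g) \<noteq> 0" using gram_invertible[OF g] by (simp add: invertible_det_nz)
  have "(\<forall>y. g z y = l y) \<longleftrightarrow> (\<forall>r. g z (axis r 1) = l (axis r 1))"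
  proof (intro iffI allI)
    fix y assume "\<forall>r. g z (axis r 1) = l (axis r 1)"
    then show "g z y = l y"
      by (subst linear_expand_axis[OF inner_formD(4)[OF g]], subst linear_expand_axis[OF l]) simp
  qed simp
  also have "\<dots> \<longleftrightarrow> gram g *v z = (\<chi> r. l (axis r 1))"
    unfolding gram_mult[OF g] by (simp add: vec_eq_iff)
  also have "\<dots> \<longleftrightarrow> z = (\<chi> k. det (\<chi> r s. if s = k then (\<chi> r. l (axis r 1)) $ r else gram g $ r $ s) / det (gram g))"
    by (rule cramer[OF nz])
  finally show ?thesis by (simp add: gram_def cong: if_cong)
qed

definition sharp :: "(real^'n \<Rightarrow> real^'n \<Rightarrow> real) \<Rightarrow> (real^'n \<Rightarrow> real) \<Rightarrow> real^'n" where
  "sharp g l = (THE w. \<forall>y. g w y = l y)"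

lemma sharp:
  assumes "inner_form g" "linear l"
  shows "g (sharp g l) y = l y"
  using inner_form_solve[OF assms] theI'[of "\<lambda>w. \<forall>y. g w y = l y"] unfolding sharp_def by auto

lemma sharp_unique:
  assumes "inner_form g" "\<And>y. g w y = l y"
  shows "sharp g l = w"
proof -
  have "linear l" using inner_formD(4)[OF assms(1), of w] assms(2) by (metis ext)
  then show ?thesis using inner_form_eqI[OF assms(1)] sharp[OF assms(1)] assms(2) by metis
qed

lemma linear_sharp:
  assumes g: "inner_form g" and b: "bilinear b"
  shows "linear (\<lambda>u. sharp g (b u))"
proof -
  have l: "linear (b u)" for u using b by (simp add: bilinear_def)
  have "sharp g (b (u + v)) = sharp g (b u) + sharp g (b v)" for u v
    by (rule sharp_unique[OF g]) (simp add: inner_form_simps[OF g] sharp[OF g l] bilinear_ladd[OF b])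
  moreover have "sharp g (b (a *\<^sub>R u)) = a *\<^sub>R sharp g (b u)" for a u
    by (rule sharp_unique[OF g]) (simp add: inner_form_simps[OF g] sharp[OF g l] bilinear_lmul[OF b])
  ultimately show ?thesis by (rule linearI)
qed

text \<open>The segment from the Euclidean product to \<open>g\<close> consists of inner products,
  so the determinant never vanishes along it; it starts at 1 and cannot change sign.\<close>

lemma det_gram_pos:
  assumes g: "inner_form g"
  shows "det (gram g) > 0"
proof (rule ccontr)
  assume neg: "\<not> ?thesis"
  define h where "h = (\<lambda>t u v. (1 - t) * (u \<bullet> v) + t * g u v)"
  have i: "inner_form (h t)" if t: "0 \<le> t" "t \<le> 1" for t
  proof -
    have "bilinear (h t)"
      unfolding h_def bilinear_def
      by (intro conjI allI linearI) (simp_all add: inner_form_simps[OF g] algebra_simps)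
    moreover have "h t u u > 0" if "u \<noteq> 0" for u
      using t inner_formD(3)[OF g that] that
      by (cases "t = 0") (auto simp: h_def intro!: add_nonneg_pos)
    ultimately show ?thesis unfolding inner_form_def h_def by (simp add: inner_commute inner_formD(2)[OF g])
  qed
  have "continuous_on {0..1} (\<lambda>t. det (gram (h t)))"
    unfolding det_def gram_def h_def by (simp, intro continuous_intros)
  moreover have "gram (h 0) = mat 1" by (simp add: gram_def h_def mat_def vec_eq_iff inner_axis_axis)
  moreover have "h 1 = g" by (simp add: h_def)
  ultimately obtain t where "0 \<le> t" "t \<le> 1" "det (gram (h t)) = 0"
    using IVT2'[of "\<lambda>t. det (gram (h t))" 1 0 0] neg by auto
  then show False using gram_invertible[OF i] by (simp add: invertible_det_nz)
qed

lemma
  fixes A :: "real^'n^'n"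
  assumes "invertible A"
  shows matrix_inv_right: "A ** matrix_inv A = mat 1" and matrix_inv_left: "matrix_inv A ** A = mat 1"
  using assms someI_ex[of "\<lambda>B. A ** B = mat 1 \<and> B ** A = mat 1"]
  unfolding invertible_def matrix_inv_def by simp_all

text \<open>Replaces the matrix formula for the metric trace by the trace of the representing
  endomorphism, so that traces of rank-one terms can be evaluated without coordinates.\<close>

lemma tr_c_eq_endo_trace:
  assumes g: "inner_form g" and A: "linear A" and b: "\<And>u v. b u v = g (A u) v"
  shows "tr_c g b = endo_trace A"
proof -
  have 1: "gram b = transpose (matrix A) ** gram g"
  proof -
    have "b (axis r 1) (axis s 1) = (\<Sum>k\<in>UNIV. A (axis r 1) $ k * g (axis k 1) (axis s 1))" for r s
      unfolding b using linear_expand_axis[OF inner_formD(5)[OF g, of "axis s 1"], of "A (axis r 1)"] by simp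
    then show ?thesis by (simp add: gram_def matrix_matrix_mult_def transpose_def matrix_def vec_eq_iff)
  qed
  have "tr_c g b = trace ((transpose (matrix A) ** gram g) ** matrix_inv (gram g))"
    unfolding tr_c_def 1 by (rule trace_mul_sym)
  also have "\<dots> = trace (transpose (matrix A))"
    using matrix_inv_right[OF gram_invertible[OF g]] by (simp flip: matrix_mul_assoc)
  finally show ?thesis by (simp add: endo_trace_def trace_def transpose_def)
qed

lemma tr_c_eq_sharp:
  assumes "inner_form g" "bilinear b"
  shows "tr_c g b = endo_trace (\<lambda>u. sharp g (b u))"
  using assms by (intro tr_c_eq_endo_trace linear_sharp) (auto simp: sharp bilinear_def)

section \<open>Connections in a chart\<close>

lemma smooth_in_linear_apply:
  fixes L :: "'a \<Rightarrow> real^'n \<Rightarrow> 'w::real_normed_vector" and f :: "'a \<Rightarrow> real^'n"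
  assumes "chart_open \<phi> U" "\<And>u. smooth_in \<phi> U (\<lambda>r. L r u)" "\<And>r. r \<in> U \<Longrightarrow> linear (L r)" "smooth_in \<phi> U f"
  shows "smooth_in \<phi> U (\<lambda>r. L r (f r))"
proof (rule smooth_in_cong[OF assms(1)])
  show "smooth_in \<phi> U (\<lambda>r. \<Sum>i\<in>UNIV. f r $ i *\<^sub>R L r (axis i 1))"
    by (intro smooth_in_sum smooth_in_scaleR smooth_in_vec_nth assms)
  show "(\<Sum>i\<in>UNIV. f r $ i *\<^sub>R L r (axis i 1)) = L r (f r)" if "r \<in> U" for r
    using linear_expand_axis[OF assms(3)[OF that], of "f r"] by simp
qed

lemma smooth_in_bilinear_apply:
  fixes G :: "'a \<Rightarrow> real^'n \<Rightarrow> real^'m \<Rightarrow> 'w::real_normed_vector"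
  assumes "chart_open \<phi> U" "\<And>u v. smooth_in \<phi> U (\<lambda>r. G r u v)" "\<And>r. r \<in> U \<Longrightarrow> bilinear (G r)"
    "smooth_in \<phi> U f" "smooth_in \<phi> U g"
  shows "smooth_in \<phi> U (\<lambda>r. G r (f r) (g r))"
proof (rule smooth_in_linear_apply[OF assms(1) _ _ assms(5)])
  show "smooth_in \<phi> U (\<lambda>r. G r (f r) v)" for v
    by (rule smooth_in_linear_apply[OF assms(1,2) _ assms(4)]) (use assms(3) in \<open>simp add: bilinear_def\<close>)
  show "linear (G r (f r))" if "r \<in> U" for r
    using assms(3)[OF that] by (simp add: bilinear_def)
qed

text \<open>Only derivatives at constant vectors are given. Uniqueness of derivatives makes them
  linear in the vector, and expansion of \<open>f\<close> in the axis vectors yields the product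
  rule.\<close>

lemma has_dchart_linear_apply:
  fixes L :: "'a \<Rightarrow> real^'n \<Rightarrow> 'w::real_normed_vector" and f :: "'a \<Rightarrow> real^'n"
  assumes "chart_open \<phi> U" "q \<in> U" "\<And>u. has_dchart \<phi> (\<lambda>r. L r u) (\<lambda>v. L' v u) q"
    "\<And>r. r \<in> U \<Longrightarrow> linear (L r)" "has_dchart \<phi> f f' q"
  shows "has_dchart \<phi> (\<lambda>r. L r (f r)) (\<lambda>v. L q (f' v) + L' v (f q)) q"
    and "linear (L' v)"
proof -
  show lin': "linear (L' v)" for v
  proof (rule linearI)
    fix u w
    have "has_dchart \<phi> (\<lambda>r. L r (u + w)) (\<lambda>v. L' v u + L' v w) q"
      using has_dchart_add[OF assms(3)[of u] assms(3)[of w]]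
      by (subst has_dchart_cong[OF assms(1,2)]) (auto simp: linear_add[OF assms(4)])
    then show "L' v (u + w) = L' v u + L' v w"
      using has_dchartD[OF assms(3)[of "u + w"]] has_dchartD by (metis (no_types, lifting))
  next
    fix a u
    have "has_dchart \<phi> (\<lambda>r. L r (a *\<^sub>R u)) (\<lambda>v. a *\<^sub>R L' v u) q"
      using has_dchart_bounded_linear[OF bounded_linear_scaleR_right assms(3)[of u], of a]
      by (subst has_dchart_cong[OF assms(1,2)]) (auto simp: linear_cmul[OF assms(4)])
    then show "L' v (a *\<^sub>R u) = a *\<^sub>R L' v u"
      using has_dchartD[OF assms(3)[of "a *\<^sub>R u"]] has_dchartD by (metis (no_types, lifting))
  qed
  have "has_dchart \<phi> (\<lambda>r. \<Sum>i\<in>UNIV. f r $ i *\<^sub>R L r (axis i 1))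
      (\<lambda>v. \<Sum>i\<in>UNIV. f q $ i *\<^sub>R L' v (axis i 1) + f' v $ i *\<^sub>R L q (axis i 1)) q"
    by (intro has_dchart_sum has_dchart_scaleR[OF assms(1,2)] assms(3)
        has_dchart_bounded_linear[OF bounded_linear_vec_nth assms(5)])
  moreover have "(\<Sum>i\<in>UNIV. f q $ i *\<^sub>R L' v (axis i 1) + f' v $ i *\<^sub>R L q (axis i 1)) = L q (f' v) + L' v (f q)" for v
    using linear_expand_axis[OF assms(4)[OF assms(2)], of "f' v"] linear_expand_axis[OF lin', of v "f q"]
    by (simp add: sum.distrib)
  ultimately show "has_dchart \<phi> (\<lambda>r. L r (f r)) (\<lambda>v. L q (f' v) + L' v (f q)) q"
    using has_dchart_cong[OF assms(1,2), of "\<lambda>r. L r (f r)" "\<lambda>r. \<Sum>i\<in>UNIV. f r $ i *\<^sub>R L r (axis i 1)"]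
      linear_expand_axis[OF assms(4)] by simp
qed

section \<open>Charts of an atlas, and smoothness tested in a single chart\<close>

lemma atlas_openin: "smooth_manifold M \<Longrightarrow> \<phi> \<in> atlas M \<Longrightarrow> openin (mtop M) (fst \<phi>)"
  by (simp add: smooth_manifold_def)

lemma chart_at_atlas: "smooth_manifold M \<Longrightarrow> p \<in> points M \<Longrightarrow> chart_at M p \<in> atlas M"
  by (simp add: smooth_manifold_def)

lemma chart_at_mem: "smooth_manifold M \<Longrightarrow> p \<in> points M \<Longrightarrow> p \<in> fst (chart_at M p)"
  by (simp add: smooth_manifold_def)

lemma mem_points: "smooth_manifold M \<Longrightarrow> \<phi> \<in> atlas M \<Longrightarrow> q \<in> fst \<phi> \<Longrightarrow> q \<in> points M"
  using atlas_openin openin_subset unfolding points_def by blast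

lemma atlas_chart_open:
  assumes M: "smooth_manifold M" "\<phi> \<in> atlas M" and U: "openin (mtop M) U" "U \<subseteq> fst \<phi>"
  shows "chart_open \<phi> U"
proof -
  have hom: "homeomorphic_map (subtopology (mtop M) (fst \<phi>)) (top_of_set (snd \<phi> ` fst \<phi>)) (snd \<phi>)"
    and o: "open (snd \<phi> ` fst \<phi>)" using M by (auto simp: smooth_manifold_def)
  have "topspace (subtopology (mtop M) (fst \<phi>)) = fst \<phi>"
    using openin_subset[OF atlas_openin[OF M]] by (auto simp: topspace_subtopology)
  then have "inj_on (snd \<phi>) (fst \<phi>)" using hom homeomorphic_imp_injective_map by metis
  moreover have "openin (subtopology (mtop M) (fst \<phi>)) U"
    using U by (auto simp: openin_subtopology intro!: exI[of _ U])
  then have "openin (top_of_set (snd \<phi> ` fst \<phi>)) (snd \<phi> ` U)"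
    using homeomorphic_imp_open_map[OF hom] unfolding open_map_def by blast
  then have "open (snd \<phi> ` U)" using o openin_open_eq by blast
  ultimately show ?thesis using U by (simp add: chart_open_def)
qed

lemma atlas_trans_on:
  assumes M: "smooth_manifold M" "\<phi> \<in> atlas M" "\<psi> \<in> atlas M"
    and U: "openin (mtop M) U" "U \<subseteq> fst \<phi>" "U \<subseteq> fst \<psi>"
  shows "trans_on \<phi> \<psi> U"
proof -
  have "smooth_on (snd \<phi> ` (fst \<phi> \<inter> fst \<psi>)) (in_chart \<phi> (snd \<psi>))"
    using M by (simp add: smooth_manifold_def)
  then have "smooth_in \<phi> U (snd \<psi>)"
    unfolding smooth_in_def by (rule smooth_on_subset) (use U in auto)
  moreover have "inj_on (snd \<psi>) (fst \<psi>)"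
    using atlas_chart_open[OF M(1,3) atlas_openin[OF M(1,3)]] by (simp add: chart_open_def)
  ultimately show ?thesis using atlas_chart_open[OF M(1,2) U(1,2)] U by (simp add: trans_on_def)
qed

lemma atlas_jac:
  assumes M: "smooth_manifold M" "\<phi> \<in> atlas M" "\<psi> \<in> atlas M" and q: "q \<in> fst \<phi>" "q \<in> fst \<psi>"
  shows "linear (jac \<phi> \<psi> q)" "jac \<psi> \<phi> q (jac \<phi> \<psi> q v) = v"
    "\<theta> \<in> atlas M \<Longrightarrow> q \<in> fst \<theta> \<Longrightarrow> jac \<psi> \<theta> q (jac \<phi> \<psi> q v) = jac \<phi> \<theta> q v"
    "jac \<phi> \<phi> q v = v"
proof -
  let ?U = "\<lambda>\<phi> \<psi>. fst \<phi> \<inter> fst \<psi>"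
  have T: "trans_on \<phi>' \<psi>' (?U \<phi>' \<psi>')" if "\<phi>' \<in> atlas M" "\<psi>' \<in> atlas M" for \<phi>' \<psi>'
    using that M(1) by (intro atlas_trans_on) (auto intro: atlas_openin)
  show "linear (jac \<phi> \<psi> q)" by (rule linear_jac[OF T]) (use assms in auto)
  show 1: "jac \<phi> \<phi> q v = v" by (rule jac_refl[OF trans_on_open[OF T[OF M(2,3)]]]) (use q in auto)
  show 2: "jac \<psi> \<theta> q (jac \<phi> \<psi> q v) = jac \<phi> \<theta> q v" if "\<theta> \<in> atlas M" "q \<in> fst \<theta>" for \<theta>
    by (rule jac_trans[OF T[OF M(2,3)] T[OF M(3) that(1)], symmetric]) (use q that in auto)
  show "jac \<psi> \<phi> q (jac \<phi> \<psi> q v) = v" using 2[OF M(2) q(1)] 1 by simp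
qed

lemma atlas_jac_at:
  assumes M: "smooth_manifold M" "\<phi> \<in> atlas M" and q: "q \<in> fst \<phi>"
  shows "linear (jac \<phi> (chart_at M q) q)" "linear (jac (chart_at M q) \<phi> q)"
    "jac \<phi> (chart_at M q) q (jac (chart_at M q) \<phi> q v) = v"
    "jac (chart_at M q) \<phi> q (jac \<phi> (chart_at M q) q v) = v"
    "\<psi> \<in> atlas M \<Longrightarrow> q \<in> fst \<psi> \<Longrightarrow> jac \<phi> \<psi> q (jac (chart_at M q) \<phi> q v) = jac (chart_at M q) \<psi> q v"
proof -
  let ?\<theta> = "chart_at M q"
  have th: "?\<theta> \<in> atlas M" "q \<in> fst ?\<theta>"
    using chart_at_atlas[OF M(1)] chart_at_mem[OF M(1)] mem_points[OF M q] by auto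
  show "linear (jac \<phi> ?\<theta> q)" "jac ?\<theta> \<phi> q (jac \<phi> ?\<theta> q v) = v"
    using atlas_jac(1,2)[OF M th(1) q th(2)] by simp_all
  show "linear (jac ?\<theta> \<phi> q)" "jac \<phi> ?\<theta> q (jac ?\<theta> \<phi> q v) = v"
    using atlas_jac(1,2)[OF M(1) th(1) M(2) th(2) q] by simp_all
  show "jac \<phi> \<psi> q (jac ?\<theta> \<phi> q v) = jac ?\<theta> \<psi> q v" if "\<psi> \<in> atlas M" "q \<in> fst \<psi>"
    using atlas_jac(3)[OF M(1) th(1) M(2) th(2) q] that by simp
qed

lemma dchart_chart_at:
  assumes M: "smooth_manifold M" "\<phi> \<in> atlas M" and U: "openin (mtop M) U" "q \<in> U" "U \<subseteq> fst \<phi>"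
    and f: "has_dchart \<phi> f f' q"
  shows "dchart (chart_at M q) f q v = dchart \<phi> f q (jac (chart_at M q) \<phi> q v)"
    "has_dchart (chart_at M q) f (\<lambda>v. f' (jac (chart_at M q) \<phi> q v)) q"
proof -
  let ?\<theta> = "chart_at M q"
  have q: "q \<in> points M" using mem_points[OF M] U by blast
  have th: "?\<theta> \<in> atlas M" "q \<in> fst ?\<theta>" using chart_at_atlas[OF M(1) q] chart_at_mem[OF M(1) q] .
  have T: "trans_on ?\<theta> \<phi> (U \<inter> fst ?\<theta>)"
    using M th U openin_Int[OF U(1) atlas_openin[OF M(1) th(1)]] by (intro atlas_trans_on) auto
  show "dchart (chart_at M q) f q v = dchart \<phi> f q (jac (chart_at M q) \<phi> q v)"
    unfolding jac_eq_dchart by (rule dchart_trans[OF T _ f]) (use U th in auto)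
  show "has_dchart (chart_at M q) f (\<lambda>v. f' (jac (chart_at M q) \<phi> q v)) q"
    unfolding jac_eq_dchart by (rule has_dchart_trans[OF T _ f]) (use U th in auto)
qed

lemma vec_comp_trans:
  assumes M: "smooth_manifold M" "\<phi> \<in> atlas M" "\<psi> \<in> atlas M" and q: "q \<in> fst \<phi>" "q \<in> fst \<psi>"
  shows "vec_comp M \<psi> X q = jac \<phi> \<psi> q (vec_comp M \<phi> X q)"
  using atlas_jac_at(5)[OF M(1,2) q(1) M(3) q(2)] by (simp add: vec_comp_def)

lemma smooth_vf_iff:
  assumes M: "smooth_manifold M" "\<phi> \<in> atlas M" and U: "openin (mtop M) U" "U \<subseteq> fst \<phi>"
  shows "smooth_vf M U X \<longleftrightarrow> smooth_in \<phi> U (vec_comp M \<phi> X)"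
proof
  assume "smooth_vf M U X"
  then have "smooth_on (snd \<phi> ` (U \<inter> fst \<phi>)) (in_chart \<phi> (vec_comp M \<phi> X))"
    using M by (simp add: smooth_vf_def)
  then show "smooth_in \<phi> U (vec_comp M \<phi> X)" using U by (simp add: smooth_in_def Int_absorb2)
next
  assume s: "smooth_in \<phi> U (vec_comp M \<phi> X)"
  show "smooth_vf M U X"
    unfolding smooth_vf_def
  proof
    fix \<psi> assume psi: "\<psi> \<in> atlas M"
    let ?W = "U \<inter> fst \<psi>"
    have W: "openin (mtop M) ?W" using U atlas_openin[OF M(1) psi] by blast
    have T: "trans_on \<phi> \<psi> ?W" "trans_on \<psi> \<phi> ?W"
      using M psi U W by (auto intro!: atlas_trans_on)
    have "smooth_in \<phi> ?W (\<lambda>q. jac \<phi> \<psi> q (vec_comp M \<phi> X q))"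
      by (rule smooth_in_linear_apply[OF trans_on_open[OF T(1)] smooth_in_jac[OF T(1)] linear_jac[OF T(1)]
          smooth_in_subset[OF s]]) auto
    then have "smooth_in \<phi> ?W (vec_comp M \<psi> X)"
      by (rule smooth_in_cong[OF trans_on_open[OF T(1)], rotated])
        (use U in \<open>auto simp: vec_comp_trans[OF M psi]\<close>)
    then have "smooth_in \<psi> ?W (vec_comp M \<psi> X)"
      by (rule smooth_in_trans[OF T(2) trans_on_open[OF T(1)], rotated]) simp
    then show "smooth_on (snd \<psi> ` ?W) (in_chart \<psi> (vec_comp M \<psi> X))" by (simp add: smooth_in_def)
  qed
qed

lemma smooth_map_on_iff:
  assumes M: "smooth_manifold M" "\<phi> \<in> atlas M" and U: "openin (mtop M) U" "U \<subseteq> fst \<phi>"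
  shows "smooth_map_on M U f \<longleftrightarrow> smooth_in \<phi> U f"
proof
  assume "smooth_map_on M U f"
  then have "smooth_on (snd \<phi> ` (U \<inter> fst \<phi>)) (in_chart \<phi> f)" using M by (simp add: smooth_map_on_def)
  then show "smooth_in \<phi> U f" using U by (simp add: smooth_in_def Int_absorb2)
next
  assume s: "smooth_in \<phi> U f"
  show "smooth_map_on M U f"
    unfolding smooth_map_on_def
  proof
    fix \<psi> assume psi: "\<psi> \<in> atlas M"
    let ?W = "U \<inter> fst \<psi>"
    have W: "openin (mtop M) ?W" using U atlas_openin[OF M(1) psi] by blast
    have T: "trans_on \<psi> \<phi> ?W" "chart_open \<phi> ?W"
      using M psi U W by (auto intro!: atlas_trans_on atlas_chart_open)
    have "smooth_in \<psi> ?W f"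
      by (rule smooth_in_trans[OF T _ smooth_in_subset[OF s]]) auto
    then show "smooth_on (snd \<psi> ` ?W) (in_chart \<psi> f)" by (simp add: smooth_in_def)
  qed
qed

lemma det_jac_nonzero:
  fixes M :: "('a, real^'b) manifold"
  assumes M: "smooth_manifold M" "\<phi> \<in> atlas M" "\<psi> \<in> atlas M" and q: "q \<in> fst \<phi>" "q \<in> fst \<psi>"
  shows "det (matrix (jac \<phi> \<psi> q)) \<noteq> 0"
proof -
  have "matrix (jac \<psi> \<phi> q) ** matrix (jac \<phi> \<psi> q) = matrix (jac \<psi> \<phi> q \<circ> jac \<phi> \<psi> q)"
    using matrix_compose[OF atlas_jac(1)[OF M q] atlas_jac(1)[OF M(1,3,2) q(2,1)]] by simp
  also have "jac \<psi> \<phi> q \<circ> jac \<phi> \<psi> q = id" using atlas_jac(2)[OF M q] by (auto simp: fun_eq_iff)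
  also have "matrix id = (mat 1 :: real^'b^'b)" by (rule matrix_id_mat_1)
  finally show ?thesis using det_mul[of "matrix (jac \<psi> \<phi> q)" "matrix (jac \<phi> \<psi> q)"] by auto
qed

lemma dens_comp_trans:
  fixes M :: "('a, real^'m) manifold"
  assumes M: "smooth_manifold M" "\<phi> \<in> atlas M" "\<psi> \<in> atlas M" and q: "q \<in> fst \<phi>" "q \<in> fst \<psi>"
  shows "dens_comp M k \<psi> s q = \<bar>det (matrix (jac \<phi> \<psi> q))\<bar> powr (k / real CARD('m)) * dens_comp M k \<phi> s q"
proof -
  have "matrix (jac (chart_at M q) \<psi> q) = matrix (jac \<phi> \<psi> q \<circ> jac (chart_at M q) \<phi> q)"
    using atlas_jac_at(5)[OF M(1,2) q(1) M(3) q(2)] by (simp add: comp_def)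
  also have "\<dots> = matrix (jac \<phi> \<psi> q) ** matrix (jac (chart_at M q) \<phi> q)"
    by (rule matrix_compose[OF atlas_jac_at(2)[OF M(1,2) q(1)] atlas_jac(1)[OF M q]])
  finally show ?thesis by (simp add: dens_comp_def det_mul abs_mult powr_mult)
qed

lemma smooth_in_det_jac_powr:
  assumes M: "smooth_manifold M" "\<phi> \<in> atlas M" "\<psi> \<in> atlas M"
    and U: "openin (mtop M) U" "U \<subseteq> fst \<phi>" "U \<subseteq> fst \<psi>"
  shows "smooth_in \<phi> U (\<lambda>q. \<bar>det (matrix (jac \<phi> \<psi> q))\<bar> powr a)"
proof -
  have T: "trans_on \<phi> \<psi> U" using atlas_trans_on[OF M U] .
  show ?thesis
    by (intro smooth_in_abs_powr trans_on_open[OF T], unfold matrix_def,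
        intro smooth_in_det trans_on_open[OF T] smooth_in_vec_nth smooth_in_jac[OF T],
        fold matrix_def, intro det_jac_nonzero[OF M]) (use U in auto)
qed

lemma smooth_dens_iff:
  fixes M :: "('a, real^'m) manifold"
  assumes M: "smooth_manifold M" "\<phi> \<in> atlas M" and U: "openin (mtop M) U" "U \<subseteq> fst \<phi>"
  shows "smooth_dens M k U s \<longleftrightarrow> smooth_in \<phi> U (dens_comp M k \<phi> s)"
proof
  assume "smooth_dens M k U s"
  then have "smooth_on (snd \<phi> ` (U \<inter> fst \<phi>)) (in_chart \<phi> (dens_comp M k \<phi> s))"
    using M by (simp add: smooth_dens_def)
  then show "smooth_in \<phi> U (dens_comp M k \<phi> s)" using U by (simp add: smooth_in_def Int_absorb2)
next
  assume s: "smooth_in \<phi> U (dens_comp M k \<phi> s)"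
  show "smooth_dens M k U s"
    unfolding smooth_dens_def
  proof
    fix \<psi> assume psi: "\<psi> \<in> atlas M"
    let ?W = "U \<inter> fst \<psi>"
    have W: "openin (mtop M) ?W" using U atlas_openin[OF M(1) psi] by blast
    have T: "trans_on \<phi> \<psi> ?W" "trans_on \<psi> \<phi> ?W"
      using M psi U W by (auto intro!: atlas_trans_on)
    have "smooth_in \<phi> ?W (\<lambda>q. \<bar>det (matrix (jac \<phi> \<psi> q))\<bar> powr (k / real CARD('m)) * dens_comp M k \<phi> s q)"
      by (intro smooth_in_mult trans_on_open[OF T(1)] smooth_in_det_jac_powr[OF M psi W]
          smooth_in_subset[OF s]) (use U in auto)
    then have "smooth_in \<phi> ?W (dens_comp M k \<psi> s)"
      by (rule smooth_in_cong[OF trans_on_open[OF T(1)], rotated])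
        (use U in \<open>auto simp: dens_comp_trans[OF M psi]\<close>)
    then have "smooth_in \<psi> ?W (dens_comp M k \<psi> s)"
      by (rule smooth_in_trans[OF T(2) trans_on_open[OF T(1)], rotated]) simp
    then show "smooth_on (snd \<psi> ` ?W) (in_chart \<psi> (dens_comp M k \<psi> s))" by (simp add: smooth_in_def)
  qed
qed

lemma smooth_vf_subset: "smooth_vf M U X \<Longrightarrow> V \<subseteq> U \<Longrightarrow> smooth_vf M V X"
  unfolding smooth_vf_def by (meson Int_mono equalityD1 image_mono smooth_on_subset)

lemma smooth_dens_subset: "smooth_dens M k U X \<Longrightarrow> V \<subseteq> U \<Longrightarrow> smooth_dens M k V X"
  unfolding smooth_dens_def by (meson Int_mono equalityD1 image_mono smooth_on_subset)

lemma nearI: "openin (mtop M) U \<Longrightarrow> p \<in> U \<Longrightarrow> P U \<Longrightarrow> near M p P"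
  by (auto simp: near_def)

text \<open>The field with constant components in \<open>\<phi>\<close>, written in the preferred
  frames. It extends \<open>vec_ext\<close> to an arbitrary chart, which makes it possible to keep
  one chart while the base point varies.\<close>

definition frame :: "('a, real^'m) manifold \<Rightarrow> ('a, real^'m) chart \<Rightarrow> real^'m \<Rightarrow> 'a \<Rightarrow> real^'m" where
  "frame M \<phi> v q = jac \<phi> (chart_at M q) q v"

lemma vec_ext_eq_frame: "vec_ext M p v = frame M (chart_at M p) v"
  by (simp add: vec_ext_def frame_def fun_eq_iff)

lemma vec_comp_frame:
  assumes M: "smooth_manifold M" "\<phi> \<in> atlas M" and q: "q \<in> fst \<phi>"
  shows "vec_comp M \<phi> (frame M \<phi> v) q = v"
  using atlas_jac_at(4)[OF assms] by (simp add: vec_comp_def frame_def)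

lemma vec_comp_frame_other:
  assumes M: "smooth_manifold M" "\<phi> \<in> atlas M" "\<psi> \<in> atlas M" and q: "q \<in> fst \<phi>" "q \<in> fst \<psi>"
  shows "vec_comp M \<psi> (frame M \<phi> v) q = jac \<phi> \<psi> q v"
  using vec_comp_trans[OF M q] vec_comp_frame[OF M(1,2) q(1)] by metis

lemma smooth_vf_frame:
  assumes M: "smooth_manifold M" "\<phi> \<in> atlas M" and U: "openin (mtop M) U" "U \<subseteq> fst \<phi>"
  shows "smooth_vf M U (frame M \<phi> v)"
  unfolding smooth_vf_iff[OF assms]
  by (rule smooth_in_cong[OF atlas_chart_open[OF assms] _ smooth_in_const[of _ _ v]])
    (use U vec_comp_frame[OF M] in auto)

text \<open>The connection is d + \<open>G\<close> in the chart \<open>\<phi>\<close>; the outer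
  \<open>jac\<close> translates the value of \<open>D\<close> at \<open>q\<close> from the preferred
  chart at \<open>q\<close>. The induced connection on \<open>N\<close> is later shown to satisfy
  exactly this predicate.\<close>

definition conn_chart ::
    "('a, real^'m) manifold \<Rightarrow> ('a, real^'m) conn \<Rightarrow> ('a, real^'m) chart \<Rightarrow> 'a set \<Rightarrow>
     ('a \<Rightarrow> real^'m \<Rightarrow> real^'m \<Rightarrow> real^'m) \<Rightarrow> bool" where
  "conn_chart M D \<phi> U G \<longleftrightarrow>
     (\<forall>q\<in>U. bilinear (G q)) \<and> (\<forall>u v. smooth_in \<phi> U (\<lambda>q. G q u v)) \<and>
     (\<forall>q\<in>U. \<forall>Y v. near M q (\<lambda>W. smooth_vf M W Y) \<longrightarrow>
        jac (chart_at M q) \<phi> q (D q v Y) =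
          dchart \<phi> (vec_comp M \<phi> Y) q (jac (chart_at M q) \<phi> q v)
          + G q (jac (chart_at M q) \<phi> q v) (vec_comp M \<phi> Y q))"

definition christoffel ::
    "('a, real^'m) manifold \<Rightarrow> ('a, real^'m) conn \<Rightarrow> ('a, real^'m) chart \<Rightarrow> 'a \<Rightarrow> real^'m \<Rightarrow> real^'m \<Rightarrow> real^'m" where
  "christoffel M D \<phi> q u v = vec_comp M \<phi> (\<lambda>r. D r (frame M \<phi> u r) (frame M \<phi> v)) q"

lemma connectionD:
  assumes "connection M D" "p \<in> points M" "near M p (\<lambda>U. smooth_vf M U Y)"
  shows "linear (\<lambda>v. D p v Y)"
    "near M p (\<lambda>U. \<forall>q\<in>U. Z q = Y q) \<Longrightarrow> D p v Z = D p v Y"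
    "near M p (\<lambda>U. smooth_vf M U Z) \<Longrightarrow> D p v (\<lambda>q. Y q + Z q) = D p v Y + D p v Z"
    "near M p (\<lambda>U. smooth_map_on M U f) \<Longrightarrow>
       D p v (\<lambda>q. f q *\<^sub>R Y q) = dir_deriv M p v f *\<^sub>R Y p + f p *\<^sub>R D p v Y"
  using assms by (simp_all add: connection_def)

text \<open>A vector field is expanded in the constant frame of \<open>\<phi>\<close>. Additivity
  and the Leibniz rule leave the derivative of its components and a term of order zero, whose
  coefficients are the values of \<open>D\<close> on the frame.\<close>

lemma connection_chart:
  fixes M :: "('a, real^'m) manifold"
  assumes M: "smooth_manifold M" "\<phi> \<in> atlas M" and U: "openin (mtop M) U" "U \<subseteq> fst \<phi>"
    and D: "connection M D"
  shows "conn_chart M D \<phi> U (christoffel M D \<phi>)"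
  unfolding conn_chart_def
proof (intro conjI ballI allI impI)
  have co: "chart_open \<phi> U" using atlas_chart_open[OF M U] .
  have pts: "q \<in> points M" if "q \<in> U" for q using mem_points[OF M] that U by blast
  have sf: "smooth_vf M U (frame M \<phi> v)" for v using smooth_vf_frame[OF M U] .
  have nf: "near M q (\<lambda>W. smooth_vf M W (frame M \<phi> v))" if "q \<in> U" for q v
    using nearI[OF U(1) that, of "\<lambda>W. smooth_vf M W (frame M \<phi> v)"] sf by simp
  have "smooth_vf M U (\<lambda>p. D p (frame M \<phi> u p) (frame M \<phi> v))" for u v
    using D U(1) sf unfolding connection_def by blast
  then show "smooth_in \<phi> U (\<lambda>q. christoffel M D \<phi> q u v)" for u v
    unfolding smooth_vf_iff[OF M U] christoffel_def .
  fix q assume q: "q \<in> U"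
  let ?J = "jac (chart_at M q) \<phi> q"
  note J = atlas_jac_at[OF M subsetD[OF U(2) q]]
  have G: "christoffel M D \<phi> q u v = ?J (D q (jac \<phi> (chart_at M q) q u) (frame M \<phi> v))" for u v
    by (simp add: christoffel_def vec_comp_def frame_def)
  show bil: "bilinear (christoffel M D \<phi> q)"
    unfolding bilinear_def
  proof (intro conjI allI)
    show "linear (\<lambda>u. christoffel M D \<phi> q u v)" for v
      using linear_compose[OF linear_compose[OF J(1) connectionD(1)[OF D pts[OF q] nf[OF q]]] J(2)]
      unfolding G by (simp add: comp_def)
    show "linear (christoffel M D \<phi> q u)" for u
    proof (rule linearI)
      fix v w
      have "near M q (\<lambda>W. \<forall>r\<in>W. frame M \<phi> (v + w) r = frame M \<phi> v r + frame M \<phi> w r)"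
        by (rule nearI[OF U(1) q]) (use U in \<open>auto simp: frame_def linear_add[OF atlas_jac_at(1)[OF M]]\<close>)
      moreover have "near M q (\<lambda>W. smooth_vf M W (\<lambda>r. frame M \<phi> v r + frame M \<phi> w r))"
      proof (rule nearI[OF U(1) q])
        show "smooth_vf M U (\<lambda>r. frame M \<phi> v r + frame M \<phi> w r)"
          unfolding smooth_vf_iff[OF M U]
          by (rule smooth_in_cong[OF co _ smooth_in_const[of _ _ "v + w"]])
            (use U in \<open>auto simp: vec_comp_def frame_def linear_add[OF atlas_jac_at(2)[OF M]] atlas_jac_at(4)[OF M]\<close>)
      qed
      ultimately have "D q x (frame M \<phi> (v + w)) = D q x (\<lambda>r. frame M \<phi> v r + frame M \<phi> w r)" for x
        using connectionD(2)[OF D pts[OF q]] by blast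
      then show "christoffel M D \<phi> q u (v + w) = christoffel M D \<phi> q u v + christoffel M D \<phi> q u w"
        unfolding G by (simp add: connectionD(3)[OF D pts[OF q] nf[OF q] nf[OF q]] linear_add[OF J(2)])
    next
      fix a v
      have "near M q (\<lambda>W. \<forall>r\<in>W. frame M \<phi> (a *\<^sub>R v) r = a *\<^sub>R frame M \<phi> v r)"
        by (rule nearI[OF U(1) q]) (use U in \<open>auto simp: frame_def linear_cmul[OF atlas_jac_at(1)[OF M]]\<close>)
      moreover have "near M q (\<lambda>W. smooth_vf M W (\<lambda>r. a *\<^sub>R frame M \<phi> v r))"
      proof (rule nearI[OF U(1) q])
        show "smooth_vf M U (\<lambda>r. a *\<^sub>R frame M \<phi> v r)"
          unfolding smooth_vf_iff[OF M U]
          by (rule smooth_in_cong[OF co _ smooth_in_const[of _ _ "a *\<^sub>R v"]])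
            (use U in \<open>auto simp: vec_comp_def frame_def linear_cmul[OF atlas_jac_at(2)[OF M]] atlas_jac_at(4)[OF M]\<close>)
      qed
      ultimately have 1: "D q x (frame M \<phi> (a *\<^sub>R v)) = D q x (\<lambda>r. a *\<^sub>R frame M \<phi> v r)" for x
        using connectionD(2)[OF D pts[OF q]] by blast
      have "near M q (\<lambda>W. smooth_map_on M W (\<lambda>_. a))"
        by (rule nearI[OF U(1) q]) (simp add: smooth_map_on_iff[OF M U] smooth_in_const)
      moreover have "dir_deriv M q x (\<lambda>_. a) = 0" for x
        unfolding dir_deriv_eq_dchart has_dchartD[OF has_dchart_const] ..
      ultimately have "D q x (\<lambda>r. a *\<^sub>R frame M \<phi> v r) = a *\<^sub>R D q x (frame M \<phi> v)" for x
        using connectionD(4)[OF D pts[OF q] nf[OF q]] by simp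
      then show "christoffel M D \<phi> q u (a *\<^sub>R v) = a *\<^sub>R christoffel M D \<phi> q u v"
        unfolding G 1 by (simp add: linear_cmul[OF J(2)])
    qed
  qed
  fix Y v assume "near M q (\<lambda>W. smooth_vf M W Y)"
  then obtain W where W: "openin (mtop M) W" "q \<in> W" "smooth_vf M W Y" by (auto simp: near_def)
  define V where "V = W \<inter> U"
  have V: "openin (mtop M) V" "V \<subseteq> fst \<phi>" "q \<in> V" "V \<subseteq> U" using W U q by (auto simp: V_def)
  have coV: "chart_open \<phi> V" using atlas_chart_open[OF M V(1,2)] .
  define f where "f = (\<lambda>i r. vec_comp M \<phi> Y r $ i)"
  have YV: "smooth_in \<phi> V (vec_comp M \<phi> Y)"
    using smooth_vf_subset[OF W(3), of V] by (simp add: V_def smooth_vf_iff[OF M V(1,2)[unfolded V_def]])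
  have fV: "smooth_in \<phi> V (f i)" for i
    unfolding f_def by (rule smooth_in_vec_nth[OF coV YV])
  have sV: "smooth_vf M V (\<lambda>r. \<Sum>i\<in>I. f i r *\<^sub>R frame M \<phi> (axis i 1) r)" for I
    unfolding smooth_vf_iff[OF M V(1,2)]
  proof (rule smooth_in_cong[OF coV])
    show "smooth_in \<phi> V (\<lambda>r. \<Sum>i\<in>I. f i r *\<^sub>R axis i 1)"
      by (intro smooth_in_sum smooth_in_scaleR smooth_in_const coV fV)
    show "(\<Sum>i\<in>I. f i r *\<^sub>R axis i 1) = vec_comp M \<phi> (\<lambda>r. \<Sum>i\<in>I. f i r *\<^sub>R frame M \<phi> (axis i 1) r) r"
      if "r \<in> V" for r
      using that V by (auto simp: vec_comp_def frame_def linear_sum[OF atlas_jac_at(2)[OF M]]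
          linear_cmul[OF atlas_jac_at(2)[OF M]] atlas_jac_at(4)[OF M])
  qed
  have sV1: "smooth_vf M V (\<lambda>r. f i r *\<^sub>R frame M \<phi> (axis i 1) r)" for i
    using sV[of "{i}"] by simp
  have nV: "near M q (\<lambda>W. smooth_vf M W X)" if "smooth_vf M V X" for X
    using nearI[OF V(1,3), of "\<lambda>W. smooth_vf M W X"] that by simp
  \<comment> \<open>The expansion is available on the domain \<open>V\<close> only, so
    \<open>Y\<close> is replaced by it through locality on germs.\<close>
  have "near M q (\<lambda>W. \<forall>r\<in>W. (\<Sum>i\<in>UNIV. f i r *\<^sub>R frame M \<phi> (axis i 1) r) = Y r)"
  proof (rule nearI[OF V(1,3)], intro ballI)
    fix r assume "r \<in> V"
    then have r: "r \<in> fst \<phi>" using V by blast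
    show "(\<Sum>i\<in>UNIV. f i r *\<^sub>R frame M \<phi> (axis i 1) r) = Y r"
      using linear_expand_axis[OF atlas_jac_at(1)[OF M r], of "vec_comp M \<phi> Y r"] atlas_jac_at(3)[OF M r]
      by (simp add: f_def frame_def vec_comp_def)
  qed
  moreover have "near M q (\<lambda>W. smooth_vf M W Y)" using W by (auto simp: near_def)
  ultimately have "D q v Y = D q v (\<lambda>r. \<Sum>i\<in>UNIV. f i r *\<^sub>R frame M \<phi> (axis i 1) r)"
    by (intro connectionD(2)[OF D pts[OF q], symmetric])
  also have "\<dots> = (\<Sum>i\<in>UNIV. dir_deriv M q v (f i) *\<^sub>R frame M \<phi> (axis i 1) q + f i q *\<^sub>R D q v (frame M \<phi> (axis i 1)))"
  proof -
    have "finite I \<Longrightarrow> D q v (\<lambda>r. \<Sum>i\<in>I. f i r *\<^sub>R frame M \<phi> (axis i 1) r) =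
      (\<Sum>i\<in>I. dir_deriv M q v (f i) *\<^sub>R frame M \<phi> (axis i 1) q + f i q *\<^sub>R D q v (frame M \<phi> (axis i 1)))" for I
    proof (induction I rule: finite_induct)
      \<comment> \<open>Additivity applied to 0 + 0 gives that \<open>D\<close> annihilates the zero
        field.\<close>
      case empty
      show ?case
        using connectionD(3)[OF D pts[OF q] nV[OF sV[of "{}"]] nV[OF sV[of "{}"]]] by simp
    next
      case (insert i I)
      have "near M q (\<lambda>W. smooth_map_on M W (f i))"
        by (rule nearI[OF V(1,3)]) (simp add: smooth_map_on_iff[OF M V(1,2)] fV)
      then show ?case
        using insert connectionD(3)[OF D pts[OF q] nV[OF sV1[of i]] nV[OF sV[of I]]]
          connectionD(4)[OF D pts[OF q] nf[OF q]] by simp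
    qed
    then show ?thesis by simp
  qed
  finally have "?J (D q v Y) = (\<Sum>i\<in>UNIV. dir_deriv M q v (f i) *\<^sub>R axis i 1 + f i q *\<^sub>R ?J (D q v (frame M \<phi> (axis i 1))))"
    by (simp add: linear_sum[OF J(2)] linear_add[OF J(2)] linear_cmul[OF J(2)] frame_def J(4))
  also have "\<dots> = (\<Sum>i\<in>UNIV. dir_deriv M q v (f i) *\<^sub>R axis i 1) + (\<Sum>i\<in>UNIV. f i q *\<^sub>R christoffel M D \<phi> q (?J v) (axis i 1))"
    by (simp add: sum.distrib G J(3))
  also have "(\<Sum>i\<in>UNIV. f i q *\<^sub>R christoffel M D \<phi> q (?J v) (axis i 1)) = christoffel M D \<phi> q (?J v) (vec_comp M \<phi> Y q)"
    using bil linear_expand_axis[of "christoffel M D \<phi> q (?J v)" "vec_comp M \<phi> Y q"]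
    by (simp add: f_def bilinear_def)
  also have "(\<Sum>i\<in>UNIV. dir_deriv M q v (f i) *\<^sub>R axis i 1) = dchart \<phi> (vec_comp M \<phi> Y) q (?J v)"
  proof -
    have "dir_deriv M q v (f i) = dchart \<phi> (vec_comp M \<phi> Y) q (?J v) $ i" for i
    proof -
      have h: "has_dchart \<phi> (f i) (\<lambda>w. dchart \<phi> (vec_comp M \<phi> Y) q w $ i) q"
        unfolding f_def
        by (rule has_dchart_bounded_linear[OF bounded_linear_vec_nth smooth_in_has_dchart[OF YV V(3)]])
      show ?thesis
        unfolding dir_deriv_eq_dchart dchart_chart_at(1)[OF M V(1,3,2) h] has_dchartD[OF h] ..
    qed
    then show ?thesis
      using basis_expansion[of "dchart \<phi> (vec_comp M \<phi> Y) q (?J v)"] by (simp add: scalar_mult_eq_scaleR)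
  qed
  finally show "?J (D q v Y) = dchart \<phi> (vec_comp M \<phi> Y) q (?J v) + christoffel M D \<phi> q (?J v) (vec_comp M \<phi> Y q)" .
qed

section \<open>Densities, Weyl structures and curvature in a chart\<close>

text \<open>Obtained by differentiating the identity that the Jacobians of a transition and of its
  inverse compose to the identity. It exchanges the second derivatives of the two maps, so that
  inhomogeneous terms of a chart change can be matched.\<close>

lemma dchart_jac_inverse:
  assumes M: "smooth_manifold M" "\<phi> \<in> atlas M" "\<theta> \<in> atlas M" and q: "q \<in> fst \<phi>" "q \<in> fst \<theta>"
  shows "dchart \<phi> (\<lambda>r. jac \<phi> \<theta> r (jac \<theta> \<phi> q u)) q w = - jac \<phi> \<theta> q (dchart \<phi> (\<lambda>r. jac \<theta> \<phi> r u) q w)"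
proof -
  let ?W = "fst \<phi> \<inter> fst \<theta>"
  have W: "openin (mtop M) ?W" "?W \<subseteq> fst \<phi>" "?W \<subseteq> fst \<theta>" "q \<in> ?W"
    using M q by (auto intro: atlas_openin)
  have T: "trans_on \<phi> \<theta> ?W" by (rule atlas_trans_on[OF M W(1-3)])
  have T': "trans_on \<theta> \<phi> ?W" by (rule atlas_trans_on[OF M(1,3,2) W(1,3,2)])
  have coW: "chart_open \<phi> ?W" using trans_on_open[OF T] .
  have hP: "has_dchart \<phi> (\<lambda>r. jac \<theta> \<phi> r u) (dchart \<phi> (\<lambda>r. jac \<theta> \<phi> r u) q) q"
    by (rule smooth_in_has_dchart[OF smooth_in_trans[OF T trans_on_open[OF T'] _ smooth_in_jac[OF T']] W(4)]) simp
  have 1: "has_dchart \<phi> (\<lambda>r. jac \<phi> \<theta> r (jac \<theta> \<phi> r u)) (\<lambda>w. jac \<phi> \<theta> q (dchart \<phi> (\<lambda>r. jac \<theta> \<phi> r u) q w)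
      + dchart \<phi> (\<lambda>r. jac \<phi> \<theta> r (jac \<theta> \<phi> q u)) q w) q"
    by (rule has_dchart_linear_apply(1)[OF coW W(4) smooth_in_has_dchart[OF smooth_in_jac[OF T] W(4)] linear_jac[OF T] hP])
  have 2: "has_dchart \<phi> (\<lambda>r. jac \<phi> \<theta> r (jac \<theta> \<phi> r u)) (\<lambda>w. 0) q"
    by (subst has_dchart_cong[OF coW W(4), where g = "\<lambda>_. u"])
      (simp_all add: atlas_jac(2)[OF M(1,3,2)] has_dchart_const)
  show ?thesis
    using fun_cong[OF has_dchartD[OF 1, unfolded has_dchartD[OF 2]], of w] by (simp add: eq_neg_iff_add_eq_0 add.commute)
qed

text \<open>\<open>dens_conn\<close> at \<open>q\<close> uses the preferred chart at
  \<open>q\<close>. Passing to \<open>\<phi>\<close> produces second derivatives of the transition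
  map twice: from the Jacobian determinant of the density and from the connection coefficients. The
  two contributions have equal traces and opposite signs.\<close>

lemma dens_conn_chart:
  fixes M :: "('a, real^'m) manifold"
  assumes M: "smooth_manifold M" "\<phi> \<in> atlas M" and U: "openin (mtop M) U" "U \<subseteq> fst \<phi>"
    and D: "conn_chart M D \<phi> U G" and q: "q \<in> U" and s: "has_dchart \<phi> (dens_comp M k \<phi> s) s' q"
  shows "\<bar>det (matrix (jac (chart_at M q) \<phi> q))\<bar> powr (k / real CARD('m)) * dens_conn M D k q v s =
    s' (jac (chart_at M q) \<phi> q v)
    + k / real CARD('m) * endo_trace (G q (jac (chart_at M q) \<phi> q v)) * dens_comp M k \<phi> s q"
proof -
  define \<theta> where "\<theta> = chart_at M q"
  define a where "a = k / real CARD('m)"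
  have qphi: "q \<in> fst \<phi>" using U q by blast
  have th: "\<theta> \<in> atlas M" "q \<in> fst \<theta>"
    unfolding \<theta>_def using chart_at_atlas[OF M(1)] chart_at_mem[OF M(1)] mem_points[OF M qphi] by auto
  define W where "W = U \<inter> fst \<theta>"
  have W: "openin (mtop M) W" "W \<subseteq> fst \<phi>" "W \<subseteq> fst \<theta>" "q \<in> W" "W \<subseteq> U"
    using U q th openin_Int[OF U(1) atlas_openin[OF M(1) th(1)]] by (auto simp: W_def)
  have T: "trans_on \<phi> \<theta> W" by (rule atlas_trans_on[OF M th(1) W(1-3)])
  have T': "trans_on \<theta> \<phi> W" by (rule atlas_trans_on[OF M(1) th(1) M(2) W(1,3,2)])
  have coW: "chart_open \<phi> W" using trans_on_open[OF T] .
  let ?J = "jac \<theta> \<phi> q" and ?I = "jac \<phi> \<theta> q"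
  note J = atlas_jac[OF M(1) th(1) M(2) th(2) qphi] and I = atlas_jac[OF M th(1) qphi th(2)]
  define x where "x = ?J v"
  define L' where "L' = (\<lambda>w u. dchart \<phi> (\<lambda>r. jac \<phi> \<theta> r u) q w)"
  define P' where "P' = (\<lambda>w u. dchart \<phi> (\<lambda>r. jac \<theta> \<phi> r u) q w)"
  have hL: "has_dchart \<phi> (\<lambda>r. jac \<phi> \<theta> r u) (\<lambda>w. L' w u) q" for u
    unfolding L'_def by (rule smooth_in_has_dchart[OF smooth_in_jac[OF T] W(4)])
  have lL: "linear (L' w)" for w
    by (rule has_dchart_linear_apply(2)[OF coW W(4) hL linear_jac[OF T] has_dchart_const])
  have IP: "?I (P' w u) = - L' w (?J u)" for w u
    unfolding P'_def L'_def dchart_jac_inverse[OF M th(1) qphi th(2)] by simp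
  define A where "A = \<bar>det (matrix ?I)\<bar> powr a"
  have AJ: "\<bar>det (matrix ?J)\<bar> powr a * A = 1"
  proof -
    have "matrix ?J ** matrix ?I = matrix (?J \<circ> ?I)" using matrix_compose[OF I(1) J(1)] by simp
    also have "?J \<circ> ?I = id" using I(2) by (auto simp: fun_eq_iff)
    also have "matrix id = (mat 1 :: real^'m^'m)" by (rule matrix_id_mat_1)
    finally have "\<bar>det (matrix ?J)\<bar> * \<bar>det (matrix ?I)\<bar> = 1"
      using det_mul[of "matrix ?J" "matrix ?I"] by (simp flip: abs_mult)
    then show ?thesis by (simp add: A_def flip: powr_mult)
  qed
  have "has_dchart \<phi> (\<lambda>r. \<bar>det (matrix (jac \<phi> \<theta> r))\<bar> powr a) (\<lambda>w. a * A * endo_trace (\<lambda>u. ?J (L' w u))) q"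
    unfolding A_def by (rule has_dchart_det_powr[OF coW W(4) hL I(1) J(1) lL I(2)])
  from has_dchart_mult[OF coW W(4) this s]
  have "has_dchart \<phi> (dens_comp M k \<theta> s) (\<lambda>w. A * s' w + a * A * endo_trace (\<lambda>u. ?J (L' w u)) * dens_comp M k \<phi> s q) q"
    by (subst has_dchart_cong[OF coW W(4), where g = "\<lambda>r. \<bar>det (matrix (jac \<phi> \<theta> r))\<bar> powr a * dens_comp M k \<phi> s r"])
      (use W dens_comp_trans[OF M th(1), where k = k and s = s] in \<open>auto simp: A_def a_def\<close>)
  from dchart_chart_at(1)[OF M W(1,4,2) this] has_dchartD[OF this]
  have d: "dir_deriv M q v (dens_comp M k \<theta> s) = A * s' x + a * A * endo_trace (\<lambda>u. ?J (L' x u)) * dens_comp M k \<phi> s q"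
    by (simp add: dir_deriv_eq_dchart \<theta>_def x_def)
  \<comment> \<open>The classical transformation law of connection coefficients, with its
    inhomogeneous second-derivative term.\<close>
  have cf: "D q v (vec_ext M q u) = - L' x (?J u) + ?I (G q x (?J u))" for u
  proof -
    have vc: "vec_comp M \<phi> (frame M \<theta> u) r = jac \<theta> \<phi> r u" if "r \<in> W" for r
      by (rule vec_comp_frame_other[OF M(1) th(1) M(2)]) (use that W in auto)
    have "near M q (\<lambda>W. smooth_vf M W (frame M \<theta> u))"
      using nearI[OF W(1,4), of "\<lambda>W. smooth_vf M W (frame M \<theta> u)"] smooth_vf_frame[OF M(1) th(1) W(1,3)] by simp
    then have "?J (D q v (frame M \<theta> u)) = dchart \<phi> (vec_comp M \<phi> (frame M \<theta> u)) q x + G q x (vec_comp M \<phi> (frame M \<theta> u) q)"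
      using D q unfolding conn_chart_def x_def \<theta>_def by blast
    also have "dchart \<phi> (vec_comp M \<phi> (frame M \<theta> u)) q = (\<lambda>w. P' w u)"
      unfolding P'_def by (rule dchart_cong[OF coW W(4) vc])
    finally have "?J (D q v (frame M \<theta> u)) = P' x u + G q x (?J u)" using vc[OF W(4)] by simp
    then have "D q v (frame M \<theta> u) = ?I (P' x u + G q x (?J u))" using J(2)[of "D q v (frame M \<theta> u)"] by simp
    then show ?thesis by (simp add: vec_ext_eq_frame \<theta>_def[symmetric] linear_add[OF I(1)] IP)
  qed
  have lG: "linear (G q x)" using D q by (simp add: conn_chart_def bilinear_def)
  have "endo_trace (\<lambda>u. D q v (vec_ext M q u)) =
      endo_trace (\<lambda>u. ?I (G q x (?J u))) - endo_trace (\<lambda>u. L' x (?J u))"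
    unfolding cf using endo_trace_diff[of "\<lambda>u. ?I (G q x (?J u))" "\<lambda>u. L' x (?J u)"] by simp
  also have "endo_trace (\<lambda>u. ?I (G q x (?J u))) = endo_trace (G q x)"
    by (rule endo_trace_conj[OF lG I(1) J(1) I(2)])
  \<comment> \<open>Cyclicity identifies this trace with the one coming from the determinant in
    \<open>d\<close>; it enters \<open>tr\<close> with the opposite sign.\<close>
  also have "endo_trace (\<lambda>u. L' x (?J u)) = endo_trace (\<lambda>u. ?J (L' x u))"
    by (rule endo_trace_commute[OF lL J(1)])
  finally have tr: "endo_trace (\<lambda>u. D q v (vec_ext M q u)) = endo_trace (G q x) - endo_trace (\<lambda>u. ?J (L' x u))" .
  have sq: "s q = A * dens_comp M k \<phi> s q"
  proof -
    have "A * dens_comp M k \<phi> s q = (\<bar>det (matrix ?J)\<bar> powr a * A) * s q"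
      by (simp add: dens_comp_def \<theta>_def a_def)
    then show ?thesis using AJ by simp
  qed
  have "dens_conn M D k q v s = A * (s' x + a * endo_trace (G q x) * dens_comp M k \<phi> s q)"
    unfolding dens_conn_def \<theta>_def[symmetric] d tr a_def[symmetric] by (simp add: sq algebra_simps)
  then have "\<bar>det (matrix ?J)\<bar> powr a * dens_conn M D k q v s =
      (\<bar>det (matrix ?J)\<bar> powr a * A) * (s' x + a * endo_trace (G q x) * dens_comp M k \<phi> s q)"
    by simp
  then show ?thesis unfolding AJ by (simp add: a_def x_def \<theta>_def)
qed

text \<open>Components of \<open>c\<close> in the frame of \<open>\<phi>\<close>, with the weight
  factor of \<open>L\<^sup>2\<close> included. These are the smooth functions hidden behind the
  pointwise values \<open>c q\<close>.\<close>

definition chart_form ::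
    "('a, real^'m) manifold \<Rightarrow> ('a \<Rightarrow> real^'m \<Rightarrow> real^'m \<Rightarrow> real) \<Rightarrow> ('a, real^'m) chart \<Rightarrow>
     'a \<Rightarrow> real^'m \<Rightarrow> real^'m \<Rightarrow> real" where
  "chart_form M c \<phi> q u w = dens_comp M 2 \<phi> (\<lambda>r. c r (frame M \<phi> u r) (frame M \<phi> w r)) q"

definition conf_chart ::
    "('a, real^'m) manifold \<Rightarrow> ('a \<Rightarrow> real^'m \<Rightarrow> real^'m \<Rightarrow> real) \<Rightarrow> ('a, real^'m) chart \<Rightarrow> 'a set \<Rightarrow> bool" where
  "conf_chart M c \<phi> U \<longleftrightarrow> (\<forall>q\<in>U. inner_form (chart_form M c \<phi> q)) \<and>
     (\<forall>u w. smooth_in \<phi> U (\<lambda>q. chart_form M c \<phi> q u w))"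

text \<open>The connection form of \<open>L\<close> in the chart: the derivative of the
  representation defining \<open>L\<close> is the trace divided by the dimension.\<close>

definition conn_tr :: "('a \<Rightarrow> real^'m \<Rightarrow> real^'m \<Rightarrow> real^'m) \<Rightarrow> 'a \<Rightarrow> real^'m \<Rightarrow> real" where
  "conn_tr G q v = endo_trace (G q v) / real CARD('m)"

text \<open>Torsion-freeness and parallelism of \<open>c\<close> for connection coefficients in one
  chart. The last term is the action of the connection on \<open>L\<^sup>2\<close>.\<close>

definition weyl_chart ::
    "('a, real^'m) manifold \<Rightarrow> ('a \<Rightarrow> real^'m \<Rightarrow> real^'m \<Rightarrow> real) \<Rightarrow> ('a, real^'m) conn \<Rightarrow>
     ('a, real^'m) chart \<Rightarrow> 'a set \<Rightarrow> ('a \<Rightarrow> real^'m \<Rightarrow> real^'m \<Rightarrow> real^'m) \<Rightarrow> bool" where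
  "weyl_chart M c D \<phi> U G \<longleftrightarrow> conn_chart M D \<phi> U G \<and> (\<forall>q\<in>U. \<forall>u v. G q u v = G q v u) \<and>
     (\<forall>q\<in>U. \<forall>u v w. dchart \<phi> (\<lambda>r. chart_form M c \<phi> r u w) q v =
        chart_form M c \<phi> q (G q v u) w + chart_form M c \<phi> q u (G q v w)
        - 2 * conn_tr G q v * chart_form M c \<phi> q u w)"

lemma chart_form_eq:
  "chart_form M c \<phi> q u w = \<bar>det (matrix (jac (chart_at M q) \<phi> q))\<bar> powr (2 / real CARD('m)) *
     c q (jac \<phi> (chart_at M q) q u) (jac \<phi> (chart_at M q) q w)"
  for M :: "('a, real^'m) manifold"
  by (simp add: chart_form_def dens_comp_def frame_def)

lemma conf_chart_conformal:
  fixes M :: "('a, real^'m) manifold"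
  assumes M: "smooth_manifold M" "\<phi> \<in> atlas M" and U: "openin (mtop M) U" "U \<subseteq> fst \<phi>"
    and c: "conformal_structure M c"
  shows "conf_chart M c \<phi> U" "q \<in> points M \<Longrightarrow> inner_form (c q)"
proof -
  show cq: "inner_form (c q)" if "q \<in> points M" for q
    using c that unfolding conformal_structure_def smooth_bil_def inner_form_def by blast
  show "conf_chart M c \<phi> U"
    unfolding conf_chart_def
  proof (intro conjI ballI allI)
    fix u w
    have "smooth_dens M 2 U (\<lambda>q. c q (frame M \<phi> u q) (frame M \<phi> w q))"
      using c U(1) smooth_vf_frame[OF M U] unfolding conformal_structure_def smooth_bil_def by blast
    then show "smooth_in \<phi> U (\<lambda>q. chart_form M c \<phi> q u w)"
      unfolding smooth_dens_iff[OF M U] chart_form_def .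
  next
    fix q assume "q \<in> U"
    then have q: "q \<in> fst \<phi>" "q \<in> points M" using U mem_points[OF M] by auto
    have th: "chart_at M q \<in> atlas M" "q \<in> fst (chart_at M q)"
      using chart_at_atlas[OF M(1)] chart_at_mem[OF M(1)] q by auto
    have "inj (jac \<phi> (chart_at M q) q)"
      by (rule inj_on_inverseI[where g = "jac (chart_at M q) \<phi> q"]) (simp add: atlas_jac_at(4)[OF M q(1)])
    moreover have "\<bar>det (matrix (jac (chart_at M q) \<phi> q))\<bar> powr (2 / real CARD('m)) > 0"
      using det_jac_nonzero[OF M(1) th(1) M(2) th(2) q(1)] by simp
    ultimately show "inner_form (chart_form M c \<phi> q)"
      unfolding chart_form_eq[abs_def]
      by (intro inner_form_scale inner_form_pullback[OF cq[OF q(2)]] atlas_jac_at(1)[OF M q(1)])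
  qed
qed

text \<open>Both axioms are evaluated on constant frames of \<open>\<phi>\<close>, whose brackets
  vanish and whose products under \<open>c\<close> are the entries of
  \<open>chart_form\<close>.\<close>

lemma weyl_structure_chart:
  fixes M :: "('a, real^'m) manifold"
  assumes M: "smooth_manifold M" "\<phi> \<in> atlas M" and U: "openin (mtop M) U" "U \<subseteq> fst \<phi>"
    and W: "weyl_structure M c D" and cc: "conf_chart M c \<phi> U"
  shows "weyl_chart M c D \<phi> U (christoffel M D \<phi>)"
proof -
  have D: "connection M D" using W by (simp add: weyl_structure_def)
  let ?G = "christoffel M D \<phi>"
  have cch: "conn_chart M D \<phi> U ?G" by (rule connection_chart[OF M U D])
  have nf: "near M q (\<lambda>W. smooth_vf M W (frame M \<phi> u) \<and> smooth_vf M W (frame M \<phi> v))" if "q \<in> U" for q u v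
    using smooth_vf_frame[OF M U]
      nearI[OF U(1) that, of "\<lambda>W. smooth_vf M W (frame M \<phi> u) \<and> smooth_vf M W (frame M \<phi> v)"] by simp
  show ?thesis
    unfolding weyl_chart_def
  proof (intro conjI ballI allI cch)
    fix q assume q: "q \<in> U"
    have qphi: "q \<in> fst \<phi>" and qM: "q \<in> points M" using U q mem_points[OF M] by auto
    define \<theta> where "\<theta> = chart_at M q"
    have th: "\<theta> \<in> atlas M" "q \<in> fst \<theta>"
      unfolding \<theta>_def using chart_at_atlas[OF M(1) qM] chart_at_mem[OF M(1) qM] .
    let ?J = "jac \<theta> \<phi> q" and ?I = "jac \<phi> \<theta> q"
    note J = atlas_jac[OF M(1) th(1) M(2) th(2) qphi] and I = atlas_jac[OF M th(1) qphi th(2)]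
    have G: "?J (D q (?I u) (frame M \<phi> v)) = ?G q u v" for u v
      by (simp add: christoffel_def vec_comp_def frame_def \<theta>_def)
    have G': "D q (?I u) (frame M \<phi> v) = ?I (?G q u v)" for u v
      using J(2)[of "D q (?I u) (frame M \<phi> v)"] unfolding G by simp
    have fr: "frame M \<phi> u q = ?I u" for u by (simp add: frame_def \<theta>_def)
    note W' = W[unfolded weyl_structure_def, THEN conjunct2, rule_format, OF qM nf[OF q]]
    define V where "V = U \<inter> fst \<theta>"
    have V: "openin (mtop M) V" "V \<subseteq> fst \<phi>" "V \<subseteq> fst \<theta>" "q \<in> V"
      using U q th openin_Int[OF U(1) atlas_openin[OF M(1) th(1)]] by (auto simp: V_def)
    have T: "trans_on \<phi> \<theta> V" by (rule atlas_trans_on[OF M th(1) V(1-3)])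
    have T': "trans_on \<theta> \<phi> V" by (rule atlas_trans_on[OF M(1) th(1) M(2) V(1,3,2)])
    show "?G q u v = ?G q v u" for u v
    proof -
      \<comment> \<open>\<open>lie_bracket\<close> is computed in the preferred chart at
        \<open>q\<close>, where the frame of \<open>\<phi>\<close> is not constant. Its derivative
        is a second derivative of the transition map, and symmetry makes the bracket vanish.\<close>
      have lb: "dir_deriv M q (?I u) (vec_comp M \<theta> (frame M \<phi> v)) = dchart \<phi> (\<lambda>r. dchart \<phi> (snd \<theta>) r v) q u" for u v
      proof -
        have h: "has_dchart \<phi> (\<lambda>r. jac \<phi> \<theta> r v) (dchart \<phi> (\<lambda>r. jac \<phi> \<theta> r v) q) q"
          by (rule smooth_in_has_dchart[OF smooth_in_jac[OF T] V(4)])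
        have "dir_deriv M q (?I u) (vec_comp M \<theta> (frame M \<phi> v)) = dchart \<theta> (\<lambda>r. jac \<phi> \<theta> r v) q (?I u)"
          unfolding dir_deriv_eq_dchart \<theta>_def[symmetric]
          by (rule fun_cong[OF dchart_cong[OF trans_on_open[OF T'] V(4)]])
            (use V vec_comp_frame_other[OF M th(1)] in auto)
        also have "\<dots> = dchart \<phi> (\<lambda>r. jac \<phi> \<theta> r v) q (?J (?I u))"
          unfolding \<theta>_def by (rule dchart_chart_at(1)[OF M V(1,4,2) h[unfolded \<theta>_def]])
        finally show ?thesis unfolding I(2) by (simp add: jac_eq_dchart)
      qed
      have "smooth_in \<phi> V (snd \<theta>)" using T by (simp add: trans_on_def)
      then have "lie_bracket M (frame M \<phi> u) (frame M \<phi> v) q = 0"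
        unfolding lie_bracket_def \<theta>_def[symmetric] fr lb
        by (simp add: dchart_symmetric[OF trans_on_open[OF T] _ V(4), of _ u v])
      then have "D q (?I u) (frame M \<phi> v) = D q (?I v) (frame M \<phi> u)"
        using W'[of u v] by (simp add: fr)
      then show ?thesis using G by metis
    qed
    show "dchart \<phi> (\<lambda>r. chart_form M c \<phi> r u w) q v =
        chart_form M c \<phi> q (?G q v u) w + chart_form M c \<phi> q u (?G q v w)
        - 2 * conn_tr ?G q v * chart_form M c \<phi> q u w" for u v w
    proof -
      let ?s = "\<lambda>r. c r (frame M \<phi> u r) (frame M \<phi> w r)"
      let ?d = "\<bar>det (matrix ?J)\<bar> powr (2 / real CARD('m))"
      have h: "has_dchart \<phi> (dens_comp M 2 \<phi> ?s) (dchart \<phi> (\<lambda>r. chart_form M c \<phi> r u w) q) q"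
        using smooth_in_has_dchart[of \<phi> U "\<lambda>q. chart_form M c \<phi> q u w" q] cc q
        by (simp add: conf_chart_def chart_form_def)
      have "?d * dens_conn M D 2 q (?I v) ?s = dchart \<phi> (\<lambda>r. chart_form M c \<phi> r u w) q v
          + 2 / real CARD('m) * endo_trace (?G q v) * chart_form M c \<phi> q u w"
        using dens_conn_chart[OF M U cch q h, of "?I v"]
        unfolding \<theta>_def[symmetric] I(2) by (simp add: chart_form_def)
      moreover have "dens_conn M D 2 q (?I v) ?s = c q (?I (?G q v u)) (?I w) + c q (?I u) (?I (?G q v w))"
        using W'[of u w] by (simp add: fr G')
      ultimately show ?thesis
        by (simp add: chart_form_eq \<theta>_def[symmetric] conn_tr_def algebra_simps)
    qed
  qed
qed

text \<open>With \<open>\<phi>\<close> preferred at \<open>p\<close>, components at \<open>p\<close>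
  coincide with the encoded values there, while \<open>U\<close> leaves room for differentiation.
  The locale serves \<open>M\<close>, and later \<open>N\<close> with its induced structure.\<close>

locale weyl_at =
  fixes M :: "('a, real^'m) manifold" and c :: "'a \<Rightarrow> real^'m \<Rightarrow> real^'m \<Rightarrow> real"
    and \<phi> :: "('a, real^'m) chart" and U :: "'a set" and p :: 'a
  assumes M: "smooth_manifold M" and \<phi>: "\<phi> = chart_at M p"
    and U: "openin (mtop M) U" "U \<subseteq> fst \<phi>" and p: "p \<in> U"
    and cc: "conf_chart M c \<phi> U"
begin

lemma pM: "p \<in> points M"
  using U p openin_subset unfolding points_def by blast

lemma phiM: "\<phi> \<in> atlas M"
  unfolding \<phi> by (rule chart_at_atlas[OF M pM])

lemma co: "chart_open \<phi> U"
  by (rule atlas_chart_open[OF M phiM U])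

lemma jac_p: "jac (chart_at M p) \<phi> p v = v" "jac \<phi> (chart_at M p) p v = v"
  using jac_refl[OF co p] unfolding \<phi> by simp_all

lemma det_jac_p: "det (matrix (jac (chart_at M p) \<phi> p)) = 1"
proof -
  have "jac (chart_at M p) \<phi> p = id" using jac_p by (simp add: fun_eq_iff)
  then have "matrix (jac (chart_at M p) \<phi> p) = mat 1" by (metis matrix_id_mat_1)
  then show ?thesis by simp
qed

lemma frame_p: "frame M \<phi> v p = v"
  by (simp add: frame_def jac_p)

lemma dens_comp_p: "dens_comp M k \<phi> s p = s p"
  by (simp add: dens_comp_def det_jac_p)

lemma chart_form_p: "chart_form M c \<phi> p = c p"
  by (simp add: fun_eq_iff chart_form_eq det_jac_p jac_p)

lemma inner_form_p: "inner_form (c p)"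
  using cc p chart_form_p unfolding conf_chart_def by metis

lemma lie_bracket_p: "lie_bracket M (vec_ext M p u) (vec_ext M p v) p = 0"
proof -
  have "dchart \<phi> (vec_comp M \<phi> (frame M \<phi> v)) p = (\<lambda>_. 0)" for v
    using dchart_cong[OF co p, of "vec_comp M \<phi> (frame M \<phi> v)" "\<lambda>_. v"] vec_comp_frame[OF M phiM] U
    by (auto simp: has_dchartD[OF has_dchart_const])
  then show ?thesis
    by (simp add: lie_bracket_def dir_deriv_eq_dchart vec_ext_eq_frame flip: \<phi>)
qed

lemma vec_ext_p: "vec_ext M p v = frame M \<phi> v"
  by (simp add: vec_ext_eq_frame \<phi>)

lemma near_p: "P U \<Longrightarrow> near M p P"
  by (rule nearI[OF U(1) p])

lemma exists_density: "\<exists>l. smooth_dens M k U l \<and> l p = 1"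
proof (intro exI conjI)
  \<comment> \<open>The density whose component in \<open>\<phi>\<close> is constantly 1.\<close>
  let ?l = "\<lambda>q. \<bar>det (matrix (jac (chart_at M q) \<phi> q))\<bar> powr (- (k / real CARD('m)))"
  show "smooth_dens M k U ?l"
    unfolding smooth_dens_iff[OF M phiM U]
  proof (rule smooth_in_cong[OF co _ smooth_in_const[of _ _ 1]])
    fix r assume "r \<in> U"
    then have r: "r \<in> fst \<phi>" "r \<in> points M" using U mem_points[OF M phiM] by auto
    have "det (matrix (jac (chart_at M r) \<phi> r)) \<noteq> 0"
      by (rule det_jac_nonzero[OF M chart_at_atlas[OF M r(2)] phiM chart_at_mem[OF M r(2)] r(1)])
    then show "1 = dens_comp M k \<phi> ?l r"
      by (simp add: dens_comp_def flip: powr_add)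
  qed
  show "?l p = 1" by (simp add: det_jac_p)
qed

text \<open>Evaluates the definite descriptions in \<open>faraday\<close>, \<open>h0_moebius\<close>
  and \<open>sigma_laplace\<close>: a density equal to 1 at \<open>p\<close> determines the
  coefficient.\<close>

lemma the_coefficient:
  assumes "\<And>l. near M p (\<lambda>U. smooth_dens M k U l) \<Longrightarrow> F l = a * l p"
  shows "(THE a. \<forall>l. near M p (\<lambda>U. smooth_dens M k U l) \<longrightarrow> F l = a * l p) = a"
proof (rule the_equality)
  obtain l where "smooth_dens M k U l" "l p = 1" using exists_density by blast
  then have "near M p (\<lambda>U. smooth_dens M k U l)" "l p = 1" using near_p[of "\<lambda>U. smooth_dens M k U l"] by auto
  then show "b = a" if "\<forall>l. near M p (\<lambda>U. smooth_dens M k U l) \<longrightarrow> F l = b * l p" for b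
    using that assms by force
qed (use assms in blast)

context
  fixes D G assumes D: "conn_chart M D \<phi> U G"
begin

lemma bilinear_G: "q \<in> U \<Longrightarrow> bilinear (G q)"
  using D by (simp add: conn_chart_def)

lemma smooth_G: "smooth_in \<phi> U (\<lambda>q. G q u v)"
  using D by (simp add: conn_chart_def)

lemma conn_frame:
  assumes "q \<in> U"
  shows "jac (chart_at M q) \<phi> q (D q (frame M \<phi> u q) (frame M \<phi> v)) = G q u v"
proof -
  have qphi: "q \<in> fst \<phi>" using assms U by blast
  have "near M q (\<lambda>W. smooth_vf M W (frame M \<phi> v))"
    using nearI[OF U(1) assms, of "\<lambda>W. smooth_vf M W (frame M \<phi> v)"] smooth_vf_frame[OF M phiM U] by simp
  moreover have "dchart \<phi> (vec_comp M \<phi> (frame M \<phi> v)) q = (\<lambda>_. 0)"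
    using dchart_cong[OF co assms, of "vec_comp M \<phi> (frame M \<phi> v)" "\<lambda>_. v"] vec_comp_frame[OF M phiM] U
    by (auto simp: has_dchartD[OF has_dchart_const])
  ultimately show ?thesis
    using D assms atlas_jac_at(4)[OF M phiM qphi] vec_comp_frame[OF M phiM qphi]
    by (simp add: conn_chart_def frame_def)
qed

lemma conn_frame_p: "D p u (frame M \<phi> v) = G p u v"
  using conn_frame[OF p, of u v] by (simp add: jac_p frame_p)

lemma smooth_conn_frame: "smooth_vf M U (\<lambda>q. D q (frame M \<phi> u q) (frame M \<phi> v))"
  unfolding smooth_vf_iff[OF M phiM U]
  by (rule smooth_in_cong[OF co _ smooth_G[of u v]]) (simp add: vec_comp_def conn_frame)

lemma curvature_chart:
  "curvature M D p u v w = dchart \<phi> (\<lambda>q. G q v w) p u - dchart \<phi> (\<lambda>q. G q u w) p v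
     + G p u (G p v w) - G p v (G p u w)"
proof -
  have 1: "D p u (\<lambda>q. D q (frame M \<phi> v q) (frame M \<phi> w)) = dchart \<phi> (\<lambda>q. G q v w) p u + G p u (G p v w)" for u v
  proof -
    let ?Y = "\<lambda>q. D q (frame M \<phi> v q) (frame M \<phi> w)"
    have Y: "vec_comp M \<phi> ?Y q = G q v w" if "q \<in> U" for q
      using conn_frame[OF that] by (simp add: vec_comp_def)
    have "near M p (\<lambda>W. smooth_vf M W ?Y)" using near_p[of "\<lambda>W. smooth_vf M W ?Y"] smooth_conn_frame by simp
    then have "jac (chart_at M p) \<phi> p (D p u ?Y) = dchart \<phi> (vec_comp M \<phi> ?Y) p (jac (chart_at M p) \<phi> p u)
        + G p (jac (chart_at M p) \<phi> p u) (vec_comp M \<phi> ?Y p)"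
      using D p unfolding conn_chart_def by blast
    moreover have "dchart \<phi> (vec_comp M \<phi> ?Y) p = dchart \<phi> (\<lambda>q. G q v w) p"
      by (rule dchart_cong[OF co p Y])
    ultimately show ?thesis by (simp add: jac_p Y[OF p])
  qed
  have 0: "D p 0 (frame M \<phi> w) = 0"
    unfolding conn_frame_p by (rule bilinear_lzero[OF bilinear_G[OF p]])
  show ?thesis
    unfolding curvature_def Let_def lie_bracket_p unfolding vec_ext_p frame_p 1 0 by simp
qed

lemma smooth_conn_tr: "smooth_in \<phi> U (\<lambda>q. conn_tr G q v)"
  unfolding conn_tr_def endo_trace_eq_sum
  by (simp only: divide_inverse, intro smooth_in_mult smooth_in_sum smooth_in_vec_nth smooth_G smooth_in_const co)

lemma linear_conn_tr: "q \<in> U \<Longrightarrow> linear (conn_tr G q)"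
  unfolding conn_tr_def endo_trace_eq_sum
  by (rule linearI)
    (simp_all add: bilinear_ladd[OF bilinear_G] bilinear_lmul[OF bilinear_G] sum.distrib add_divide_distrib
      sum_distrib_left)

lemma dens_conn_p:
  assumes l: "openin (mtop M) W" "p \<in> W" "W \<subseteq> U" "smooth_in \<phi> W (dens_comp M k \<phi> l)"
  shows "dens_conn M D k p v l = dchart \<phi> (dens_comp M k \<phi> l) p v + k * conn_tr G p v * l p"
  using dens_conn_chart[OF M phiM U D p smooth_in_has_dchart[OF l(4,2)]]
  by (simp add: jac_p det_jac_p dens_comp_p conn_tr_def)

text \<open>Kept for a general weight, since weight 1 serves both curvature and Moebius operators
  and weight 1/2 serves Laplace operators.\<close>

lemma dens_conn_twice:
  assumes l: "openin (mtop M) W" "p \<in> W" "W \<subseteq> U" "smooth_in \<phi> W (dens_comp M k \<phi> l)"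
  defines "f \<equiv> dens_comp M k \<phi> l"
  shows "dens_conn M D k p u (\<lambda>q. dens_conn M D k q (frame M \<phi> v q) l) =
    dchart \<phi> (\<lambda>q. dchart \<phi> f q v) p u
    + k * (dchart \<phi> (\<lambda>q. conn_tr G q v) p u * l p + conn_tr G p v * dchart \<phi> f p u + conn_tr G p u * dchart \<phi> f p v)
    + k\<^sup>2 * conn_tr G p u * conn_tr G p v * l p"
proof -
  have coW: "chart_open \<phi> W" using atlas_chart_open[OF M phiM l(1)] l U by blast
  let ?m = "\<lambda>q. dens_conn M D k q (frame M \<phi> v q) l"
  let ?g = "\<lambda>q. dchart \<phi> f q v + k * (conn_tr G q v * f q)"
  have f: "smooth_in \<phi> W f" using l by (simp add: f_def)
  have m: "dens_comp M k \<phi> ?m q = ?g q" if "q \<in> W" for q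
  proof -
    have q: "q \<in> U" "q \<in> fst \<phi>" using that l U by auto
    show ?thesis
      unfolding dens_comp_def[of M k \<phi> ?m]
        dens_conn_chart[OF M phiM U D q(1) smooth_in_has_dchart[OF l(4) that]]
      by (simp add: frame_def atlas_jac_at(4)[OF M phiM q(2)] f_def conn_tr_def)
  qed
  have st: "smooth_in \<phi> W (\<lambda>q. conn_tr G q v)" by (rule smooth_in_subset[OF smooth_conn_tr l(3)])
  have "smooth_in \<phi> W ?g"
    by (rule smooth_in_add[OF coW smooth_in_dchart[OF coW f]
          smooth_in_mult[OF coW smooth_in_const smooth_in_mult[OF coW st f]]])
  then have sm: "smooth_in \<phi> W (dens_comp M k \<phi> ?m)"
    by (rule smooth_in_cong[OF coW _, rotated]) (simp add: m)
  have "has_dchart \<phi> ?g (\<lambda>w. dchart \<phi> (\<lambda>q. dchart \<phi> f q v) p w +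
      k * (conn_tr G p v * dchart \<phi> f p w + dchart \<phi> (\<lambda>q. conn_tr G q v) p w * f p)) p"
    by (rule has_dchart_add[OF smooth_in_has_dchart[OF smooth_in_dchart[OF coW f] l(2)]
          has_dchart_linear_image[OF linear_times has_dchart_mult[OF coW l(2)
            smooth_in_has_dchart[OF st l(2)] smooth_in_has_dchart[OF f l(2)]]]])
  moreover have "dchart \<phi> (dens_comp M k \<phi> ?m) p = dchart \<phi> ?g p"
    by (rule dchart_cong[OF coW l(2) m])
  ultimately have "dchart \<phi> (dens_comp M k \<phi> ?m) p u = dchart \<phi> (\<lambda>q. dchart \<phi> f q v) p u +
      k * (conn_tr G p v * dchart \<phi> f p u + dchart \<phi> (\<lambda>q. conn_tr G q v) p u * f p)"
    by (simp add: has_dchartD)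
  moreover have "?m p = dchart \<phi> f p v + k * (conn_tr G p v * f p)"
    using m[OF l(2)] by (simp add: dens_comp_p)
  moreover have "f p = l p" by (simp add: f_def dens_comp_p)
  ultimately show ?thesis
    unfolding dens_conn_p[OF l(1-3) sm] by (simp add: algebra_simps power2_eq_square)
qed

lemma near_density:
  assumes "near M p (\<lambda>U. smooth_dens M k U l)"
  obtains W where "openin (mtop M) W" "p \<in> W" "W \<subseteq> U" "smooth_in \<phi> W (dens_comp M k \<phi> l)"
proof -
  obtain V where V: "openin (mtop M) V" "p \<in> V" "smooth_dens M k V l" using assms by (auto simp: near_def)
  let ?W = "V \<inter> U"
  have W: "openin (mtop M) ?W" "?W \<subseteq> fst \<phi>" using V U by auto
  have "smooth_dens M k ?W l" by (rule smooth_dens_subset[OF V(3)]) simp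
  then show ?thesis using that[of ?W] W V p by (simp add: smooth_dens_iff[OF M phiM W])
qed

lemma hess_chart:
  assumes l: "openin (mtop M) W" "p \<in> W" "W \<subseteq> U" "smooth_in \<phi> W (dens_comp M k \<phi> l)"
  defines "f \<equiv> dens_comp M k \<phi> l"
  shows "hess M D k l p u v =
    dchart \<phi> (\<lambda>q. dchart \<phi> f q v) p u
    + k * (dchart \<phi> (\<lambda>q. conn_tr G q v) p u * l p + conn_tr G p v * dchart \<phi> f p u + conn_tr G p u * dchart \<phi> f p v)
    + k\<^sup>2 * conn_tr G p u * conn_tr G p v * l p
    - (dchart \<phi> f p (G p u v) + k * conn_tr G p (G p u v) * l p)"
  unfolding hess_def Let_def vec_ext_p frame_p conn_frame_p dens_conn_twice[OF l] dens_conn_p[OF l] f_def ..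

text \<open>In the second derivative of a density everything is symmetric in \<open>u\<close> and
  \<open>v\<close> except the derivative of the connection form, so the curvature of
  \<open>L\<close> is the exterior derivative of \<open>conn_tr\<close>.\<close>

lemma faraday_chart:
  "faraday M D p u v = dchart \<phi> (\<lambda>q. conn_tr G q v) p u - dchart \<phi> (\<lambda>q. conn_tr G q u) p v"
  unfolding faraday_def Let_def lie_bracket_p unfolding vec_ext_p frame_p
proof (rule the_coefficient)
  fix l assume "near M p (\<lambda>U. smooth_dens M 1 U l)"
  then obtain W where W: "openin (mtop M) W" "p \<in> W" "W \<subseteq> U" "smooth_in \<phi> W (dens_comp M 1 \<phi> l)"
    using near_density by blast
  have coW: "chart_open \<phi> W" using atlas_chart_open[OF M phiM W(1)] W U by blast
  have "dens_conn M D 1 p 0 l = 0"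
    unfolding dens_conn_p[OF W] using linear_0[OF linear_dchart[OF W(4,2)]] linear_0[OF linear_conn_tr[OF p]] by simp
  then show "dens_conn M D 1 p u (\<lambda>q. dens_conn M D 1 q (frame M \<phi> v q) l)
      - dens_conn M D 1 p v (\<lambda>q. dens_conn M D 1 q (frame M \<phi> u q) l) - dens_conn M D 1 p 0 l =
     (dchart \<phi> (\<lambda>q. conn_tr G q v) p u - dchart \<phi> (\<lambda>q. conn_tr G q u) p v) * l p"
    unfolding dens_conn_twice[OF W] using dchart_symmetric[OF coW W(4,2), of u v]
    by (simp add: algebra_simps)
qed

end

end

section \<open>Change of the Weyl structure\<close>

lemma gram_add: "gram (\<lambda>u v. a u v + b u v) = gram a + gram b"
  by (simp add: gram_def vec_eq_iff)

lemma tr_c_add: "tr_c c (\<lambda>u v. a u v + b u v) = tr_c c a + tr_c c b"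
  by (simp add: tr_c_def gram_add matrix_add_ldistrib trace_add)

lemma tr_c_scale: "tr_c c (\<lambda>u v. t * b u v) = t * tr_c c b"
  by (simp add: tr_c_def trace_def matrix_matrix_mult_def gram_def sum_distrib_left mult.left_commute)

lemma tr_c_diff: "tr_c c (\<lambda>u v. a u v - b u v) = tr_c c a - tr_c c b"
  using tr_c_add[of c a "\<lambda>u v. (- 1) * b u v"] tr_c_scale[of c "- 1" b] by simp

lemma tr_c_transpose:
  assumes "inner_form c" "bilinear b"
  shows "tr_c c (\<lambda>u v. b v u) = tr_c c b"
proof -
  have c: "gram c = transpose (gram c)"
    using inner_formD(2)[OF assms(1)] by (simp add: gram_def transpose_def vec_eq_iff)
  have i: "matrix_inv (gram c) = transpose (matrix_inv (gram c))"
  proof -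
    let ?B = "matrix_inv (gram c)"
    have 1: "gram c ** ?B = mat 1" by (rule matrix_inv_right[OF gram_invertible[OF assms(1)]])
    have 2: "transpose ?B ** gram c = mat 1"
      using arg_cong[OF 1, of transpose] by (simp add: matrix_transpose_mul c[symmetric] transpose_mat)
    have "transpose ?B = transpose ?B ** (gram c ** ?B)" by (simp add: 1)
    also have "\<dots> = ?B" by (simp add: matrix_mul_assoc 2)
    finally show ?thesis by simp
  qed
  have "gram (\<lambda>u v. b v u) = transpose (gram b)" by (simp add: gram_def transpose_def vec_eq_iff)
  then have "matrix_inv (gram c) ** gram (\<lambda>u v. b v u) = transpose (gram b ** matrix_inv (gram c))"
    by (simp add: matrix_transpose_mul i[symmetric])
  then have "tr_c c (\<lambda>u v. b v u) = trace (gram b ** matrix_inv (gram c))"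
    by (simp add: tr_c_def trace_def transpose_def)
  then show ?thesis by (simp only: trace_mul_sym[of "gram b"] tr_c_def[of c b])
qed

lemma tr_c_self:
  fixes c :: "real^'m \<Rightarrow> real^'m \<Rightarrow> real"
  assumes "inner_form c"
  shows "tr_c c c = real CARD('m)"
  using tr_c_eq_endo_trace[OF assms linear_id, of c] endo_trace_ident[where 'n = 'm]
  by (simp add: id_def)

lemma tr_c_rank_one:
  assumes "inner_form c" "linear k" "linear l"
  shows "tr_c c (\<lambda>u v. k u * l v) = k (sharp c l)"
proof -
  have "linear (\<lambda>u. k u *\<^sub>R sharp c l)"
    using assms(2) by (simp add: linear_compose[of k "\<lambda>a. a *\<^sub>R sharp c l", unfolded comp_def] linear_scaleR_left)
  then have "tr_c c (\<lambda>u v. k u * l v) = endo_trace (\<lambda>u. k u *\<^sub>R sharp c l)"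
    by (rule tr_c_eq_endo_trace[OF assms(1)]) (simp add: inner_form_simps[OF assms(1)] sharp[OF assms(1,3)])
  then show ?thesis by (simp add: endo_trace_rank_one[OF assms(2)])
qed

lemma sym0_add: "sym0 c (\<lambda>u v. a u v + b u v) u v = sym0 c a u v + sym0 c b u v"
  by (simp add: sym0_def tr_c_add field_simps)

lemma sym0_scale: "sym0 c (\<lambda>u v. t * b u v) u v = t * sym0 c b u v"
  by (simp add: sym0_def tr_c_scale field_simps)

text \<open>On a line all bilinear forms are proportional. This reduces the tensor law on a curve to
  an identity between traces.\<close>

lemma bilinear_one_dim:
  fixes c b :: "real^'m \<Rightarrow> real^'m \<Rightarrow> real"
  assumes "CARD('m) = 1" "inner_form c" "bilinear b"
  shows "b u v = tr_c c b * c u v"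
proof -
  define A where "A = (\<lambda>u. sharp c (b u))"
  have A: "linear A" unfolding A_def by (rule linear_sharp[OF assms(2,3)])
  obtain i :: 'm where i: "UNIV = {i}" using assms(1) by (auto simp: card_1_singleton_iff)
  have ax: "x = x $ i *\<^sub>R axis i 1" for x :: "real^'m"
    using linear_expand_axis[OF linear_id, of x] by (simp add: i)
  have "A u = u $ i *\<^sub>R A (axis i 1)" using linear_expand_axis[OF A, of u] by (simp add: i)
  also have "\<dots> = A (axis i 1) $ i *\<^sub>R u"
    by (metis ax scaleR_left_commute)
  also have "A (axis i 1) $ i = tr_c c b"
    unfolding tr_c_eq_sharp[OF assms(2,3)] A_def[symmetric] endo_trace_eq_sum by (simp add: i)
  finally have "c (A u) v = tr_c c b * c u v" by (simp add: inner_form_simps[OF assms(2)])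
  moreover have "linear (b u)" using assms(3) by (simp add: bilinear_def)
  ultimately show ?thesis by (simp add: A_def sharp[OF assms(2)])
qed

lemma linear_dchart_family:
  fixes L :: "'a \<Rightarrow> real^'n \<Rightarrow> 'w::real_normed_vector"
  assumes "chart_open \<phi> U" "q \<in> U" "\<And>u. smooth_in \<phi> U (\<lambda>r. L r u)" "\<And>r. r \<in> U \<Longrightarrow> linear (L r)"
  shows "linear (\<lambda>u. dchart \<phi> (\<lambda>r. L r u) q v)"
  by (rule has_dchart_linear_apply(2)[OF assms(1,2) smooth_in_has_dchart[OF assms(3,2)] assms(4) has_dchart_const])

lemma bilinearI:
  assumes "\<And>u v w. b (u + v) w = b u w + b v w" "\<And>a u w. b (a *\<^sub>R u) w = a *\<^sub>R b u w"
    "\<And>u v w. b w (u + v) = b w u + b w v" "\<And>a u w. b w (a *\<^sub>R u) = a *\<^sub>R b w u"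
  shows "bilinear b"
  unfolding bilinear_def by (intro conjI allI linearI assms)

lemmas bilinear_simps = bilinear_ladd bilinear_lmul bilinear_radd bilinear_rmul

lemma bilinear_sym0:
  assumes "bilinear c" "bilinear b"
  shows "bilinear (sym0 c b)"
  by (rule bilinearI) (simp_all add: sym0_def bilinear_simps[OF assms(1)] bilinear_simps[OF assms(2)] field_simps)

context weyl_at
begin

lemma C_inner: "q \<in> U \<Longrightarrow> inner_form (chart_form M c \<phi> q)"
  using cc by (simp add: conf_chart_def)

lemma C_smooth: "smooth_in \<phi> U (\<lambda>q. chart_form M c \<phi> q u v)"
  using cc by (simp add: conf_chart_def)

lemma weyl_chartD:
  assumes "weyl_chart M c D \<phi> U G"
  shows "conn_chart M D \<phi> U G" "q \<in> U \<Longrightarrow> G q u v = G q v u"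
    "q \<in> U \<Longrightarrow> dchart \<phi> (\<lambda>r. chart_form M c \<phi> r u w) q v =
        chart_form M c \<phi> q (G q v u) w + chart_form M c \<phi> q u (G q v w)
        - 2 * conn_tr G q v * chart_form M c \<phi> q u w"
  using assms by (simp_all add: weyl_chart_def)

lemma bilinear_ricci:
  assumes "conn_chart M D \<phi> U G"
  shows "bilinear (ricci M D p)"
proof -
  note G = bilinear_G[OF assms p]
  have lG: "linear (G q u)" "linear (\<lambda>u. G q u v)" if "q \<in> U" for q u v
    using bilinear_G[OF assms that] by (auto simp: bilinear_def)
  have 1: "linear (\<lambda>v. dchart \<phi> (\<lambda>q. G q v w) p u)" for u w
    by (rule linear_dchart_family[OF co p smooth_G[OF assms] lG(2)])
  have 2: "linear (\<lambda>w. dchart \<phi> (\<lambda>q. G q v w) p u)" for u v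
    by (rule linear_dchart_family[OF co p smooth_G[OF assms] lG(1)])
  have 3: "linear (dchart \<phi> (\<lambda>q. G q v w) p)" for v w
    by (rule linear_dchart[OF smooth_G[OF assms] p])
  show ?thesis
    unfolding ricci_def curvature_chart[OF assms] endo_trace_eq_sum
    by (rule bilinearI)
      (simp_all add: linear_add[OF 1] linear_cmul[OF 1] linear_add[OF 2] linear_cmul[OF 2] linear_add[OF 3]
        linear_cmul[OF 3] bilinear_simps[OF G] sum_distrib_left sum_subtractf sum.distrib algebra_simps)
qed

section \<open>The difference of two Weyl structures and its effect on curvature and
  Hessians\<close>

context
  fixes D G D' G'
  assumes w: "weyl_chart M c D \<phi> U G" and w': "weyl_chart M c D' \<phi> U G'"
begin

abbreviation (input) "C \<equiv> chart_form M c \<phi>"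
text \<open>Here \<open>\<delta>\<close> is the difference tensor and \<open>\<gamma>\<close> the
  difference of the two connections on \<open>L\<close>. The remaining ones are taken at
  \<open>p\<close>: \<open>nab\<close> is the derivative of \<open>\<gamma>\<close> with respect to
  \<open>D\<close>, \<open>gs\<close> its dual vector and \<open>gn\<close> its squared
  norm.\<close>

definition "\<delta> q u v = G' q u v - G q u v"
definition "\<gamma> q v = conn_tr G' q v - conn_tr G q v"
definition "nab u v = dchart \<phi> (\<lambda>q. \<gamma> q v) p u - \<gamma> p (G p u v)"
definition "gs = sharp (C p) (\<gamma> p)"
definition "gn = \<gamma> p gs"

lemma conn: "conn_chart M D \<phi> U G" and conn': "conn_chart M D' \<phi> U G'"
  using weyl_chartD(1)[OF w] weyl_chartD(1)[OF w'] .

lemma linear_gamma: "q \<in> U \<Longrightarrow> linear (\<gamma> q)"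
  unfolding \<gamma>_def by (intro linear_compose_sub linear_conn_tr[OF conn] linear_conn_tr[OF conn'])

lemma smooth_gamma: "smooth_in \<phi> U (\<lambda>q. \<gamma> q v)"
  unfolding \<gamma>_def by (intro smooth_in_minus co smooth_conn_tr[OF conn] smooth_conn_tr[OF conn'])

lemma smooth_delta: "smooth_in \<phi> U (\<lambda>q. \<delta> q u v)"
  unfolding \<delta>_def by (intro smooth_in_minus co smooth_G[OF conn] smooth_G[OF conn'])

lemma delta_sym: "q \<in> U \<Longrightarrow> \<delta> q u v = \<delta> q v u"
  unfolding \<delta>_def using weyl_chartD(2)[OF w] weyl_chartD(2)[OF w'] by metis

lemma bilinear_delta: "q \<in> U \<Longrightarrow> bilinear (\<delta> q)"
  unfolding \<delta>_def
  by (rule bilinearI) (simp_all add: bilinear_simps[OF bilinear_G[OF conn]] bilinear_simps[OF bilinear_G[OF conn']] algebra_simps)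

text \<open>
  As in Koszul's formula for the Levi-Civita connection, cyclic permutation determines \<open>\<delta>\<close> from its
  symmetry and the symmetric part of the endomorphisms \<open>\<delta> q v\<close>.
\<close>

lemma C_delta:
  assumes q: "q \<in> U"
  shows "C q (\<delta> q u v) x = \<gamma> q u * C q v x + \<gamma> q v * C q u x - \<gamma> q x * C q u v"
proof -
  have s: "C q (\<delta> q v u) x + C q (\<delta> q v x) u = 2 * \<gamma> q v * C q u x" for u v x
    using weyl_chartD(3)[OF w q, of u x v] weyl_chartD(3)[OF w' q, of u x v]
    by (simp add: \<delta>_def \<gamma>_def inner_form_simps[OF C_inner[OF q]] inner_formD(2)[OF C_inner[OF q], of "_ - _" u]
        inner_formD(2)[OF C_inner[OF q], of "G _ _ _" u] inner_formD(2)[OF C_inner[OF q], of "G' _ _ _" u] algebra_simps)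
  show ?thesis
    using s[of u v x] s[of v u x] s[of x u v] delta_sym[OF q, of u v] delta_sym[OF q, of u x] delta_sym[OF q, of v x]
      inner_formD(2)[OF C_inner[OF q], of u v]
    by simp
qed

lemma C_gs: "C p gs x = \<gamma> p x"
  unfolding gs_def by (rule sharp[OF C_inner[OF p] linear_gamma[OF p]])

lemma delta_p: "\<delta> p u v = \<gamma> p u *\<^sub>R v + \<gamma> p v *\<^sub>R u - C p u v *\<^sub>R gs"
  by (rule inner_form_eqI[OF C_inner[OF p]])
    (simp add: C_delta[OF p] inner_form_simps[OF C_inner[OF p]] C_gs mult.commute)

lemma bilinear_nab: "bilinear nab"
proof -
  have 1: "linear (\<lambda>v. dchart \<phi> (\<lambda>q. \<gamma> q v) p u)" for u
    by (rule linear_dchart_family[OF co p smooth_gamma linear_gamma])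
  have 2: "linear (dchart \<phi> (\<lambda>q. \<gamma> q v) p)" for v
    by (rule linear_dchart[OF smooth_gamma p])
  show ?thesis
    unfolding nab_def
    by (rule bilinearI)
      (simp_all add: linear_add[OF 1] linear_cmul[OF 1] linear_add[OF 2] linear_cmul[OF 2]
        bilinear_simps[OF bilinear_G[OF conn p]] linear_add[OF linear_gamma[OF p]] linear_cmul[OF linear_gamma[OF p]]
        algebra_simps)
qed

text \<open>The covariant derivative of the identity \<open>C_delta\<close>; the vector on the left
  is the derivative of the tensor \<open>\<delta>\<close> along \<open>u\<close>, evaluated at
  \<open>v\<close> and \<open>x\<close>. Since \<open>c\<close> is parallel, the coefficients
  \<open>G\<close> and the weight terms cancel between the two sides.\<close>

lemma C_nabla_delta:
  "C p (dchart \<phi> (\<lambda>q. \<delta> q v x) p u + G p u (\<delta> p v x) - \<delta> p (G p u v) x - \<delta> p v (G p u x)) z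
     = nab u v * C p x z + nab u x * C p v z - nab u z * C p v x"
proof -
  have dC: "has_dchart \<phi> (\<lambda>r. C r a b) (\<lambda>u. C p (G p u a) b + C p a (G p u b) - 2 * conn_tr G p u * C p a b) p" for a b
  proof -
    have "dchart \<phi> (\<lambda>r. C r a b) p = (\<lambda>u. C p (G p u a) b + C p a (G p u b) - 2 * conn_tr G p u * C p a b)"
      using weyl_chartD(3)[OF w p] by (simp add: fun_eq_iff)
    then show ?thesis using smooth_in_has_dchart[OF C_smooth p, of a b] by simp
  qed
  have dg: "has_dchart \<phi> (\<lambda>r. \<gamma> r a) (dchart \<phi> (\<lambda>q. \<gamma> q a) p) p" for a
    by (rule smooth_in_has_dchart[OF smooth_gamma p])
  have L: "has_dchart \<phi> (\<lambda>r. C r (\<delta> r v x) z) (\<lambda>u. C p (dchart \<phi> (\<lambda>q. \<delta> q v x) p u) z +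
      (C p (G p u (\<delta> p v x)) z + C p (\<delta> p v x) (G p u z) - 2 * conn_tr G p u * C p (\<delta> p v x) z)) p"
    using has_dchart_linear_apply(1)[OF co p dC inner_formD(5)[OF C_inner] smooth_in_has_dchart[OF smooth_delta p, of v x]] .
  have R: "has_dchart \<phi> (\<lambda>r. \<gamma> r v * C r x z + \<gamma> r x * C r v z - \<gamma> r z * C r v x) (\<lambda>u.
     (\<gamma> p v * (C p (G p u x) z + C p x (G p u z) - 2 * conn_tr G p u * C p x z) + dchart \<phi> (\<lambda>q. \<gamma> q v) p u * C p x z) +
     (\<gamma> p x * (C p (G p u v) z + C p v (G p u z) - 2 * conn_tr G p u * C p v z) + dchart \<phi> (\<lambda>q. \<gamma> q x) p u * C p v z) -
     (\<gamma> p z * (C p (G p u v) x + C p v (G p u x) - 2 * conn_tr G p u * C p v x) + dchart \<phi> (\<lambda>q. \<gamma> q z) p u * C p v x)) p"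
    by (rule has_dchart_diff[OF has_dchart_add[OF has_dchart_mult[OF co p dg dC] has_dchart_mult[OF co p dg dC]]
          has_dchart_mult[OF co p dg dC]])
  have "dchart \<phi> (\<lambda>r. C r (\<delta> r v x) z) p = dchart \<phi> (\<lambda>r. \<gamma> r v * C r x z + \<gamma> r x * C r v z - \<gamma> r z * C r v x) p"
    by (rule dchart_cong[OF co p C_delta])
  from fun_cong[OF this, of u] show ?thesis
    unfolding has_dchartD[OF L] has_dchartD[OF R]
    by (simp add: inner_form_simps[OF C_inner[OF p]] C_delta[OF p] nab_def algebra_simps)
qed

text \<open>The change of curvature is the alternated covariant derivative of
  \<open>\<delta>\<close> plus the commutator of its endomorphisms. Symmetry of \<open>G\<close>
  removes the terms in which \<open>G p u v\<close> is inserted into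
  \<open>\<delta>\<close>.\<close>

lemma curvature_diff:
  "curvature M D' p u v x = curvature M D p u v x
     + (nab u v *\<^sub>R x + nab u x *\<^sub>R v - C p v x *\<^sub>R sharp (C p) (nab u))
     - (nab v u *\<^sub>R x + nab v x *\<^sub>R u - C p u x *\<^sub>R sharp (C p) (nab v))
     + \<delta> p u (\<delta> p v x) - \<delta> p v (\<delta> p u x)"
proof -
  have ln: "linear (nab u)" for u using bilinear_nab by (simp add: bilinear_def)
  have X: "dchart \<phi> (\<lambda>q. \<delta> q v x) p u = nab u v *\<^sub>R x + nab u x *\<^sub>R v - C p v x *\<^sub>R sharp (C p) (nab u)
      - G p u (\<delta> p v x) + \<delta> p (G p u v) x + \<delta> p v (G p u x)" for u v
  proof -
    have "dchart \<phi> (\<lambda>q. \<delta> q v x) p u + G p u (\<delta> p v x) - \<delta> p (G p u v) x - \<delta> p v (G p u x)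
        = nab u v *\<^sub>R x + nab u x *\<^sub>R v - C p v x *\<^sub>R sharp (C p) (nab u)"
    proof (rule inner_form_eqI[OF C_inner[OF p]], unfold C_nabla_delta)
      fix z
      show "nab u v * C p x z + nab u x * C p v z - nab u z * C p v x
          = C p (nab u v *\<^sub>R x + nab u x *\<^sub>R v - C p v x *\<^sub>R sharp (C p) (nab u)) z"
        by (simp add: inner_form_simps[OF C_inner[OF p]] sharp[OF C_inner[OF p] ln])
    qed
    then show ?thesis by (simp add: algebra_simps)
  qed
  have d: "dchart \<phi> (\<lambda>q. G' q v x) p u = dchart \<phi> (\<lambda>q. G q v x) p u + dchart \<phi> (\<lambda>q. \<delta> q v x) p u" for u v
  proof -
    have "has_dchart \<phi> (\<lambda>q. G q v x + \<delta> q v x) (\<lambda>u. dchart \<phi> (\<lambda>q. G q v x) p u + dchart \<phi> (\<lambda>q. \<delta> q v x) p u) p"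
      by (intro has_dchart_add smooth_in_has_dchart[OF smooth_G[OF conn] p] smooth_in_has_dchart[OF smooth_delta p])
    from fun_cong[OF has_dchartD[OF this], of u] show ?thesis by (simp add: \<delta>_def)
  qed
  have G': "G' p a b = G p a b + \<delta> p a b" for a b by (simp add: \<delta>_def)
  show ?thesis
    unfolding curvature_chart[OF conn] curvature_chart[OF conn'] d X G'
    using weyl_chartD(2)[OF w p, of u v]
    by (simp add: bilinear_simps[OF bilinear_G[OF conn p]] bilinear_simps[OF bilinear_delta[OF p]] algebra_simps)
qed

lemma gamma_delta: "\<gamma> p (\<delta> p u v) = 2 * \<gamma> p u * \<gamma> p v - C p u v * gn"
  by (simp add: delta_p gn_def linear_add[OF linear_gamma[OF p]] linear_diff[OF linear_gamma[OF p]]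
      linear_cmul[OF linear_gamma[OF p]])

text \<open>All correction terms depend on \<open>u\<close> through a multiple of \<open>u\<close>,
  a linear functional times a fixed vector, or the endomorphism dual to \<open>nab\<close>, so each
  trace is immediate. The weights stay visible because Ricci is not symmetrized: the skew part of
  \<open>nab\<close> is what changes the Faraday form.\<close>

lemma ricci_diff:
  "ricci M D' p v x = ricci M D p v x + nab x v + (1 - real CARD('m)) * nab v x - C p v x * tr_c (C p) nab
     + (real CARD('m) - 2) * (\<gamma> p v * \<gamma> p x - gn * C p v x)"
proof -
  note Ci = C_inner[OF p]
  define a where "a = \<delta> p v x"
  have ln: "linear (nab u)" "linear (\<lambda>v. nab v u)" for u using bilinear_nab by (simp_all add: bilinear_def)
  note r1 = endo_trace_rank_one[OF ln(2)] endo_trace_rank_one[OF ln(1)] endo_trace_rank_one[OF linear_gamma[OF p]]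
    endo_trace_rank_one[OF inner_formD(5)[OF Ci]]
  \<comment> \<open>Expanded until \<open>u\<close> occurs only in rank-one terms and multiples of
    the identity.\<close>
  have dd: "\<delta> p v (\<delta> p u x) = \<gamma> p v *\<^sub>R (\<gamma> p u *\<^sub>R x) + (\<gamma> p v * \<gamma> p x) *\<^sub>R u - \<gamma> p v *\<^sub>R (C p u x *\<^sub>R gs)
      + (2 * \<gamma> p x) *\<^sub>R (\<gamma> p u *\<^sub>R v) - gn *\<^sub>R (C p u x *\<^sub>R v)
      - (C p x v *\<^sub>R (\<gamma> p u *\<^sub>R gs) + \<gamma> p x *\<^sub>R (C p u v *\<^sub>R gs) - \<gamma> p v *\<^sub>R (C p u x *\<^sub>R gs))" for u
  proof -
    have "C p v (\<delta> p u x) = C p (\<delta> p u x) v" by (rule inner_formD(2)[OF Ci])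
    then have "\<delta> p v (\<delta> p u x) = \<gamma> p v *\<^sub>R \<delta> p u x + (2 * \<gamma> p u * \<gamma> p x - C p u x * gn) *\<^sub>R v
      - (\<gamma> p u * C p x v + \<gamma> p x * C p u v - \<gamma> p v * C p u x) *\<^sub>R gs"
      using delta_p[of v "\<delta> p u x"] gamma_delta[of u x] C_delta[OF p, of u x v] by simp
    then show ?thesis unfolding delta_p[of u x]
      by (simp add: algebra_simps)
  qed
  have "endo_trace (\<lambda>u. curvature M D' p u v x) = endo_trace (\<lambda>u. curvature M D p u v x
     + (nab u v *\<^sub>R x + nab u x *\<^sub>R v - C p v x *\<^sub>R sharp (C p) (nab u))
     - (nab v u *\<^sub>R x + nab v x *\<^sub>R u - C p u x *\<^sub>R sharp (C p) (nab v))
     + (\<gamma> p u *\<^sub>R a + \<gamma> p a *\<^sub>R u - C p u a *\<^sub>R gs)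
     - (\<gamma> p v *\<^sub>R (\<gamma> p u *\<^sub>R x) + (\<gamma> p v * \<gamma> p x) *\<^sub>R u - \<gamma> p v *\<^sub>R (C p u x *\<^sub>R gs)
      + (2 * \<gamma> p x) *\<^sub>R (\<gamma> p u *\<^sub>R v) - gn *\<^sub>R (C p u x *\<^sub>R v)
      - (C p x v *\<^sub>R (\<gamma> p u *\<^sub>R gs) + \<gamma> p x *\<^sub>R (C p u v *\<^sub>R gs) - \<gamma> p v *\<^sub>R (C p u x *\<^sub>R gs))))"
    unfolding curvature_diff dd unfolding a_def[symmetric] delta_p[of _ a] ..
  also have "\<dots> = endo_trace (\<lambda>u. curvature M D p u v x)
     + (nab x v + nab v x - C p v x * tr_c (C p) nab)
     - (nab v x + nab v x * real CARD('m) - nab v x)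
     + (\<gamma> p a + \<gamma> p a * real CARD('m) - \<gamma> p a)
     - (\<gamma> p v * \<gamma> p x + (\<gamma> p v * \<gamma> p x) * real CARD('m) - \<gamma> p v * \<gamma> p x
      + (2 * \<gamma> p x) * \<gamma> p v - gn * C p v x
      - (C p x v * gn + \<gamma> p x * \<gamma> p v - \<gamma> p v * \<gamma> p x))"
    unfolding endo_trace_add endo_trace_diff endo_trace_scaleR endo_trace_ident r1
      tr_c_eq_sharp[OF Ci bilinear_nab, symmetric] sharp[OF Ci ln(1)] C_gs gn_def[symmetric] ..
  finally show ?thesis
    unfolding ricci_def a_def gamma_delta using inner_formD(2)[OF Ci, of x v] by (simp add: algebra_simps)
qed

lemma tr_nab_transpose: "tr_c (c p) (\<lambda>u v. nab v u) = tr_c (c p) nab"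
  by (rule tr_c_transpose[OF inner_form_p bilinear_nab])

lemma tr_gamma: "tr_c (c p) (\<lambda>u v. \<gamma> p u * \<gamma> p v) = gn"
  using tr_c_rank_one[OF inner_form_p linear_gamma[OF p] linear_gamma[OF p]]
  by (simp add: gn_def gs_def chart_form_p)

text \<open>An equation of forms, written with sums and scalar multiples only, so that the linearity
  rules for \<open>tr_c\<close> and \<open>sym0\<close> apply by rewriting.\<close>

lemma ricci_diff_fun:
  "ricci M D' p = (\<lambda>v x. ricci M D p v x + nab x v + (1 - real CARD('m)) * nab v x
     + (- tr_c (c p) nab) * c p v x + (real CARD('m) - 2) * (\<gamma> p v * \<gamma> p x)
     + (- (real CARD('m) - 2) * gn) * c p v x)"
  by (simp add: fun_eq_iff ricci_diff chart_form_p algebra_simps)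

lemma scal_diff:
  "scal M c D' p = scal M c D p - 2 * (real CARD('m) - 1) * tr_c (c p) nab
     - (real CARD('m) - 1) * (real CARD('m) - 2) * gn"
  unfolding scal_def ricci_diff_fun tr_c_add tr_c_scale tr_nab_transpose tr_gamma tr_c_self[OF inner_form_p]
  by (simp add: algebra_simps)

lemma sigma_diff:
  assumes "CARD('m) \<ge> 2"
  shows "sigma M c D' p = sigma M c D p - tr_c (c p) nab - (real CARD('m) - 2) / 2 * gn"
proof -
  have "real CARD('m) - 1 \<noteq> 0" using assms by simp
  then show ?thesis unfolding sigma_def scal_diff by (simp add: field_simps)
qed

text \<open>The connections on \<open>L\<close> differ by \<open>\<gamma>\<close>, so the curvatures
  differ by its exterior derivative; for a torsion-free connection this is the alternation of
  \<open>nab\<close>.\<close>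

lemma faraday_diff: "faraday M D' p u v = faraday M D p u v + nab u v - nab v u"
proof -
  have d: "has_dchart \<phi> (\<lambda>q. conn_tr G q v + \<gamma> q v) (\<lambda>u. dchart \<phi> (\<lambda>q. conn_tr G q v) p u + dchart \<phi> (\<lambda>q. \<gamma> q v) p u) p" for v
    by (intro has_dchart_add smooth_in_has_dchart[OF smooth_conn_tr[OF conn] p] smooth_in_has_dchart[OF smooth_gamma p])
  have "dchart \<phi> (\<lambda>q. conn_tr G' q v) p u = dchart \<phi> (\<lambda>q. conn_tr G q v) p u + dchart \<phi> (\<lambda>q. \<gamma> q v) p u" for u v
  proof -
    have "(\<lambda>q. conn_tr G' q v) = (\<lambda>q. conn_tr G q v + \<gamma> q v)" by (simp add: \<gamma>_def)
    then show ?thesis using fun_cong[OF has_dchartD[OF d], of v u] by simp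
  qed
  then show ?thesis
    unfolding faraday_chart[OF conn] faraday_chart[OF conn'] nab_def
    using weyl_chartD(2)[OF w p, of u v] by simp
qed

text \<open>The weight decides which first-order terms survive. For k = 1 they are multiples of
  \<open>c\<close>, which the trace-free part discards. In the trace they carry the coefficient 2 (k
  - 1) + m, which vanishes for k = 1/2 and m = 1.\<close>

lemma hess_diff:
  assumes l: "openin (mtop M) W" "p \<in> W" "W \<subseteq> U" "smooth_in \<phi> W (dens_comp M k \<phi> l)"
  defines "f \<equiv> dens_comp M k \<phi> l"
  shows "hess M D' k l p u v = hess M D k l p u v + k * l p * nab u v
     + (k - 1) * (dchart \<phi> f p u * \<gamma> p v + \<gamma> p u * dchart \<phi> f p v)
     + (k\<^sup>2 - k) * l p * (conn_tr G p u * \<gamma> p v + \<gamma> p u * conn_tr G p v)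
     + (k\<^sup>2 - 2 * k) * l p * (\<gamma> p u * \<gamma> p v)
     + (dchart \<phi> f p gs + k * conn_tr G p gs * l p + k * gn * l p) * c p u v"
proof -
  have tr': "conn_tr G' q v = conn_tr G q v + \<gamma> q v" for q v by (simp add: \<gamma>_def)
  have "has_dchart \<phi> (\<lambda>q. conn_tr G q v + \<gamma> q v) (\<lambda>u. dchart \<phi> (\<lambda>q. conn_tr G q v) p u + dchart \<phi> (\<lambda>q. \<gamma> q v) p u) p"
    by (intro has_dchart_add smooth_in_has_dchart[OF smooth_conn_tr[OF conn] p] smooth_in_has_dchart[OF smooth_gamma p])
  note d = fun_cong[OF has_dchartD[OF this]]
  have G': "G' p u v = G p u v + \<delta> p u v" by (simp add: \<delta>_def)
  have lf: "linear (dchart \<phi> f p)" unfolding f_def by (rule linear_dchart[OF l(4,2)])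
  note lt = linear_conn_tr[OF conn p]
  have 1: "dchart \<phi> f p (G' p u v) = dchart \<phi> f p (G p u v) + \<gamma> p u * dchart \<phi> f p v + \<gamma> p v * dchart \<phi> f p u - c p u v * dchart \<phi> f p gs"
    unfolding G' delta_p by (simp add: linear_add[OF lf] linear_diff[OF lf] linear_cmul[OF lf] chart_form_p)
  have 2: "conn_tr G' p (G' p u v) = conn_tr G p (G p u v) + \<gamma> p u * conn_tr G p v + \<gamma> p v * conn_tr G p u - c p u v * conn_tr G p gs
     + \<gamma> p (G p u v) + 2 * \<gamma> p u * \<gamma> p v - c p u v * gn"
    unfolding G' tr' linear_add[OF linear_gamma[OF p]] gamma_delta
    by (simp add: delta_p linear_add[OF lt] linear_diff[OF lt] linear_cmul[OF lt] chart_form_p)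
  show ?thesis
    unfolding hess_chart[OF conn l] hess_chart[OF conn' l] f_def[symmetric] 1 2 unfolding tr' d nab_def
    by (simp add: algebra_simps power2_eq_square)
qed

lemma moebius_diff:
  assumes "near M p (\<lambda>U. smooth_dens M 1 U l)"
  shows "sym0 (c p) (hess M D' 1 l p) u v =
    sym0 (c p) (hess M D 1 l p) u v + l p * (sym0 (c p) nab u v - sym0 (c p) (\<lambda>u v. \<gamma> p u * \<gamma> p v) u v)"
proof -
  obtain W where W: "openin (mtop M) W" "p \<in> W" "W \<subseteq> U" "smooth_in \<phi> W (dens_comp M 1 \<phi> l)"
    using near_density[OF conn assms] by blast
  define t where "t = dchart \<phi> (dens_comp M 1 \<phi> l) p gs + conn_tr G p gs * l p + gn * l p"
  have h: "hess M D' 1 l p = (\<lambda>u v. hess M D 1 l p u v + l p * nab u v + (- l p) * (\<gamma> p u * \<gamma> p v) + t * c p u v)"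
    by (simp add: fun_eq_iff hess_diff[OF W] t_def)
  have z: "sym0 (c p) (c p) u v = 0"
    using inner_formD(2)[OF inner_form_p, of u v] by (simp add: sym0_def tr_c_self[OF inner_form_p])
  show ?thesis unfolding h sym0_add sym0_scale z by (simp add: algebra_simps)
qed

lemma laplace_diff:
  assumes "near M p (\<lambda>U. smooth_dens M (1/2) U l)" "CARD('m) = 1"
  shows "tr_c (c p) (hess M D' (1/2) l p) = tr_c (c p) (hess M D (1/2) l p) + l p * (tr_c (c p) nab / 2 - gn / 4)"
proof -
  obtain W where W: "openin (mtop M) W" "p \<in> W" "W \<subseteq> U" "smooth_in \<phi> W (dens_comp M (1/2) \<phi> l)"
    using near_density[OF conn assms(1)] by blast
  define f where "f = dens_comp M (1/2) \<phi> l"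
  have lf: "linear (dchart \<phi> f p)" unfolding f_def by (rule linear_dchart[OF W(4,2)])
  note lt = linear_conn_tr[OF conn p] and lg = linear_gamma[OF p]
  have bil: "bilinear (\<lambda>u v. a u * \<gamma> p v)" if "linear a" for a
    by (rule bilinearI) (simp_all add: linear_add[OF that] linear_cmul[OF that] linear_add[OF lg] linear_cmul[OF lg] algebra_simps)
  have tr: "tr_c (c p) (\<lambda>u v. a u * \<gamma> p v) = a gs" "tr_c (c p) (\<lambda>u v. \<gamma> p u * a v) = a gs" if "linear a" for a
  proof -
    show 1: "tr_c (c p) (\<lambda>u v. a u * \<gamma> p v) = a gs"
      using tr_c_rank_one[OF inner_form_p that lg] by (simp add: gs_def chart_form_p)
    show "tr_c (c p) (\<lambda>u v. \<gamma> p u * a v) = a gs"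
      using tr_c_transpose[OF inner_form_p bil[OF that]] 1 by (simp add: mult.commute)
  qed
  have "hess M D' (1/2) l p = (\<lambda>u v. hess M D (1/2) l p u v + 1 / 2 * l p * nab u v
     + (1 / 2 - 1) * (dchart \<phi> f p u * \<gamma> p v + \<gamma> p u * dchart \<phi> f p v)
     + ((1 / 2)\<^sup>2 - 1 / 2) * l p * (conn_tr G p u * \<gamma> p v + \<gamma> p u * conn_tr G p v)
     + ((1 / 2)\<^sup>2 - 2 * (1 / 2)) * l p * (\<gamma> p u * \<gamma> p v)
     + (dchart \<phi> f p gs + 1 / 2 * conn_tr G p gs * l p + 1 / 2 * gn * l p) * c p u v)"
    by (simp only: fun_eq_iff hess_diff[OF W] f_def) simp
  \<comment> \<open>With m = 1 the terms in \<open>dchart \<phi> f p gs\<close> and in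
    \<open>conn_tr G p gs\<close> cancel, and the coefficients of \<open>gn\<close> sum to 1/4 - 1 +
    1/2 = -1/4.\<close>
  then have "tr_c (c p) (hess M D' (1/2) l p) = tr_c (c p) (hess M D (1/2) l p) + 1 / 2 * l p * tr_c (c p) nab
     + (1 / 2 - 1) * (dchart \<phi> f p gs + dchart \<phi> f p gs)
     + ((1 / 2)\<^sup>2 - 1 / 2) * l p * (conn_tr G p gs + conn_tr G p gs)
     + ((1 / 2)\<^sup>2 - 2 * (1 / 2)) * l p * gn
     + (dchart \<phi> f p gs + 1 / 2 * conn_tr G p gs * l p + 1 / 2 * gn * l p) * real CARD('m)"
    by (simp only: tr_c_add tr_c_scale tr[OF lf] tr[OF lt] tr_gamma tr_c_self[OF inner_form_p])
  then show ?thesis unfolding assms(2) by (simp add: power2_eq_square algebra_simps)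
qed

lemma moebius_coefficient:
  assumes "\<And>l. near M p (\<lambda>U. smooth_dens M 1 U l) \<Longrightarrow> Q l p u v - sym0 (c p) (hess M D 1 l p) u v = a * l p"
  shows "h0_moebius M c Q D p u v = a"
    "h0_moebius M c Q D' p u v = a - sym0 (c p) nab u v + sym0 (c p) (\<lambda>u v. \<gamma> p u * \<gamma> p v) u v"
  unfolding h0_moebius_def
  by (rule the_coefficient, rule assms, assumption)
    (rule the_coefficient, simp add: moebius_diff, drule assms, simp add: algebra_simps)

lemma laplace_coefficient:
  assumes "\<And>l. near M p (\<lambda>U. smooth_dens M (1/2) U l) \<Longrightarrow> Q l p - tr_c (c p) (hess M D (1/2) l p) = a * l p"
    and m: "CARD('m) = 1"
  shows "sigma_laplace M c Q D p = 2 * a"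
    "sigma_laplace M c Q D' p = 2 * a - tr_c (c p) nab + gn / 2"
proof -
  show "sigma_laplace M c Q D p = 2 * a"
    unfolding sigma_laplace_def by (rule arg_cong[of _ _ "(*) 2"], rule the_coefficient, rule assms)
  have "(THE a. \<forall>l. near M p (\<lambda>U. smooth_dens M (1/2) U l) \<longrightarrow>
        Q l p - tr_c (c p) (hess M D' (1/2) l p) = a * l p) = a - (tr_c (c p) nab / 2 - gn / 4)"
    by (rule the_coefficient, unfold laplace_diff[OF _ m], drule assms(1)) (simp add: algebra_simps)
  then show "sigma_laplace M c Q D' p = 2 * a - tr_c (c p) nab + gn / 2"
    unfolding sigma_laplace_def by simp
qed

lemma sym0_gamma: "sym0 (c p) (\<lambda>u v. \<gamma> p u * \<gamma> p v) u v = \<gamma> p u * \<gamma> p v - gn / real CARD('m) * c p u v"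
  by (simp add: sym0_def tr_gamma)

lemma bilinear_gamma: "bilinear (\<lambda>u v. \<gamma> p u * \<gamma> p v)"
  by (rule bilinearI)
    (simp_all add: linear_add[OF linear_gamma[OF p]] linear_cmul[OF linear_gamma[OF p]] algebra_simps)

end

text \<open>The structure compares the operator with one unspecified Weyl structure. The change
  formula carries the comparison over to the given \<open>D\<close> and keeps the coefficient
  bilinear and symmetric.\<close>

lemma moebius_exists:
  assumes Q: "moebius_structure M c Q" and w: "weyl_chart M c D \<phi> U G"
  obtains a where "bilinear a" "\<And>u v. a u v = a v u"
    "\<And>l u v. near M p (\<lambda>U. smooth_dens M 1 U l) \<Longrightarrow> Q l p u v - sym0 (c p) (hess M D 1 l p) u v = a u v * l p"
proof -
  obtain D0 A where D0: "weyl_structure M c D0" and A: "smooth_bil M 0 A" "\<And>u v. A p u v = A p v u"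
    and l: "\<And>l u v. near M p (\<lambda>U. smooth_dens M 1 U l) \<Longrightarrow> Q l p u v - sym0 (c p) (hess M D0 1 l p) u v = A p u v * l p"
    using Q pM unfolding moebius_structure_def by blast
  note w0 = weyl_structure_chart[OF M phiM U D0 cc]
  define g where "g = (\<lambda>u v. \<gamma> (christoffel M D0 \<phi>) G p u * \<gamma> (christoffel M D0 \<phi>) G p v)"
  define n where "n = nab (christoffel M D0 \<phi>) G"
  have bA: "bilinear (A p)" using A(1) pM by (simp add: smooth_bil_def)
  have bn: "bilinear (sym0 (c p) n)" "bilinear (sym0 (c p) g)"
    unfolding n_def g_def
    by (intro bilinear_sym0 inner_formD(1)[OF inner_form_p] bilinear_nab[OF w0 w] bilinear_gamma[OF w0 w])+
  have s: "sym0 (c p) b u v = sym0 (c p) b v u" for b u v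
    using inner_formD(2)[OF inner_form_p, of u v] by (simp add: sym0_def add.commute)
  show ?thesis
  proof
    let ?a = "\<lambda>u v. A p u v - sym0 (c p) n u v + sym0 (c p) g u v"
    show "bilinear ?a"
      by (rule bilinearI)
        (simp_all add: bilinear_simps[OF bA] bilinear_simps[OF bn(1)] bilinear_simps[OF bn(2)] algebra_simps)
    show "?a u v = ?a v u" for u v using A(2)[of u v] s[of n u v] s[of g u v] by simp
    show "Q l p u v - sym0 (c p) (hess M D 1 l p) u v = ?a u v * l p"
      if "near M p (\<lambda>U. smooth_dens M 1 U l)" for l u v
      using l[OF that, of u v] moebius_diff[OF w0 w that, of u v] by (simp add: n_def g_def algebra_simps)
  qed
qed

text \<open>Transfer from the Weyl structure that witnesses the Laplace structure to the given
  \<open>D\<close>, in dimension 1, where the trace of the Hessian changes only by a term of order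
  zero.\<close>

lemma laplace_exists:
  assumes Q: "laplace_structure M c Q" and w: "weyl_chart M c D \<phi> U G" and m: "CARD('m) = 1"
  obtains a where
    "\<And>l. near M p (\<lambda>U. smooth_dens M (1/2) U l) \<Longrightarrow> Q l p - tr_c (c p) (hess M D (1/2) l p) = a * l p"
proof -
  obtain D0 a where D0: "weyl_structure M c D0"
    and l: "\<And>l. near M p (\<lambda>U. smooth_dens M (1/2) U l) \<Longrightarrow> Q l p - tr_c (c p) (hess M D0 (1/2) l p) = a p * l p"
    using Q pM unfolding laplace_structure_def by blast
  note w0 = weyl_structure_chart[OF M phiM U D0 cc]
  let ?a = "a p - (tr_c (c p) (nab (christoffel M D0 \<phi>) G) / 2 - gn (christoffel M D0 \<phi>) G / 4)"
  show ?thesis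
  proof
    show "Q l p - tr_c (c p) (hess M D (1/2) l p) = ?a * l p"
      if "near M p (\<lambda>U. smooth_dens M (1/2) U l)" for l
      using l[OF that] unfolding laplace_diff[OF w0 w that m] by (simp add: algebra_simps)
  qed
qed

lemma bilinear_faraday:
  assumes "conn_chart M D \<phi> U G"
  shows "bilinear (faraday M D p)" "faraday M D p u v = - faraday M D p v u"
proof -
  have 1: "linear (\<lambda>v. dchart \<phi> (\<lambda>q. conn_tr G q v) p u)" for u
    by (rule linear_dchart_family[OF co p smooth_conn_tr[OF assms] linear_conn_tr[OF assms]])
  have 2: "linear (dchart \<phi> (\<lambda>q. conn_tr G q v) p)" for v
    by (rule linear_dchart[OF smooth_conn_tr[OF assms] p])
  show "bilinear (faraday M D p)"
    unfolding faraday_chart[OF assms]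
    by (rule bilinearI)
      (simp_all add: linear_add[OF 1] linear_cmul[OF 1] linear_add[OF 2] linear_cmul[OF 2] algebra_simps)
  show "faraday M D p u v = - faraday M D p v u"
    unfolding faraday_chart[OF assms] by simp
qed

text \<open>The terms given by definite descriptions become tensors through their chart formulas.
  The coefficient -1/2 of the Faraday form is counted twice in the skew difference.\<close>

lemma schouten_weyl_bilinear:
  assumes w: "weyl_chart M c D \<phi> U G" and K: "of_kind M c K"
  shows "bilinear (schouten_weyl M c K D p)"
    "schouten_weyl M c K D p u v - schouten_weyl M c K D p v u = - faraday M D p u v"
proof -
  note D = weyl_chartD(1)[OF w]
  note bf = bilinear_faraday[OF D]
  note bc = inner_formD(1)[OF inner_form_p]
  note b = bilinear_simps[OF bc] bilinear_simps[OF bf(1)]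
  have cs: "c p v u = c p u v" for u v by (rule inner_formD(2)[OF inner_form_p])
  have "bilinear (schouten_weyl M c K D p) \<and>
    schouten_weyl M c K D p u v - schouten_weyl M c K D p v u = - faraday M D p u v"
  proof (cases K)
    case Conformal
    have br: "bilinear (sym0 (c p) (ricci M D p))"
      by (rule bilinear_sym0[OF bc bilinear_ricci[OF D]])
    have "sym0 (c p) (ricci M D p) u v = sym0 (c p) (ricci M D p) v u"
      using cs[of u v] by (simp add: sym0_def add.commute)
    moreover have "bilinear (schouten_weyl M c K D p)"
      by (rule bilinearI)
        (simp_all add: schouten_weyl_def Conformal b bilinear_simps[OF br] algebra_simps add_divide_distrib)
    ultimately show ?thesis using cs[of u v] bf(2)[of u v] by (simp add: schouten_weyl_def Conformal)
  next
    case (Moebius_Surface Q)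
    then have "moebius_structure M c Q" using K by (simp add: of_kind_def)
    then obtain a where a: "bilinear a" "\<And>u v. a u v = a v u"
      "\<And>l u v. near M p (\<lambda>U. smooth_dens M 1 U l) \<Longrightarrow> Q l p u v - sym0 (c p) (hess M D 1 l p) u v = a u v * l p"
      by (rule moebius_exists[OF _ w]) (rule that)
    have h: "h0_moebius M c Q D p u v = a u v" for u v
      by (rule moebius_coefficient(1)[OF w w, where a = "a u v"], rule a(3))
    have "bilinear (schouten_weyl M c K D p)"
      by (rule bilinearI) (simp_all add: schouten_weyl_def Moebius_Surface b h bilinear_simps[OF a(1)] algebra_simps)
    then show ?thesis using cs[of u v] bf(2)[of u v] a(2)[of u v] by (simp add: schouten_weyl_def Moebius_Surface h)
  next
    case (Laplace_Curve Q)
    then have m: "CARD('m) = 1" using K by (simp add: of_kind_def)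
    \<comment> \<open>On a curve no Faraday term is subtracted; there the form is both skew and a
      multiple of \<open>c p\<close>, hence zero.\<close>
    have "faraday M D p u v = faraday M D p v u"
      using bilinear_one_dim[OF m inner_form_p bf(1)] cs by metis
    moreover have "bilinear (schouten_weyl M c K D p)"
      by (rule bilinearI) (simp_all add: schouten_weyl_def Laplace_Curve b algebra_simps)
    ultimately show ?thesis using cs[of u v] bf(2)[of u v] by (simp add: schouten_weyl_def Laplace_Curve)
  qed
  then show "bilinear (schouten_weyl M c K D p)"
    "schouten_weyl M c K D p u v - schouten_weyl M c K D p v u = - faraday M D p u v" by auto
qed

text \<open>For m at least 2 the law is assembled from its three irreducible parts: trace-free from
  Ricci or the Moebius operator, trace from \<open>sigma\<close>, and skew from the Faraday
  form.\<close>

lemma schouten_weyl_change: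
  assumes w: "weyl_chart M c D \<phi> U G" and w': "weyl_chart M c D' \<phi> U G'" and K: "of_kind M c K"
  shows "schouten_weyl M c K D' p u v = schouten_weyl M c K D p u v - nab G G' u v
    + \<gamma> G G' p u * \<gamma> G G' p v - gn G G' / 2 * c p u v"
proof -
  note W = w w'
  have cs: "c p v u = c p u v" for u v by (rule inner_formD(2)[OF inner_form_p])
  show ?thesis
  proof (cases K)
    case Conformal
    then have m: "CARD('m) \<ge> 3" using K by (simp add: of_kind_def)
    let ?m = "real CARD('m)"
    have m': "?m - 2 \<noteq> 0" "?m \<noteq> 0" using m by auto
    have "sym0 (c p) (c p) u v = 0"
      using cs[of u v] m' by (simp add: sym0_def tr_c_self[OF inner_form_p])
    moreover have "sym0 (c p) (\<lambda>v x. nab G G' x v) u v = sym0 (c p) (nab G G') u v"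
      by (simp add: sym0_def tr_nab_transpose[OF W] add.commute)
    \<comment> \<open>After symmetrization the coefficients 1 and 1 - m of the two copies of
      \<open>nab\<close> add up to -(m - 2), the same factor that multiplies the quadratic
      term.\<close>
    ultimately have s: "sym0 (c p) (ricci M D' p) u v = sym0 (c p) (ricci M D p) u v
        - (?m - 2) * (sym0 (c p) (nab G G') u v - sym0 (c p) (\<lambda>u v. \<gamma> G G' p u * \<gamma> G G' p v) u v)"
      unfolding ricci_diff_fun[OF W] sym0_add sym0_scale by (simp add: algebra_simps)
    have "1 / (?m - 2) * sym0 (c p) (ricci M D' p) u v = 1 / (?m - 2) * sym0 (c p) (ricci M D p) u v
        - sym0 (c p) (nab G G') u v + sym0 (c p) (\<lambda>u v. \<gamma> G G' p u * \<gamma> G G' p v) u v"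
      unfolding s using m' by (simp add: divide_simps) (simp add: algebra_simps)
    moreover have "sigma M c D' p = sigma M c D p - tr_c (c p) (nab G G') - (?m - 2) / 2 * gn G G'"
      by (rule sigma_diff[OF W]) (use m in simp)
    \<comment> \<open>The coefficient of \<open>gn\<close> times \<open>c\<close> is -1/m from
      removing the trace of the square of \<open>\<gamma>\<close> and -(m - 2)/(2 m) from
      \<open>sigma\<close>; together -1/2.\<close>
    ultimately show ?thesis
      unfolding schouten_weyl_def Conformal using m'
      by (simp add: faraday_diff[OF W] sym0_gamma[OF W])
        (simp add: sym0_def field_simps)
  next
    case (Moebius_Surface Q)
    then have Q: "moebius_structure M c Q" and m: "CARD('m) = 2" using K by (simp_all add: of_kind_def)
    from Q obtain a where a: "bilinear a" "\<And>u v. a u v = a v u"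
      "\<And>l u v. near M p (\<lambda>U. smooth_dens M 1 U l) \<Longrightarrow> Q l p u v - sym0 (c p) (hess M D 1 l p) u v = a u v * l p"
      by (rule moebius_exists[OF _ w]) (rule that)
    have h: "h0_moebius M c Q D p u v = a u v"
      "h0_moebius M c Q D' p u v = a u v - sym0 (c p) (nab G G') u v + sym0 (c p) (\<lambda>u v. \<gamma> G G' p u * \<gamma> G G' p v) u v"
      by (rule moebius_coefficient[OF W, where a = "a u v"], rule a(3), assumption)+
    have "sigma M c D' p = sigma M c D p - tr_c (c p) (nab G G')"
      using sigma_diff[OF W] m by simp
    then show ?thesis
      unfolding schouten_weyl_def Moebius_Surface
      by (simp add: h faraday_diff[OF W] sym0_gamma[OF W]) (simp add: m sym0_def field_simps)
  next
    case (Laplace_Curve Q)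
    then have Q: "laplace_structure M c Q" and m: "CARD('m) = 1" using K by (simp_all add: of_kind_def)
    obtain a where a:
      "\<And>l. near M p (\<lambda>U. smooth_dens M (1/2) U l) \<Longrightarrow> Q l p - tr_c (c p) (hess M D (1/2) l p) = a * l p"
      by (rule laplace_exists[OF Q w m]) (rule that)
    \<comment> \<open>With both tensors multiples of \<open>c\<close>, the change
      \<open>gn / 2\<close> of the Laplace coefficient is the required
      \<open>gn - gn / 2\<close>.\<close>
    have "nab G G' u v = tr_c (c p) (nab G G') * c p u v"
      by (rule bilinear_one_dim[OF m inner_form_p bilinear_nab[OF W]])
    moreover have "\<gamma> G G' p u * \<gamma> G G' p v = gn G G' * c p u v"
      using bilinear_one_dim[OF m inner_form_p bilinear_gamma[OF W]] by (simp add: tr_gamma[OF W])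
    ultimately show ?thesis
      unfolding schouten_weyl_def Laplace_Curve
      by (simp add: laplace_coefficient[OF W, where Q = Q and a = a, OF a m] algebra_simps)
  qed
qed

end

section \<open>Submanifolds in adapted charts\<close>

lemma gram_pullback:
  fixes J :: "real^'n \<Rightarrow> real^'n"
  assumes "bilinear g" "linear J"
  shows "gram (\<lambda>x y. g (J x) (J y)) = transpose (matrix J) ** gram g ** matrix J"
proof -
  have "g (J (axis r 1)) (J (axis s 1)) =
      (\<Sum>k\<in>UNIV. (\<Sum>l\<in>UNIV. J (axis r 1) $ l * g (axis l 1) (axis k 1)) * J (axis s 1) $ k)" for r s
  proof -
    have l: "linear (g (J (axis r 1)))" "linear (\<lambda>x. g x (axis k 1))" for k
      using assms(1) by (auto simp: bilinear_def)
    have "g (J (axis r 1)) (J (axis s 1)) = (\<Sum>k\<in>UNIV. J (axis s 1) $ k * g (J (axis r 1)) (axis k 1))"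
      using linear_expand_axis[OF l(1), of "J (axis s 1)"] by simp
    moreover have "g (J (axis r 1)) (axis k 1) = (\<Sum>l\<in>UNIV. J (axis r 1) $ l * g (axis l 1) (axis k 1))" for k
      using linear_expand_axis[OF l(2)[of k], of "J (axis r 1)"] by simp
    ultimately show ?thesis by (simp add: mult.commute)
  qed
  then show ?thesis
    by (simp add: gram_def matrix_matrix_mult_def transpose_def matrix_def vec_eq_iff)
qed

lemma det_gram_scale: "det (gram (\<lambda>u v. t * g u v)) = t ^ CARD('n) * det (gram g)"
  for g :: "real^'n \<Rightarrow> real^'n \<Rightarrow> real"
proof -
  have "gram (\<lambda>u v. t * g u v) = (\<chi> i. t *s gram g $ i)" by (simp add: gram_def vec_eq_iff)
  then show ?thesis using det_rows_mul[of "\<lambda>_. t" "\<lambda>i. gram g $ i"] by simp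
qed

text \<open>The inclusion enters through its coordinate expression from \<open>\<psi>\<close> to
  \<open>\<phi>\<close>, whose derivative is injective on \<open>V\<close>. This treats immersed
  submanifolds without slice coordinates.\<close>

locale submanifold_at =
  fixes M :: "('a, real^'m) manifold" and N :: "('a, real^'n) manifold"
    and c :: "'a \<Rightarrow> real^'m \<Rightarrow> real^'m \<Rightarrow> real" and \<phi> :: "('a, real^'m) chart"
    and \<psi> :: "('a, real^'n) chart" and p :: 'a
  assumes M: "smooth_manifold M" and c: "conformal_structure M c" and sub: "submanifold M N"
    and p: "p \<in> points N" and \<phi>: "\<phi> = chart_at M p" and \<psi>: "\<psi> = chart_at N p"
begin

definition "V = fst \<psi> \<inter> fst \<phi>"

abbreviation (input) "\<iota> \<equiv> jac \<psi> \<phi>"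

abbreviation "cN \<equiv> induced_conf M c N"

lemma N: "smooth_manifold N"
  using sub by (simp add: submanifold_def)

lemma pM: "p \<in> points M"
  using sub p by (auto simp: submanifold_def)

lemma phiM: "\<phi> \<in> atlas M" and p_phi: "p \<in> fst \<phi>"
  unfolding \<phi> using chart_at_atlas[OF M pM] chart_at_mem[OF M pM] .

lemma psiN: "\<psi> \<in> atlas N" and p_psi: "p \<in> fst \<psi>"
  unfolding \<psi> using chart_at_atlas[OF N p] chart_at_mem[OF N p] .

text \<open>The topology of \<open>N\<close> may be finer than the subspace topology; continuity of
  the inclusion makes traces of open sets of \<open>M\<close> open in \<open>N\<close>.\<close>

lemma openin_N:
  assumes "openin (mtop N) W" "openin (mtop M) A"
  shows "openin (mtop N) (W \<inter> A)"
proof -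
  have "continuous_map (mtop N) (mtop M) (\<lambda>q. q)" using sub by (simp add: submanifold_def)
  from openin_continuous_map_preimage[OF this assms(2)]
  have "openin (mtop N) {x \<in> topspace (mtop N). x \<in> A}" .
  moreover have "W \<inter> A = W \<inter> {x \<in> topspace (mtop N). x \<in> A}" using openin_subset[OF assms(1)] by auto
  ultimately show ?thesis using assms(1) openin_Int by metis
qed

lemma V: "openin (mtop N) V" "V \<subseteq> fst \<psi>" "V \<subseteq> fst \<phi>" "p \<in> V"
  unfolding V_def using openin_N[OF atlas_openin[OF N psiN] atlas_openin[OF M phiM]] p_phi p_psi by auto

lemma sub_trans:
  assumes "\<psi>' \<in> atlas N" "\<phi>' \<in> atlas M" "openin (mtop N) W" "W \<subseteq> fst \<psi>'" "W \<subseteq> fst \<phi>'"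
  shows "trans_on \<psi>' \<phi>' W"
proof -
  have "smooth_on (snd \<psi>' ` (fst \<psi>' \<inter> fst \<phi>')) (in_chart \<psi>' (snd \<phi>'))"
    using sub assms(1,2) by (simp add: submanifold_def)
  then have "smooth_in \<psi>' W (snd \<phi>')"
    unfolding smooth_in_def by (rule smooth_on_subset) (use assms in auto)
  moreover have "inj_on (snd \<phi>') (fst \<phi>')"
    using atlas_chart_open[OF M assms(2) atlas_openin[OF M assms(2)]] by (simp add: chart_open_def)
  ultimately show ?thesis
    using atlas_chart_open[OF N assms(1,3,4)] assms by (simp add: trans_on_def)
qed

lemma T: "trans_on \<psi> \<phi> V"
  by (rule sub_trans[OF psiN phiM V(1-3)])

lemma coV: "chart_open \<psi> V"
  by (rule trans_on_open[OF T])

lemma co_phi: "chart_open \<phi> (fst \<phi>)"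
  by (rule atlas_chart_open[OF M phiM atlas_openin[OF M phiM]]) simp

lemma linear_iota: "q \<in> V \<Longrightarrow> linear (\<iota> q)"
  by (rule linear_jac[OF T])

lemma smooth_iota: "smooth_in \<psi> V (\<lambda>q. \<iota> q v)"
  by (rule smooth_in_jac[OF T])

lemma smooth_restrict: "smooth_in \<phi> (fst \<phi>) f \<Longrightarrow> smooth_in \<psi> V f"
  by (rule smooth_in_trans[OF T co_phi V(3)])

lemma has_dchart_restrict:
  "smooth_in \<phi> (fst \<phi>) f \<Longrightarrow> q \<in> V \<Longrightarrow> has_dchart \<psi> f (\<lambda>v. dchart \<phi> f q (\<iota> q v)) q"
  unfolding jac_eq_dchart
  by (rule has_dchart_trans[OF T], assumption, rule smooth_in_has_dchart, assumption) (use V in auto)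

lemma mem_V:
  assumes "q \<in> V"
  shows "q \<in> fst \<psi>" "q \<in> fst \<phi>" "q \<in> points N" "q \<in> points M"
    "chart_at M q \<in> atlas M" "q \<in> fst (chart_at M q)" "chart_at N q \<in> atlas N" "q \<in> fst (chart_at N q)"
proof -
  show 1: "q \<in> fst \<psi>" "q \<in> fst \<phi>" using assms V by auto
  show 2: "q \<in> points N" "q \<in> points M" using mem_points[OF N psiN 1(1)] mem_points[OF M phiM 1(2)] .
  show "chart_at M q \<in> atlas M" "q \<in> fst (chart_at M q)" "chart_at N q \<in> atlas N" "q \<in> fst (chart_at N q)"
    using chart_at_atlas[OF M 2(2)] chart_at_mem[OF M 2(2)] chart_at_atlas[OF N 2(1)] chart_at_mem[OF N 2(1)] .
qed

lemma incl_chart: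
  assumes q: "q \<in> V"
  shows "jac (chart_at M q) \<phi> q (incl_d M N q x) = \<iota> q (jac (chart_at N q) \<psi> q x)"
proof -
  note m = mem_V[OF q]
  let ?a = "chart_at M q" and ?b = "chart_at N q"
  have W1: "openin (mtop N) (fst ?b \<inter> fst ?a)" by (rule openin_N[OF atlas_openin[OF N m(7)] atlas_openin[OF M m(5)]])
  have 1: "trans_on ?b ?a (fst ?b \<inter> fst ?a)" by (rule sub_trans[OF m(7,5) W1]) auto
  have 2: "trans_on ?a \<phi> (fst ?a \<inter> fst \<phi>)"
    by (rule atlas_trans_on[OF M m(5) phiM openin_Int[OF atlas_openin[OF M m(5)] atlas_openin[OF M phiM]]]) auto
  have 3: "trans_on ?b \<psi> (fst ?b \<inter> fst \<psi>)"
    by (rule atlas_trans_on[OF N m(7) psiN openin_Int[OF atlas_openin[OF N m(7)] atlas_openin[OF N psiN]]]) auto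
  have "jac ?a \<phi> q (incl_d M N q x) = jac ?b \<phi> q x"
    unfolding incl_d_def by (rule jac_trans[OF 1 2, symmetric]) (use m in auto)
  also have "\<dots> = \<iota> q (jac ?b \<psi> q x)"
    by (rule jac_trans[OF 3 T]) (use m q in auto)
  finally show ?thesis .
qed

lemma incl_eq:
  assumes q: "q \<in> V"
  shows "incl_d M N q (jac \<psi> (chart_at N q) q x) = jac \<phi> (chart_at M q) q (\<iota> q x)"
  using incl_chart[OF q, of "jac \<psi> (chart_at N q) q x"] atlas_jac_at(3)[OF M phiM mem_V(2)[OF q]]
    atlas_jac_at(4)[OF N psiN mem_V(1)[OF q]] by metis

lemma inj_iota:
  assumes q: "q \<in> V"
  shows "inj (\<iota> q)"
proof (rule injI)
  fix x y assume "\<iota> q x = \<iota> q y"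
  then have "incl_d M N q (jac \<psi> (chart_at N q) q x) = incl_d M N q (jac \<psi> (chart_at N q) q y)"
    unfolding incl_eq[OF q] by simp
  moreover have "inj (incl_d M N q)" using sub mem_V(3)[OF q] by (simp add: submanifold_def)
  ultimately have "jac \<psi> (chart_at N q) q x = jac \<psi> (chart_at N q) q y" by (simp add: inj_eq)
  then show "x = y" using atlas_jac_at(4)[OF N psiN mem_V(1)[OF q]] by metis
qed

section \<open>The first fundamental form, the tangential projection and the normalized conformal
  structure\<close>

sublocale MM: weyl_at M c \<phi> "fst \<phi>" p
  by unfold_locales
    (use M \<phi> atlas_openin[OF M phiM] p_phi conf_chart_conformal(1)[OF M phiM atlas_openin[OF M phiM] subset_refl c] in auto)

abbreviation (input) "C \<equiv> chart_form M c \<phi>"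

definition "g q u v = C q (\<iota> q u) (\<iota> q v)"

lemma C_inner: "q \<in> V \<Longrightarrow> inner_form (C q)"
  using MM.C_inner V by blast

lemma g_inner: "q \<in> V \<Longrightarrow> inner_form (g q)"
  unfolding g_def[abs_def] by (rule inner_form_pullback[OF C_inner linear_iota inj_iota])

lemma smooth_C: "smooth_in \<psi> V (\<lambda>q. C q u v)"
  by (rule smooth_restrict[OF MM.C_smooth])

lemma smooth_C_apply: "smooth_in \<psi> V f \<Longrightarrow> smooth_in \<psi> V h \<Longrightarrow> smooth_in \<psi> V (\<lambda>q. C q (f q) (h q))"
  by (rule smooth_in_bilinear_apply[OF coV smooth_C inner_formD(1)[OF C_inner]])

lemma smooth_g: "smooth_in \<psi> V (\<lambda>q. g q u v)"
  unfolding g_def by (rule smooth_C_apply[OF smooth_iota smooth_iota])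

text \<open>Orthogonal projection onto the tangent space of \<open>N\<close>, expressed in the
  charts. Defining it by duality for \<open>g\<close> makes Cramer's rule available for its
  smoothness.\<close>

definition "Tan q w = sharp (g q) (\<lambda>y. C q w (\<iota> q y))"

lemma linear_C_iota: "q \<in> V \<Longrightarrow> linear (\<lambda>y. C q w (\<iota> q y))"
  using linear_compose[OF linear_iota inner_formD(4)[OF C_inner]] by (simp add: comp_def)

lemma g_Tan: "q \<in> V \<Longrightarrow> g q (Tan q w) y = C q w (\<iota> q y)"
  unfolding Tan_def by (rule sharp[OF g_inner linear_C_iota])

lemma Tan_unique: "q \<in> V \<Longrightarrow> (\<And>y. g q z y = C q w (\<iota> q y)) \<Longrightarrow> Tan q w = z"
  unfolding Tan_def by (rule sharp_unique[OF g_inner])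

lemma Tan_iota: "q \<in> V \<Longrightarrow> Tan q (\<iota> q z) = z"
  by (rule Tan_unique) (simp_all add: g_def)

lemma linear_Tan: "q \<in> V \<Longrightarrow> linear (Tan q)"
  by (rule linearI; rule Tan_unique)
    (simp_all add: inner_form_simps[OF g_inner] inner_form_simps[OF C_inner] g_Tan)

lemma smooth_Tan: "smooth_in \<psi> V (\<lambda>q. Tan q w)"
proof (rule smooth_in_cong[OF coV])
  let ?d = "\<lambda>q. det (\<chi> r s. g q (axis r 1) (axis s 1))"
  let ?n = "\<lambda>q k. det (\<chi> r s. if s = k then C q w (\<iota> q (axis r 1)) else g q (axis r 1) (axis s 1))"
  have nz: "?d q \<noteq> 0" if "q \<in> V" for q
    using gram_invertible[OF g_inner[OF that]] by (simp add: invertible_det_nz gram_def)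
  have n: "smooth_in \<psi> V (\<lambda>q. ?n q k)" for k
  proof (rule smooth_in_det[OF coV])
    fix r s
    show "smooth_in \<psi> V (\<lambda>q. if s = k then C q w (\<iota> q (axis r 1)) else g q (axis r 1) (axis s 1))"
      by (cases "s = k") (simp_all add: smooth_g smooth_C_apply[OF smooth_in_const smooth_iota])
  qed
  show "smooth_in \<psi> V (\<lambda>q. \<chi> k. ?n q k * inverse (?d q))"
    by (rule smooth_in_vec_lambda[OF coV smooth_in_mult[OF coV n
          smooth_in_inverse[OF coV smooth_in_det[OF coV smooth_g] nz]]])
  show "(\<chi> k. ?n q k * inverse (?d q)) = Tan q w" if "q \<in> V" for q
    using inner_form_solve[OF g_inner[OF that] linear_C_iota[OF that], of "Tan q w" w] g_Tan[OF that]
    by (simp add: divide_inverse)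
qed

lemma det_J_pos:
  assumes "q \<in> V"
  shows "\<bar>det (matrix (jac (chart_at M q) \<phi> q))\<bar> powr a > 0"
    "\<bar>det (matrix (jac (chart_at N q) \<psi> q))\<bar> > 0"
  using det_jac_nonzero[OF M mem_V(5)[OF assms] phiM mem_V(6,2)[OF assms]]
    det_jac_nonzero[OF N mem_V(7)[OF assms] psiN mem_V(8,1)[OF assms]] by simp_all

lemma C_pullback:
  assumes "q \<in> V"
  shows "C q (jac (chart_at M q) \<phi> q a) (jac (chart_at M q) \<phi> q b) =
    \<bar>det (matrix (jac (chart_at M q) \<phi> q))\<bar> powr (2 / real CARD('m)) * c q a b"
  by (simp add: chart_form_eq atlas_jac_at(3)[OF M phiM mem_V(2)[OF assms]])

text \<open>Orthogonality does not see the positive weight factor between \<open>c q\<close> and its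
  chart form, so both projections solve the same linear equations.\<close>

lemma tan_part_chart:
  assumes q: "q \<in> V"
  shows "jac (chart_at N q) \<psi> q (tan_part M c N q w) = Tan q (jac (chart_at M q) \<phi> q w)"
proof -
  let ?JM = "jac (chart_at M q) \<phi> q" and ?JN = "jac (chart_at N q) \<psi> q" and ?IN = "jac \<psi> (chart_at N q) q"
  note JM = atlas_jac_at[OF M phiM mem_V(2)[OF q]] and JN = atlas_jac_at[OF N psiN mem_V(1)[OF q]]
  have "w - incl_d M N q x \<in> normal_space M c N q \<longleftrightarrow> x = ?IN (Tan q (?JM w))" for x
  proof -
    have "c q (w - incl_d M N q x) (incl_d M N q y) = 0 \<longleftrightarrow> g q (?JN x) (?JN y) = C q (?JM w) (\<iota> q (?JN y))" for y
      using C_pullback[OF q, of "w - incl_d M N q x" "incl_d M N q y"] det_J_pos(1)[OF q, of "2 / real CARD('m)"]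
      unfolding linear_diff[OF JM(2)] incl_chart[OF q] by (auto simp: g_def inner_form_simps[OF C_inner[OF q]])
    then have "w - incl_d M N q x \<in> normal_space M c N q \<longleftrightarrow>
        (\<forall>y. g q (?JN x) (?JN y) = C q (?JM w) (\<iota> q (?JN y)))"
      by (simp add: normal_space_def)
    also have "\<dots> \<longleftrightarrow> (\<forall>y. g q (?JN x) y = C q (?JM w) (\<iota> q y))"
      using JN(4) by metis
    also have "\<dots> \<longleftrightarrow> ?JN x = Tan q (?JM w)"
      using Tan_unique[OF q, of "?JN x" "?JM w"] g_Tan[OF q] by auto
    also have "\<dots> \<longleftrightarrow> x = ?IN (Tan q (?JM w))" using JN(3,4) by metis
    finally show ?thesis .
  qed
  then have "tan_part M c N q w = ?IN (Tan q (?JM w))" unfolding tan_part_def by simp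
  then show ?thesis by (simp add: JN(4))
qed

text \<open>The factor that normalizes the determinant of \<open>g\<close>; the exponent compensates
  that scaling by t multiplies an n by n determinant by the n-th power of t.\<close>

definition "scl q = \<bar>det (gram (g q))\<bar> powr (- 1 / real CARD('n))"

lemma scl_pos: "q \<in> V \<Longrightarrow> scl q > 0"
  using det_gram_pos[OF g_inner, of q] by (simp add: scl_def)

lemma smooth_scl: "smooth_in \<psi> V scl"
  unfolding scl_def[abs_def]
proof (rule smooth_in_abs_powr[OF coV])
  show "smooth_in \<psi> V (\<lambda>q. det (gram (g q)))"
    unfolding gram_def by (rule smooth_in_det[OF coV smooth_g])
  show "det (gram (g q)) \<noteq> 0" if "q \<in> V" for q
    using det_gram_pos[OF g_inner[OF that]] by simp
qed

text \<open>Two factors drop out. The ambient weight \<open>t\<close> scales \<open>h\<close> and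
  the normalizing root alike, and the squared Jacobian determinant under that root cancels the
  weight of \<open>L\<^sup>2\<close> on \<open>N\<close>.\<close>

lemma chart_form_N:
  assumes q: "q \<in> V"
  shows "chart_form N cN \<psi> q u w = scl q * g q u w"
proof -
  let ?JN = "jac (chart_at N q) \<psi> q" and ?IN = "jac \<psi> (chart_at N q) q"
  let ?dN = "\<bar>det (matrix ?JN)\<bar>"
  note JN = atlas_jac_at[OF N psiN mem_V(1)[OF q]]
  define t where "t = \<bar>det (matrix (jac (chart_at M q) \<phi> q))\<bar> powr (2 / real CARD('m))"
  have t: "t > 0" unfolding t_def by (rule det_J_pos(1)[OF q])
  define h where "h = (\<lambda>x y. c q (incl_d M N q x) (incl_d M N q y))"
  have h: "h x y = inverse t * g q (?JN x) (?JN y)" for x y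
    using C_pullback[OF q, of "incl_d M N q x" "incl_d M N q y"] t
    unfolding incl_chart[OF q] t_def[symmetric] h_def g_def by (simp add: field_simps)
  define d where "d = det (gram (g q))"
  have d: "d > 0" unfolding d_def by (rule det_gram_pos[OF g_inner[OF q]])
  have "det (gram h) = inverse t ^ CARD('n) * (?dN\<^sup>2 * d)"
    unfolding h[abs_def] det_gram_scale gram_pullback[OF inner_formD(1)[OF g_inner[OF q]] JN(2)] det_mul d_def
    by (simp add: power2_eq_square)
  then have "det (gram h) powr (1 / real CARD('n)) =
      (inverse t ^ CARD('n)) powr (1 / real CARD('n)) * ((?dN\<^sup>2) powr (1 / real CARD('n)) * d powr (1 / real CARD('n)))"
    using t d by (simp add: powr_mult)
  also have "(inverse t ^ CARD('n)) powr (1 / real CARD('n)) = inverse t"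
    using t by (simp add: powr_powr flip: powr_realpow)
  also have "(?dN\<^sup>2) powr (1 / real CARD('n)) = ?dN powr (2 / real CARD('n))"
    by (simp add: abs_powr_eq power2_eq_square)
  finally have dh: "det (gram h) powr (1 / real CARD('n)) = inverse t * (?dN powr (2 / real CARD('n)) * d powr (1 / real CARD('n)))" .
  have "chart_form N cN \<psi> q u w = ?dN powr (2 / real CARD('n)) * (h (?IN u) (?IN w) / det (gram h) powr (1 / real CARD('n)))"
    unfolding chart_form_eq induced_conf_def Let_def h_def ..
  also have "\<dots> = g q u w / d powr (1 / real CARD('n))"
    unfolding dh h JN(4) using t det_J_pos(2)[OF q] d by (simp add: field_simps)
  finally show ?thesis
    using d by (simp add: scl_def d_def[symmetric] powr_minus divide_inverse)
qed

lemma conf_N: "conf_chart N cN \<psi> V"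
  unfolding conf_chart_def
proof (intro conjI ballI allI)
  show "inner_form (chart_form N cN \<psi> q)" if "q \<in> V" for q
    unfolding chart_form_N[OF that, abs_def] by (rule inner_form_scale[OF g_inner[OF that] scl_pos[OF that]])
  show "smooth_in \<psi> V (\<lambda>q. chart_form N cN \<psi> q u w)" for u w
    by (rule smooth_in_cong[OF coV _ smooth_in_mult[OF coV smooth_scl smooth_g[of u w]]])
      (simp add: chart_form_N)
qed

sublocale NN: weyl_at N cN \<psi> V p
  by unfold_locales (use N \<psi> V conf_N in auto)

text \<open>Holding on all of \<open>V\<close>, this equation can be differentiated, which is the
  input to \<open>unimodular_trace\<close>.\<close>

lemma det_gram_N: "q \<in> V \<Longrightarrow> det (gram (chart_form N cN \<psi> q)) = 1"
proof -
  assume q: "q \<in> V"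
  have d: "det (gram (g q)) > 0" by (rule det_gram_pos[OF g_inner[OF q]])
  have "scl q ^ CARD('n) = inverse (det (gram (g q)))"
  proof -
    have "scl q ^ CARD('n) = (det (gram (g q)) powr (- 1 / real CARD('n))) powr real CARD('n)"
      using d by (simp add: scl_def powr_realpow)
    also have "\<dots> = det (gram (g q)) powr (- 1)" unfolding powr_powr by simp
    finally show ?thesis using d by (simp add: powr_minus)
  qed
  then show ?thesis
    unfolding chart_form_N[OF q, abs_def] det_gram_scale using d by simp
qed

lemma iota_p: "incl_d M N p = \<iota> p"
  by (simp add: incl_d_def \<phi> \<psi>)

text \<open>\<open>along_conn\<close> at \<open>q\<close> expands a field in the frame of the
  preferred ambient chart at \<open>q\<close>. In the fixed chart the second derivatives of the
  ambient transition cancel between the derivative of the components and the derivative of the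
  frame.\<close>

lemma along_conn_chart:
  assumes G: "conn_chart M D \<phi> (fst \<phi>) G" and q: "q \<in> V"
    and A: "\<And>r. r \<in> V \<Longrightarrow> vec_comp M \<phi> W r = A r" "has_dchart \<psi> A A' q"
  shows "jac (chart_at M q) \<phi> q (along_conn M N D q x W) =
    A' (jac (chart_at N q) \<psi> q x) + G q (\<iota> q (jac (chart_at N q) \<psi> q x)) (A q)"
proof -
  define \<theta> where "\<theta> = chart_at M q"
  note m = mem_V[OF q]
  have th: "\<theta> \<in> atlas M" "q \<in> fst \<theta>" using m by (simp_all add: \<theta>_def)
  let ?J = "jac \<theta> \<phi> q" and ?I = "jac \<phi> \<theta> q" and ?JN = "jac (chart_at N q) \<psi> q"
  note J = atlas_jac[OF M th(1) phiM th(2) m(2)] and I = atlas_jac[OF M phiM th(1) m(2) th(2)]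
  define y where "y = \<iota> q (?JN x)"
  define B where "B = V \<inter> fst \<theta>"
  have B: "openin (mtop N) B" "B \<subseteq> fst \<psi>" "B \<subseteq> fst \<phi>" "B \<subseteq> fst \<theta>" "q \<in> B" "B \<subseteq> V"
    using openin_N[OF V(1) atlas_openin[OF M th(1)]] V q th by (auto simp: B_def)
  have coB: "chart_open \<psi> B" by (rule atlas_chart_open[OF N psiN B(1,2)])
  have TB: "trans_on \<psi> \<phi> B" by (rule sub_trans[OF psiN phiM B(1-3)])
  let ?F = "fst \<phi> \<inter> fst \<theta>"
  have F: "openin (mtop M) ?F" using atlas_openin[OF M phiM] atlas_openin[OF M th(1)] by blast
  have TF: "trans_on \<phi> \<theta> ?F" by (rule atlas_trans_on[OF M phiM th(1) F]) auto
  have hL: "has_dchart \<psi> (\<lambda>r. jac \<phi> \<theta> r a) (\<lambda>w. dchart \<phi> (\<lambda>r. jac \<phi> \<theta> r a) q (\<iota> q w)) q" for a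
    unfolding jac_eq_dchart[of \<psi>]
    by (rule has_dchart_trans[OF TB B(5)], rule smooth_in_has_dchart[OF smooth_in_jac[OF TF]]) (use m th in auto)
  have lin: "linear (jac \<phi> \<theta> r)" if "r \<in> B" for r
    by (rule atlas_jac(1)[OF M phiM th(1)]) (use that B in auto)
  have "has_dchart \<psi> (\<lambda>r. jac \<phi> \<theta> r (A r)) (\<lambda>w. ?I (A' w) + dchart \<phi> (\<lambda>r. jac \<phi> \<theta> r (A q)) q (\<iota> q w)) q"
    by (rule has_dchart_linear_apply(1)[OF coB B(5) hL lin A(2)])
  moreover have "vec_comp M \<theta> W r = jac \<phi> \<theta> r (A r)" if "r \<in> B" for r
  proof -
    have "r \<in> fst \<phi>" "r \<in> fst \<theta>" "r \<in> V" using that B by auto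
    then show ?thesis using vec_comp_trans[OF M phiM th(1), of r W] A(1)[of r] by simp
  qed
  ultimately have "has_dchart \<psi> (vec_comp M \<theta> W) (\<lambda>w. ?I (A' w) + dchart \<phi> (\<lambda>r. jac \<phi> \<theta> r (A q)) q (\<iota> q w)) q"
    by (subst has_dchart_cong[OF coB B(5)]) auto
  from dchart_chart_at(1)[OF N psiN B(1,5,2) this] has_dchartD[OF this]
  have 1: "dir_deriv N q x (vec_comp M \<theta> W) = ?I (A' (?JN x)) + dchart \<phi> (\<lambda>r. jac \<phi> \<theta> r (A q)) q y"
    by (simp add: dir_deriv_eq_dchart y_def)
  have Aq: "A q = ?J (W q)" using A(1)[OF q] by (simp add: vec_comp_def \<theta>_def)
  \<comment> \<open>Rewritten by the inverse-Jacobian identity so that it becomes the negative of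
    the inhomogeneous term in the next fact.\<close>
  have 2: "?J (dchart \<phi> (\<lambda>r. jac \<phi> \<theta> r (A q)) q y) = - dchart \<phi> (\<lambda>r. jac \<theta> \<phi> r (W q)) q y"
    unfolding Aq dchart_jac_inverse[OF M phiM th(1) m(2) th(2)] by (simp add: linear_neg[OF J(1)] I(2))
  have 3: "?J (D q (incl_d M N q x) (vec_ext M q (W q))) = dchart \<phi> (\<lambda>r. jac \<theta> \<phi> r (W q)) q y + G q y (A q)"
  proof -
    have vc: "vec_comp M \<phi> (frame M \<theta> (W q)) r = jac \<theta> \<phi> r (W q)" if "r \<in> ?F" for r
      by (rule vec_comp_frame_other[OF M th(1) phiM]) (use that in auto)
    have "near M q (\<lambda>W'. smooth_vf M W' (frame M \<theta> (W q)))"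
      using nearI[OF atlas_openin[OF M th(1)] th(2), of "\<lambda>W'. smooth_vf M W' (frame M \<theta> (W q))"]
        smooth_vf_frame[OF M th(1) atlas_openin[OF M th(1)] subset_refl] by simp
    then have "?J (D q (incl_d M N q x) (frame M \<theta> (W q))) =
        dchart \<phi> (vec_comp M \<phi> (frame M \<theta> (W q))) q (?J (incl_d M N q x))
        + G q (?J (incl_d M N q x)) (vec_comp M \<phi> (frame M \<theta> (W q)) q)"
      using G m(2) unfolding conn_chart_def \<theta>_def by blast
    moreover have "dchart \<phi> (vec_comp M \<phi> (frame M \<theta> (W q))) q = dchart \<phi> (\<lambda>r. jac \<theta> \<phi> r (W q)) q"
      by (rule dchart_cong[OF trans_on_open[OF TF] _ vc]) (use m th in auto)
    moreover have "vec_comp M \<phi> (frame M \<theta> (W q)) q = A q"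
      using vc[of q] m th by (simp add: Aq)
    ultimately show ?thesis
      using incl_chart[OF q, of x] by (simp add: vec_ext_eq_frame \<theta>_def y_def)
  qed
  show ?thesis
    unfolding along_conn_def \<theta>_def[symmetric] 1 y_def[symmetric]
    by (simp add: linear_add[OF J(1)] 2 3 J(2) I(2))
qed

end

text \<open>The derivative of \<open>det K = 1\<close> is the trace of the compatibility condition.\<close>

lemma unimodular_trace:
  fixes K :: "'a \<Rightarrow> real^'n \<Rightarrow> real^'n \<Rightarrow> real"
  assumes co: "chart_open \<psi> V" and q: "q \<in> V" and K: "\<And>r. r \<in> V \<Longrightarrow> inner_form (K r)"
    and det1: "\<And>r. r \<in> V \<Longrightarrow> det (gram (K r)) = 1" and sm: "\<And>u w. smooth_in \<psi> V (\<lambda>r. K r u w)"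
    and B: "linear B" and d: "\<And>u w. dchart \<psi> (\<lambda>r. K r u w) q v = K q (B u) w + K q u (B w) - 2 * b * K q u w"
  shows "b = endo_trace B / real CARD('n)"
proof -
  note i = K[OF q]
  have "has_dchart \<psi> (\<lambda>r. gram (K r) $ r' $ s) (\<lambda>v. (\<chi> i j. dchart \<psi> (\<lambda>r. K r (axis i 1) (axis j 1)) q v) $ r' $ s) q" for r' s
    using smooth_in_has_dchart[OF sm q] by (simp add: gram_def)
  from has_dchart_det[OF co q this matrix_inv_left[OF gram_invertible[OF i]]]
  have "has_dchart \<psi> (\<lambda>r. det (gram (K r))) (\<lambda>v. trace (matrix_inv (gram (K q)) **
      (\<chi> i j. dchart \<psi> (\<lambda>r. K r (axis i 1) (axis j 1)) q v))) q"
    by (simp add: det1[OF q])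
  moreover have "has_dchart \<psi> (\<lambda>r. det (gram (K r))) (\<lambda>v. 0) q"
    by (subst has_dchart_cong[OF co q, where g = "\<lambda>_. 1"]) (simp_all add: det1 has_dchart_const)
  ultimately have "trace (matrix_inv (gram (K q)) ** (\<chi> i j. dchart \<psi> (\<lambda>r. K r (axis i 1) (axis j 1)) q v)) = 0"
    by (metis (no_types, lifting) has_dchartD)
  moreover have "(\<chi> i j. dchart \<psi> (\<lambda>r. K r (axis i 1) (axis j 1)) q v) =
      gram (\<lambda>u w. K q (B u) w + K q u (B w) - 2 * b * K q u w)"
    unfolding d gram_def ..
  ultimately have "0 = tr_c (K q) (\<lambda>u w. K q (B u) w + K q u (B w) - 2 * b * K q u w)"
    by (simp add: tr_c_def)
  also have "\<dots> = endo_trace B + tr_c (K q) (\<lambda>u w. K q u (B w)) - 2 * b * real CARD('n)"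
    unfolding tr_c_diff tr_c_add tr_c_scale tr_c_self[OF i] by (simp add: tr_c_eq_endo_trace[OF i B])
  also have "tr_c (K q) (\<lambda>u w. K q u (B w)) = tr_c (K q) (\<lambda>u w. K q (B u) w)"
  proof -
    have "bilinear (\<lambda>u w. K q (B u) w)"
      by (rule bilinearI) (simp_all add: inner_form_simps[OF i] linear_add[OF B] linear_cmul[OF B])
    from tr_c_transpose[OF i this] show ?thesis by (simp add: inner_formD(2)[OF i, of _ "B _"])
  qed
  also have "\<dots> = endo_trace B" by (rule tr_c_eq_endo_trace[OF i B refl])
  finally show ?thesis by (simp add: field_simps)
qed

section \<open>Gauss splitting: induced connection and its Faraday form\<close>

context submanifold_at
begin

text \<open>The ambient derivative of the pushed-forward constant frame of \<open>\<psi>\<close>. By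
  the Gauss formula its tangential part is the induced connection and its normal part is the
  fundamental form.\<close>

definition "second G q u v = dchart \<psi> (\<lambda>r. \<iota> r v) q u + G q (\<iota> q u) (\<iota> q v)"
definition "christ_N G q u v = Tan q (second G q u v)"
definition "nor w = w - \<iota> p (Tan p w)"

lemma dchart_iota_sym: "q \<in> V \<Longrightarrow> dchart \<psi> (\<lambda>r. \<iota> r v) q u = dchart \<psi> (\<lambda>r. \<iota> r u) q v"
  unfolding jac_eq_dchart using T by (intro dchart_symmetric[OF coV]) (auto simp: trans_on_def)

lemma linear_dchart_iota:
  assumes "q \<in> V"
  shows "linear (dchart \<psi> (\<lambda>r. \<iota> r v) q)" "linear (\<lambda>v. dchart \<psi> (\<lambda>r. \<iota> r v) q u)"
  by (rule linear_dchart[OF smooth_iota assms]) (rule linear_dchart_family[OF coV assms smooth_iota linear_iota])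

lemma bilinear_second:
  assumes "conn_chart M D \<phi> (fst \<phi>) G" "q \<in> V"
  shows "bilinear (second G q)"
proof -
  have G: "bilinear (G q)" using MM.bilinear_G[OF assms(1)] mem_V(2)[OF assms(2)] .
  note l = linear_dchart_iota[OF assms(2)] linear_iota[OF assms(2)]
  show ?thesis
    unfolding second_def
    by (rule bilinearI)
      (simp_all add: linear_add[OF l(1)] linear_cmul[OF l(1)] linear_add[OF l(2)] linear_cmul[OF l(2)]
        linear_add[OF l(3)] linear_cmul[OF l(3)] bilinear_simps[OF G] algebra_simps)
qed

lemma smooth_second:
  assumes G: "conn_chart M D \<phi> (fst \<phi>) G"
  shows "smooth_in \<psi> V (\<lambda>q. second G q u v)"
  unfolding second_def
proof (rule smooth_in_add[OF coV smooth_in_dchart[OF coV smooth_iota]])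
  show "smooth_in \<psi> V (\<lambda>q. G q (\<iota> q u) (\<iota> q v))"
    by (rule smooth_in_bilinear_apply[OF coV smooth_restrict[OF MM.smooth_G[OF G]]
          MM.bilinear_G[OF G] smooth_iota smooth_iota]) (rule mem_V(2))
qed

text \<open>The product rule for the pushed-forward field gives a tangential term, recovered exactly
  by \<open>Tan\<close>, and the term \<open>second\<close>.\<close>

lemma conn_chart_N:
  assumes G: "conn_chart M D \<phi> (fst \<phi>) G"
  shows "conn_chart N (induced_conn M c N D) \<psi> V (christ_N G)"
  unfolding conn_chart_def
proof (intro conjI ballI allI impI)
  show "smooth_in \<psi> V (\<lambda>q. christ_N G q u v)" for u v
    unfolding christ_N_def by (rule smooth_in_linear_apply[OF coV smooth_Tan linear_Tan smooth_second[OF G]])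
  fix q assume q: "q \<in> V"
  note b = bilinear_second[OF G q]
  show "bilinear (christ_N G q)"
    unfolding christ_N_def
    by (rule bilinearI) (simp_all add: bilinear_simps[OF b] linear_add[OF linear_Tan[OF q]] linear_cmul[OF linear_Tan[OF q]])
  fix Y x assume "near N q (\<lambda>W. smooth_vf N W Y)"
  then obtain W where W: "openin (mtop N) W" "q \<in> W" "smooth_vf N W Y" by (auto simp: near_def)
  have WV: "openin (mtop N) (W \<inter> V)" "W \<inter> V \<subseteq> fst \<psi>" "q \<in> W \<inter> V" using W V q by auto
  have "smooth_vf N (W \<inter> V) Y" by (rule smooth_vf_subset[OF W(3)]) simp
  then have "smooth_in \<psi> (W \<inter> V) (vec_comp N \<psi> Y)" unfolding smooth_vf_iff[OF N psiN WV(1,2)] .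
  then have hY: "has_dchart \<psi> (vec_comp N \<psi> Y) (dchart \<psi> (vec_comp N \<psi> Y) q) q"
    by (rule smooth_in_has_dchart[OF _ WV(3)])
  let ?JN = "jac (chart_at N q) \<psi> q"
  have "jac (chart_at M q) \<phi> q (along_conn M N D q x (\<lambda>r. incl_d M N r (Y r))) =
     (\<iota> q (dchart \<psi> (vec_comp N \<psi> Y) q (?JN x)) + dchart \<psi> (\<lambda>r. \<iota> r (vec_comp N \<psi> Y q)) q (?JN x))
     + G q (\<iota> q (?JN x)) (\<iota> q (vec_comp N \<psi> Y q))"
  proof (rule along_conn_chart[OF G q])
    show "vec_comp M \<phi> (\<lambda>r. incl_d M N r (Y r)) r = \<iota> r (vec_comp N \<psi> Y r)" if "r \<in> V" for r
      using incl_chart[OF that] by (simp add: vec_comp_def)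
    show "has_dchart \<psi> (\<lambda>r. \<iota> r (vec_comp N \<psi> Y r))
        (\<lambda>v. \<iota> q (dchart \<psi> (vec_comp N \<psi> Y) q v) + dchart \<psi> (\<lambda>r. \<iota> r (vec_comp N \<psi> Y q)) q v) q"
      by (rule has_dchart_linear_apply(1)[OF coV q smooth_in_has_dchart[OF smooth_iota q] linear_iota hY])
  qed
  then show "?JN (induced_conn M c N D q x Y) =
      dchart \<psi> (vec_comp N \<psi> Y) q (?JN x) + christ_N G q (?JN x) (vec_comp N \<psi> Y q)"
    unfolding induced_conn_def tan_part_chart[OF q]
    by (simp add: christ_N_def second_def linear_add[OF linear_Tan[OF q]] Tan_iota[OF q] add.assoc)
qed

text \<open>Paired with tangent vectors, \<open>second\<close> contributes only through its
  tangential part. The weight term is still the ambient connection form, because \<open>g\<close>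
  has not been normalized.\<close>

lemma dchart_g:
  assumes w: "weyl_chart M c D \<phi> (fst \<phi>) G" and q: "q \<in> V"
  shows "dchart \<psi> (\<lambda>r. g r u w) q v =
    g q (christ_N G q v u) w + g q u (christ_N G q v w) - 2 * conn_tr G q (\<iota> q v) * g q u w"
proof -
  note i = C_inner[OF q]
  have hC: "has_dchart \<psi> (\<lambda>r. C r a b) (\<lambda>v. dchart \<phi> (\<lambda>r. C r a b) q (\<iota> q v)) q" for a b
    by (rule has_dchart_restrict[OF MM.C_smooth q])
  have hi: "has_dchart \<psi> (\<lambda>r. \<iota> r u) (dchart \<psi> (\<lambda>r. \<iota> r u) q) q" for u
    by (rule smooth_in_has_dchart[OF smooth_iota q])
  have h1: "has_dchart \<psi> (\<lambda>r. C r (\<iota> r u) b) (\<lambda>v. C q (dchart \<psi> (\<lambda>r. \<iota> r u) q v) b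
      + dchart \<phi> (\<lambda>r. C r (\<iota> q u) b) q (\<iota> q v)) q" for b
    by (rule has_dchart_linear_apply(1)[OF coV q hC inner_formD(5)[OF C_inner] hi])
  have "has_dchart \<psi> (\<lambda>r. C r (\<iota> r u) (\<iota> r w)) (\<lambda>v. C q (\<iota> q u) (dchart \<psi> (\<lambda>r. \<iota> r w) q v)
      + (C q (dchart \<psi> (\<lambda>r. \<iota> r u) q v) (\<iota> q w) + dchart \<phi> (\<lambda>r. C r (\<iota> q u) (\<iota> q w)) q (\<iota> q v))) q"
    by (rule has_dchart_linear_apply(1)[OF coV q h1 inner_formD(4)[OF C_inner] hi])
  from has_dchartD[OF this]
  have "dchart \<psi> (\<lambda>r. g r u w) q v = C q (\<iota> q u) (second G q v w) + C q (second G q v u) (\<iota> q w)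
      - 2 * conn_tr G q (\<iota> q v) * g q u w"
    unfolding g_def MM.weyl_chartD(3)[OF w mem_V(2)[OF q]] second_def
    by (simp add: inner_form_simps[OF i])
  also have "C q (\<iota> q u) (second G q v w) = g q u (christ_N G q v w)"
    unfolding christ_N_def inner_formD(2)[OF g_inner[OF q], of u] g_Tan[OF q] by (rule inner_formD(2)[OF i])
  also have "C q (second G q v u) (\<iota> q w) = g q (christ_N G q v u) w"
    unfolding christ_N_def g_Tan[OF q] ..
  finally show ?thesis by simp
qed

text \<open>Normalizing \<open>g\<close> by \<open>scl\<close> shifts the scalar in the
  compatibility condition by half the logarithmic derivative of \<open>scl\<close>. The constant
  determinant forces this scalar to be the trace of the induced connection divided by n, so both
  claims follow together.\<close>

lemma
  assumes w: "weyl_chart M c D \<phi> (fst \<phi>) G"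
  shows conn_tr_N: "q \<in> V \<Longrightarrow> conn_tr (christ_N G) q v = conn_tr G q (\<iota> q v) - dchart \<psi> scl q v * (inverse (scl q) / 2)"
    and weyl_chart_N: "weyl_chart N cN (induced_conn M c N D) \<psi> V (christ_N G)"
proof -
  note cN = conn_chart_N[OF MM.weyl_chartD(1)[OF w]]
  have d: "dchart \<psi> (\<lambda>r. chart_form N cN \<psi> r u x) q v =
      chart_form N cN \<psi> q (christ_N G q v u) x + chart_form N cN \<psi> q u (christ_N G q v x)
      - 2 * (conn_tr G q (\<iota> q v) - dchart \<psi> scl q v * (inverse (scl q) / 2)) * chart_form N cN \<psi> q u x"
    if q: "q \<in> V" for q u v x
  proof -
    have "has_dchart \<psi> (\<lambda>r. scl r * g r u x) (\<lambda>v. scl q * dchart \<psi> (\<lambda>r. g r u x) q v + dchart \<psi> scl q v * g q u x) q"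
      by (rule has_dchart_mult[OF coV q smooth_in_has_dchart[OF smooth_scl q] smooth_in_has_dchart[OF smooth_g q]])
    moreover have "dchart \<psi> (\<lambda>r. chart_form N cN \<psi> r u x) q = dchart \<psi> (\<lambda>r. scl r * g r u x) q"
      by (rule dchart_cong[OF coV q chart_form_N])
    ultimately have e: "dchart \<psi> (\<lambda>r. chart_form N cN \<psi> r u x) q v = scl q * dchart \<psi> (\<lambda>r. g r u x) q v + dchart \<psi> scl q v * g q u x"
      by (simp add: has_dchartD)
    show ?thesis
      unfolding e dchart_g[OF w q] chart_form_N[OF q] using scl_pos[OF q] by (simp add: field_simps)
  qed
  have tr: "conn_tr (christ_N G) q v = conn_tr G q (\<iota> q v) - dchart \<psi> scl q v * (inverse (scl q) / 2)" if q: "q \<in> V" for q v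
    unfolding conn_tr_def[of "christ_N G"]
  proof (rule unimodular_trace[where K = "chart_form N cN \<psi>", OF coV q NN.C_inner det_gram_N NN.C_smooth _ d[OF q], symmetric])
    show "linear (christ_N G q v)" using NN.bilinear_G[OF cN q] by (simp add: bilinear_def)
  qed
  then show "q \<in> V \<Longrightarrow> conn_tr (christ_N G) q v = conn_tr G q (\<iota> q v) - dchart \<psi> scl q v * (inverse (scl q) / 2)" .
  show "weyl_chart N cN (induced_conn M c N D) \<psi> V (christ_N G)"
    unfolding weyl_chart_def
  proof (intro conjI ballI allI cN)
    show "christ_N G q u v = christ_N G q v u" if q: "q \<in> V" for q u v
      unfolding christ_N_def second_def
      using dchart_iota_sym[OF q, of u v] MM.weyl_chartD(2)[OF w mem_V(2)[OF q], of "\<iota> q u" "\<iota> q v"] by simp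
  qed (simp add: d tr)
qed

text \<open>The bracket with factor 1/2 is the second derivative of the logarithm of
  \<open>scl\<close> in the chart. Its symmetry removes it from the Faraday form.\<close>

lemma dchart_conn_tr_N:
  assumes w: "weyl_chart M c D \<phi> (fst \<phi>) G"
  shows "dchart \<psi> (\<lambda>q. conn_tr (christ_N G) q v) p u =
    conn_tr G p (dchart \<psi> (\<lambda>r. \<iota> r v) p u) + dchart \<phi> (\<lambda>q. conn_tr G q (\<iota> p v)) p (\<iota> p u)
    - 1 / 2 * (dchart \<psi> (\<lambda>q. dchart \<psi> scl q v) p u * inverse (scl p)
       - dchart \<psi> scl p v * dchart \<psi> scl p u * (inverse (scl p))\<^sup>2)"
proof -
  note p = V(4)
  note G = MM.weyl_chartD(1)[OF w]
  let ?i = "\<lambda>q. inverse (scl q)"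
  have si: "smooth_in \<psi> V ?i"
    using smooth_in_inverse[OF coV smooth_scl] scl_pos by (simp add: less_imp_neq[symmetric])
  note hs = smooth_in_has_dchart[OF smooth_scl p] and hi = smooth_in_has_dchart[OF si p]
  have "has_dchart \<psi> (\<lambda>q. scl q * ?i q) (\<lambda>u. scl p * dchart \<psi> ?i p u + dchart \<psi> scl p u * ?i p) p"
    by (rule has_dchart_mult[OF coV p hs hi])
  moreover have "has_dchart \<psi> (\<lambda>q. scl q * ?i q) (\<lambda>_. 0) p"
    by (subst has_dchart_cong[OF coV p, where g = "\<lambda>_. 1"]) (use scl_pos in \<open>auto simp: has_dchart_const less_imp_neq[symmetric]\<close>)
  ultimately have "scl p * dchart \<psi> ?i p u + dchart \<psi> scl p u * ?i p = 0"
    by (metis (no_types, lifting) has_dchartD)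
  then have di: "dchart \<psi> ?i p u = - dchart \<psi> scl p u * (?i p)\<^sup>2"
    using scl_pos[OF p] by (simp add: field_simps power2_eq_square eq_neg_iff_add_eq_0)
  have "has_dchart \<psi> (\<lambda>q. dchart \<psi> scl q v * ?i q) (\<lambda>u. dchart \<psi> scl p v * dchart \<psi> ?i p u
      + dchart \<psi> (\<lambda>q. dchart \<psi> scl q v) p u * ?i p) p"
    by (rule has_dchart_mult[OF coV p smooth_in_has_dchart[OF smooth_in_dchart[OF coV smooth_scl] p] hi])
  then have 1: "has_dchart \<psi> (\<lambda>q. 1 / 2 * (dchart \<psi> scl q v * ?i q)) (\<lambda>u. 1 / 2 * (dchart \<psi> scl p v * dchart \<psi> ?i p u
      + dchart \<psi> (\<lambda>q. dchart \<psi> scl q v) p u * ?i p)) p"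
    by (rule has_dchart_linear_image[OF linear_times])
  have 2: "has_dchart \<psi> (\<lambda>q. conn_tr G q (\<iota> q v)) (\<lambda>u. conn_tr G p (dchart \<psi> (\<lambda>r. \<iota> r v) p u)
      + dchart \<phi> (\<lambda>q. conn_tr G q (\<iota> p v)) p (\<iota> p u)) p"
    by (rule has_dchart_linear_apply(1)[OF coV p has_dchart_restrict[OF MM.smooth_conn_tr[OF G] p]
          MM.linear_conn_tr[OF G] smooth_in_has_dchart[OF smooth_iota p]]) (rule mem_V(2))
  have "dchart \<psi> (\<lambda>q. conn_tr (christ_N G) q v) p = dchart \<psi> (\<lambda>q. conn_tr G q (\<iota> q v) - 1 / 2 * (dchart \<psi> scl q v * ?i q)) p"
    by (rule dchart_cong[OF coV p]) (simp add: conn_tr_N[OF w])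
  from fun_cong[OF this[unfolded has_dchartD[OF has_dchart_diff[OF 2 1]]], of u] show ?thesis
    by (simp add: di algebra_simps)
qed

lemma faraday_N:
  assumes w: "weyl_chart M c D \<phi> (fst \<phi>) G"
  shows "faraday N (induced_conn M c N D) p u v = faraday M D p (\<iota> p u) (\<iota> p v)"
  unfolding NN.faraday_chart[OF conn_chart_N[OF MM.weyl_chartD(1)[OF w]]] MM.faraday_chart[OF MM.weyl_chartD(1)[OF w]]
    dchart_conn_tr_N[OF w]
  using dchart_iota_sym[OF V(4), of u v] dchart_symmetric[OF coV smooth_scl V(4), of u v]
  by (simp add: algebra_simps)

section \<open>Fundamental form and mean curvature at the point\<close>

lemma tan_part_p: "tan_part M c N p w = Tan p w"
  using tan_part_chart[OF V(4)] by (simp add: MM.jac_p NN.jac_p)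

lemma nor_part_p: "nor_part M c N p w = nor w"
  by (simp add: nor_part_def tan_part_p iota_p nor_def)

lemma linear_nor: "linear nor"
  unfolding nor_def
  by (intro linear_compose_sub linear_ident linear_compose[OF linear_Tan[OF V(4)] linear_iota[OF V(4)], unfolded comp_def])

lemma nor_iota: "nor (\<iota> p x) = 0"
  by (simp add: nor_def Tan_iota[OF V(4)])

lemma inner_c: "inner_form (c p)"
  by (rule MM.inner_form_p)

lemma normal_iff: "\<xi> \<in> normal_space M c N p \<longleftrightarrow> Tan p \<xi> = 0"
proof
  assume "\<xi> \<in> normal_space M c N p"
  then show "Tan p \<xi> = 0"
    by (intro Tan_unique[OF V(4)]) (simp add: normal_space_def iota_p MM.chart_form_p inner_form_simps[OF g_inner[OF V(4)]])
next
  assume "Tan p \<xi> = 0"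
  then show "\<xi> \<in> normal_space M c N p"
    using g_Tan[OF V(4), of \<xi>] by (simp add: normal_space_def iota_p MM.chart_form_p inner_form_simps[OF g_inner[OF V(4)]])
qed

lemma Tan_nor: "Tan p (nor w) = 0"
  by (simp add: nor_def linear_diff[OF linear_Tan[OF V(4)]] Tan_iota[OF V(4)])

lemma c_normal: "Tan p \<xi> = 0 \<Longrightarrow> c p \<xi> (\<iota> p x) = 0" "Tan p \<xi> = 0 \<Longrightarrow> c p (\<iota> p x) \<xi> = 0"
  using g_Tan[OF V(4), of \<xi> x] inner_formD(2)[OF inner_c, of \<xi> "\<iota> p x"]
  by (simp_all add: MM.chart_form_p inner_form_simps[OF g_inner[OF V(4)]])

lemma fund_form_chart:
  assumes G: "conn_chart M D \<phi> (fst \<phi>) G"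
  shows "fund_form M c N D p x y = nor (second G p x y)"
proof -
  have "jac (chart_at M p) \<phi> p (along_conn M N D p x (\<lambda>q. incl_d M N q (vec_ext N p y q))) =
      dchart \<psi> (\<lambda>r. \<iota> r y) p (jac (chart_at N p) \<psi> p x) + G p (\<iota> p (jac (chart_at N p) \<psi> p x)) (\<iota> p y)"
  proof (rule along_conn_chart[OF G V(4)])
    show "vec_comp M \<phi> (\<lambda>q. incl_d M N q (vec_ext N p y q)) r = \<iota> r y" if "r \<in> V" for r
      using incl_chart[OF that, of "vec_ext N p y r"] atlas_jac_at(4)[OF N psiN mem_V(1)[OF that], of y]
      by (simp add: vec_comp_def NN.vec_ext_p frame_def)
    show "has_dchart \<psi> (\<lambda>r. \<iota> r y) (dchart \<psi> (\<lambda>r. \<iota> r y) p) p"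
      by (rule smooth_in_has_dchart[OF smooth_iota V(4)])
  qed
  then show ?thesis
    by (simp add: fund_form_def nor_part_p MM.jac_p NN.jac_p second_def)
qed

text \<open>A normal vector is extended by projecting the constant field. The derivative of this
  projection involves the metric alone, so a change of Weyl structure affects only the term with
  \<open>G\<close>.\<close>

lemma mean_curv_chart:
  assumes G: "conn_chart M D \<phi> (fst \<phi>) G"
  shows "mean_curv M c N D p \<xi> = - (1 / real CARD('n)) * endo_trace (\<lambda>x. Tan p
    (dchart \<psi> (\<lambda>r. \<xi> - \<iota> r (Tan r \<xi>)) p x + G p (\<iota> p x) (nor \<xi>)))"
proof -
  have "jac (chart_at M p) \<phi> p (along_conn M N D p x (\<lambda>q. nor_part M c N q (vec_ext M p \<xi> q))) =
      dchart \<psi> (\<lambda>r. \<xi> - \<iota> r (Tan r \<xi>)) p (jac (chart_at N p) \<psi> p x)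
      + G p (\<iota> p (jac (chart_at N p) \<psi> p x)) (\<xi> - \<iota> p (Tan p \<xi>))" for x
  proof (rule along_conn_chart[OF G V(4)])
    show "vec_comp M \<phi> (\<lambda>q. nor_part M c N q (vec_ext M p \<xi> q)) r = \<xi> - \<iota> r (Tan r \<xi>)" if "r \<in> V" for r
      using tan_part_chart[OF that, of "vec_ext M p \<xi> r"] incl_chart[OF that]
        atlas_jac_at(4)[OF M phiM mem_V(2)[OF that], of \<xi>] linear_diff[OF atlas_jac_at(2)[OF M phiM mem_V(2)[OF that]]]
      by (simp add: vec_comp_def nor_part_def MM.vec_ext_p frame_def)
    show "has_dchart \<psi> (\<lambda>r. \<xi> - \<iota> r (Tan r \<xi>)) (dchart \<psi> (\<lambda>r. \<xi> - \<iota> r (Tan r \<xi>)) p) p"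
      by (rule smooth_in_has_dchart[OF smooth_in_minus[OF coV smooth_in_const
            smooth_in_linear_apply[OF coV smooth_iota linear_iota smooth_Tan]] V(4)])
  qed
  then show ?thesis
    by (simp add: mean_curv_def tan_part_p MM.jac_p NN.jac_p nor_def)
qed

lemma linear_mean_curv:
  assumes G: "conn_chart M D \<phi> (fst \<phi>) G"
  shows "linear (mean_curv M c N D p)"
proof -
  have 1: "linear (\<lambda>\<xi>. dchart \<psi> (\<lambda>r. \<xi> - \<iota> r (Tan r \<xi>)) p x)" for x
  proof (rule linear_dchart_family[OF coV V(4)])
    show "smooth_in \<psi> V (\<lambda>r. \<xi> - \<iota> r (Tan r \<xi>))" for \<xi>
      by (rule smooth_in_minus[OF coV smooth_in_const smooth_in_linear_apply[OF coV smooth_iota linear_iota smooth_Tan]])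
    show "linear (\<lambda>\<xi>. \<xi> - \<iota> r (Tan r \<xi>))" if "r \<in> V" for r
      by (intro linear_compose_sub linear_ident linear_compose[OF linear_Tan[OF that] linear_iota[OF that], unfolded comp_def])
  qed
  note b = MM.bilinear_G[OF G mem_V(2)[OF V(4)]] and lT = linear_Tan[OF V(4)]
  show ?thesis
    unfolding mean_curv_chart[OF G] endo_trace_eq_sum
    by (rule linearI)
      (simp_all add: linear_add[OF 1] linear_cmul[OF 1] linear_add[OF linear_nor] linear_cmul[OF linear_nor]
        bilinear_simps[OF b] linear_add[OF lT] linear_cmul[OF lT] sum.distrib sum_distrib_left algebra_simps)
qed

text \<open>The functional is extended by zero to tangent vectors through \<open>nor\<close> and
  then dualized in the whole tangent space of \<open>M\<close>. The resulting vector is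
  automatically normal; positivity on normal vectors gives uniqueness.\<close>

lemma mean_curv_vec:
  assumes G: "conn_chart M D \<phi> (fst \<phi>) G"
  shows "Tan p (mean_curv_vec M c N D p) = 0"
    "Tan p \<xi> = 0 \<Longrightarrow> c p (mean_curv_vec M c N D p) \<xi> = mean_curv M c N D p \<xi>"
    "\<lbrakk>Tan p \<eta> = 0; \<And>\<xi>. Tan p \<xi> = 0 \<Longrightarrow> c p \<eta> \<xi> = mean_curv M c N D p \<xi>\<rbrakk> \<Longrightarrow> mean_curv_vec M c N D p = \<eta>"
proof -
  let ?h = "mean_curv M c N D p"
  have l: "linear (\<lambda>w. ?h (nor w))"
    using linear_compose[OF linear_nor linear_mean_curv[OF G]] by (simp add: comp_def)
  define e where "e = sharp (c p) (\<lambda>w. ?h (nor w))"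
  have ce: "c p e w = ?h (nor w)" for w unfolding e_def by (rule sharp[OF inner_c l])
  have e1: "Tan p e = 0"
    by (rule Tan_unique[OF V(4)])
      (simp add: MM.chart_form_p ce nor_iota linear_0[OF linear_mean_curv[OF G]] inner_form_simps[OF g_inner[OF V(4)]])
  have e2: "c p e \<xi> = ?h \<xi>" if "Tan p \<xi> = 0" for \<xi>
    using that by (simp add: ce nor_def linear_0[OF linear_iota[OF V(4)]])
  have u: "\<eta> = e" if "Tan p \<eta> = 0" "\<And>\<xi>. Tan p \<xi> = 0 \<Longrightarrow> c p \<eta> \<xi> = ?h \<xi>" for \<eta>
  proof (rule ccontr)
    assume "\<eta> \<noteq> e"
    then have "c p (\<eta> - e) (\<eta> - e) > 0" using inner_formD(3)[OF inner_c] by simp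
    moreover have "Tan p (\<eta> - e) = 0" using that(1) e1 by (simp add: linear_diff[OF linear_Tan[OF V(4)]])
    ultimately show False using that(2) e2 by (simp add: inner_form_simps(3)[OF inner_c])
  qed
  have "mean_curv_vec M c N D p = e"
    unfolding mean_curv_vec_def normal_iff Ball_def
  proof (rule the_equality)
    show "Tan p e = 0 \<and> (\<forall>\<xi>. Tan p \<xi> = 0 \<longrightarrow> c p e \<xi> = ?h \<xi>)" using e1 e2 by simp
    show "\<eta> = e" if "Tan p \<eta> = 0 \<and> (\<forall>\<xi>. Tan p \<xi> = 0 \<longrightarrow> c p \<eta> \<xi> = ?h \<xi>)" for \<eta>
      by (rule u) (use that in auto)
  qed
  then show "Tan p (mean_curv_vec M c N D p) = 0"
    "Tan p \<xi> = 0 \<Longrightarrow> c p (mean_curv_vec M c N D p) \<xi> = ?h \<xi>"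
    "\<lbrakk>Tan p \<eta> = 0; \<And>\<xi>. Tan p \<xi> = 0 \<Longrightarrow> c p \<eta> \<xi> = ?h \<xi>\<rbrakk> \<Longrightarrow> mean_curv_vec M c N D p = \<eta>"
    by (simp_all add: e1 e2 u[of \<eta>, symmetric])
qed

lemma fund_form0_chart:
  assumes G: "conn_chart M D \<phi> (fst \<phi>) G"
  shows "fund_form0 M c N D p x y = nor (second G p x y) - c p (\<iota> p x) (\<iota> p y) *\<^sub>R mean_curv_vec M c N D p"
  by (simp add: fund_form0_def fund_form_chart[OF G] iota_p)

lemma Tan_fund_form0:
  assumes G: "conn_chart M D \<phi> (fst \<phi>) G"
  shows "Tan p (fund_form0 M c N D p x y) = 0"
  by (simp add: fund_form0_chart[OF G] linear_diff[OF linear_Tan[OF V(4)]] linear_cmul[OF linear_Tan[OF V(4)]]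
      Tan_nor mean_curv_vec(1)[OF G])

section \<open>Effect of a change of Weyl structure on the extrinsic terms\<close>

context
  fixes D G D' G'
  assumes w: "weyl_chart M c D \<phi> (fst \<phi>) G" and w': "weyl_chart M c D' \<phi> (fst \<phi>) G'"
begin

abbreviation (input) "\<gamma> \<equiv> MM.\<gamma> G G' p"
abbreviation (input) "gs \<equiv> MM.gs G G'"

lemma conn: "conn_chart M D \<phi> (fst \<phi>) G" "conn_chart M D' \<phi> (fst \<phi>) G'"
  using MM.weyl_chartD(1)[OF w] MM.weyl_chartD(1)[OF w'] .

lemma lin_gamma: "linear \<gamma>"
  by (rule MM.linear_gamma[OF w w' p_phi])

lemma gamma_N: "q \<in> V \<Longrightarrow> NN.\<gamma> (christ_N G) (christ_N G') q v = MM.\<gamma> G G' q (\<iota> q v)"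
  by (simp add: NN.\<gamma>_def[OF weyl_chart_N[OF w] weyl_chart_N[OF w']] MM.\<gamma>_def[OF w w'] conn_tr_N[OF w] conn_tr_N[OF w'])

text \<open>By the chain rule the derivative of the restricted form contains \<open>\<gamma>\<close>
  applied to the whole of \<open>second\<close>; the connection term on \<open>N\<close> subtracts
  its tangential part.\<close>

lemma nab_N: "NN.nab (christ_N G) (christ_N G') u v = MM.nab G G' (\<iota> p u) (\<iota> p v) + \<gamma> (nor (second G p u v))"
proof -
  note p = V(4)
  note W = weyl_chart_N[OF w] weyl_chart_N[OF w']
  have "has_dchart \<psi> (\<lambda>q. MM.\<gamma> G G' q (\<iota> q v)) (\<lambda>u. \<gamma> (dchart \<psi> (\<lambda>r. \<iota> r v) p u)
      + dchart \<phi> (\<lambda>q. MM.\<gamma> G G' q (\<iota> p v)) p (\<iota> p u)) p"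
    by (rule has_dchart_linear_apply(1)[OF coV p has_dchart_restrict[OF MM.smooth_gamma[OF w w'] p]
          MM.linear_gamma[OF w w'] smooth_in_has_dchart[OF smooth_iota p]]) (rule mem_V(2))
  moreover have "dchart \<psi> (\<lambda>q. NN.\<gamma> (christ_N G) (christ_N G') q v) p = dchart \<psi> (\<lambda>q. MM.\<gamma> G G' q (\<iota> q v)) p"
    by (rule dchart_cong[OF coV p gamma_N])
  ultimately have "dchart \<psi> (\<lambda>q. NN.\<gamma> (christ_N G) (christ_N G') q v) p u =
      \<gamma> (dchart \<psi> (\<lambda>r. \<iota> r v) p u) + dchart \<phi> (\<lambda>q. MM.\<gamma> G G' q (\<iota> p v)) p (\<iota> p u)"
    by (simp add: has_dchartD)
  then show ?thesis
    unfolding NN.nab_def[OF W] MM.nab_def[OF w w'] gamma_N[OF p] christ_N_def nor_def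
    by (simp add: second_def linear_add[OF lin_gamma] linear_diff[OF lin_gamma] linear_add[OF linear_iota[OF p]]
        linear_add[OF linear_Tan[OF p]])
qed

lemma c_gs: "c p gs x = \<gamma> x"
  using MM.C_gs[OF w w'] by (simp add: MM.chart_form_p)

text \<open>The product is independent of the normalization: \<open>scl\<close> enters the metric
  and its inverse enters the squared norm.\<close>

lemma gn_N: "NN.gn (christ_N G) (christ_N G') * cN p x y = \<gamma> (\<iota> p (Tan p gs)) * c p (\<iota> p x) (\<iota> p y)"
proof -
  note W = weyl_chart_N[OF w] weyl_chart_N[OF w']
  have s: "scl p \<noteq> 0" using scl_pos[OF V(4)] by simp
  have gy: "g p (Tan p gs) y = \<gamma> (\<iota> p y)" for y
    unfolding g_Tan[OF V(4)] by (simp add: MM.chart_form_p c_gs)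
  have "NN.gs (christ_N G) (christ_N G') = inverse (scl p) *\<^sub>R Tan p gs"
    unfolding NN.gs_def[OF W]
    by (rule sharp_unique[OF NN.C_inner[OF V(4)]])
      (simp add: chart_form_N[OF V(4)] inner_form_simps[OF g_inner[OF V(4)]] gamma_N[OF V(4)] gy s)
  then have "NN.gn (christ_N G) (christ_N G') = inverse (scl p) * \<gamma> (\<iota> p (Tan p gs))"
    unfolding NN.gn_def[OF W] gamma_N[OF V(4)] by (simp add: linear_cmul[OF linear_iota[OF V(4)]] linear_cmul[OF lin_gamma])
  moreover have "cN p x y = scl p * c p (\<iota> p x) (\<iota> p y)"
    using chart_form_N[OF V(4), of x y] by (simp add: NN.chart_form_p g_def MM.chart_form_p)
  ultimately show ?thesis using s by simp
qed

lemma c_nor_gs: "Tan p \<xi> = 0 \<Longrightarrow> c p (nor gs) \<xi> = \<gamma> \<xi>"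
  by (simp add: nor_def inner_form_simps[OF inner_c] c_gs c_normal)

text \<open>For normal \<open>\<xi>\<close> only \<open>\<gamma> \<xi>\<close> times the tangent
  direction survives the projection of the difference tensor. Its trace is
  \<open>n * \<gamma> \<xi>\<close>, and the factor -1/n in the definition supplies the
  sign.\<close>

lemma mean_curv_diff:
  assumes "Tan p \<xi> = 0"
  shows "mean_curv M c N D' p \<xi> = mean_curv M c N D p \<xi> - \<gamma> \<xi>"
proof -
  have nx: "nor \<xi> = \<xi>" using assms by (simp add: nor_def linear_0[OF linear_iota[OF V(4)]])
  note lT = linear_Tan[OF V(4)]
  have G': "G' p (\<iota> p x) \<xi> = G p (\<iota> p x) \<xi> + \<gamma> (\<iota> p x) *\<^sub>R \<xi> + \<gamma> \<xi> *\<^sub>R \<iota> p x" for x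
    using MM.delta_p[OF w w', of "\<iota> p x" \<xi>] c_normal(2)[OF assms, of x]
    by (simp add: MM.\<delta>_def[OF w w'] MM.chart_form_p algebra_simps)
  have e: "endo_trace (\<lambda>x. Tan p (a x + G' p (\<iota> p x) \<xi>)) = endo_trace (\<lambda>x. Tan p (a x + G p (\<iota> p x) \<xi>)) + \<gamma> \<xi> * real CARD('n)" for a
  proof -
    have "(\<lambda>x. Tan p (a x + G' p (\<iota> p x) \<xi>)) = (\<lambda>x. Tan p (a x + G p (\<iota> p x) \<xi>) + \<gamma> \<xi> *\<^sub>R x)"
      by (simp add: fun_eq_iff G' linear_add[OF lT] linear_cmul[OF lT] assms Tan_iota[OF V(4)])
    then show ?thesis by (simp add: endo_trace_add endo_trace_scaleR endo_trace_ident)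
  qed
  show ?thesis
    unfolding mean_curv_chart[OF conn(1)] mean_curv_chart[OF conn(2)] nx e by (simp add: field_simps)
qed

lemma mean_curv_vec_diff: "mean_curv_vec M c N D' p = mean_curv_vec M c N D p - nor gs"
  by (rule mean_curv_vec(3)[OF conn(2)])
    (simp_all add: linear_diff[OF linear_Tan[OF V(4)]] mean_curv_vec(1,2)[OF conn(1)] Tan_nor
      inner_form_simps[OF inner_c] c_nor_gs mean_curv_diff)

text \<open>Projection kills the two tangential terms of the difference tensor. The remaining
  multiple of \<open>nor gs\<close> is exactly the change of the pure-trace part.\<close>

lemma fund_form0_diff: "fund_form0 M c N D' p x y = fund_form0 M c N D p x y"
proof -
  have "second G' p x y = second G p x y + (\<gamma> (\<iota> p x) *\<^sub>R \<iota> p y + \<gamma> (\<iota> p y) *\<^sub>R \<iota> p x - c p (\<iota> p x) (\<iota> p y) *\<^sub>R gs)"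
    using MM.delta_p[OF w w', of "\<iota> p x" "\<iota> p y"]
    by (simp add: second_def MM.\<delta>_def[OF w w'] MM.chart_form_p algebra_simps)
  then have "nor (second G' p x y) = nor (second G p x y) - c p (\<iota> p x) (\<iota> p y) *\<^sub>R nor gs"
    by (simp add: linear_add[OF linear_nor] linear_diff[OF linear_nor] linear_cmul[OF linear_nor] nor_iota)
  then show ?thesis
    unfolding fund_form0_chart[OF conn(1)] fund_form0_chart[OF conn(2)] mean_curv_vec_diff
    by (simp add: algebra_simps)
qed

text \<open>The ledger on \<open>x\<close> and \<open>y\<close>: the difference of the two
  Schouten-Weyl tensors changes by
  \<open>\<gamma> B0 + cxy * c p H ns - cxy * c p ns ns / 2\<close>, the squared mean curvature term
  by \<open>- cxy * c p H ns + cxy * c p ns ns / 2\<close>, and the last term by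
  \<open>- \<gamma> B0\<close>.\<close>

lemma rel_schouten_weyl_diff:
  assumes K: "of_kind M c K" and K': "of_kind N cN K'"
  shows "rel_schouten_weyl M c K N K' D' p x y = rel_schouten_weyl M c K N K' D p x y"
proof -
  note W = weyl_chart_N[OF w] weyl_chart_N[OF w']
  define H where "H = mean_curv_vec M c N D p"
  define B0 where "B0 = fund_form0 M c N D p x y"
  define cxy where "cxy = c p (\<iota> p x) (\<iota> p y)"
  define ns where "ns = nor gs"
  have H: "Tan p H = 0" "\<gamma> H = c p H ns"
  proof -
    show "Tan p H = 0" unfolding H_def by (rule mean_curv_vec(1)[OF conn(1)])
    then show "\<gamma> H = c p H ns"
      using c_nor_gs[of H] inner_formD(2)[OF inner_c, of H ns] by (simp add: ns_def)
  qed
  have B0: "Tan p B0 = 0" unfolding B0_def by (rule Tan_fund_form0[OF conn(1)])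
  have "nor (second G p x y) = B0 + cxy *\<^sub>R H"
    by (simp add: B0_def fund_form0_chart[OF conn(1)] cxy_def H_def)
  then have nab: "NN.nab (christ_N G) (christ_N G') x y = MM.nab G G' (\<iota> p x) (\<iota> p y) + \<gamma> B0 + cxy * c p H ns"
    unfolding nab_N by (simp add: linear_add[OF lin_gamma] linear_cmul[OF lin_gamma] H)
  have "\<gamma> gs = \<gamma> (\<iota> p (Tan p gs)) + \<gamma> ns"
    by (simp add: ns_def nor_def flip: linear_add[OF lin_gamma])
  also have "\<gamma> ns = c p ns ns" using c_nor_gs[of ns] Tan_nor by (simp add: ns_def)
  finally have gn: "MM.gn G G' = \<gamma> (\<iota> p (Tan p gs)) + c p ns ns" by (simp add: MM.gn_def[OF w w'])
  have sM: "schouten_weyl M c K D' p (\<iota> p x) (\<iota> p y) = schouten_weyl M c K D p (\<iota> p x) (\<iota> p y)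
      - MM.nab G G' (\<iota> p x) (\<iota> p y) + \<gamma> (\<iota> p x) * \<gamma> (\<iota> p y) - MM.gn G G' / 2 * cxy"
    unfolding cxy_def by (rule MM.schouten_weyl_change[OF w w' K])
  have sN: "schouten_weyl N cN K' (induced_conn M c N D') p x y = schouten_weyl N cN K' (induced_conn M c N D) p x y
      - NN.nab (christ_N G) (christ_N G') x y + \<gamma> (\<iota> p x) * \<gamma> (\<iota> p y) - \<gamma> (\<iota> p (Tan p gs)) / 2 * cxy"
    using NN.schouten_weyl_change[OF W K', of x y] gn_N[of x y] by (simp add: gamma_N[OF V(4)] cxy_def)
  have mc: "mean_curv M c N D' p B0 = mean_curv M c N D p B0 - \<gamma> B0" by (rule mean_curv_diff[OF B0])
  have HH: "c p (H - ns) (H - ns) = c p H H - 2 * c p H ns + c p ns ns"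
    using inner_formD(2)[OF inner_c, of H ns] by (simp add: inner_form_simps[OF inner_c])
  show ?thesis
    unfolding rel_schouten_weyl_def iota_p fund_form0_diff mean_curv_vec_diff sM sN
    unfolding H_def[symmetric] B0_def[symmetric] cxy_def[symmetric] ns_def[symmetric] mc HH nab gn
    by (simp add: field_simps)
qed

end

text \<open>The skew parts of the two Schouten-Weyl tensors agree by \<open>faraday_N\<close>; the
  extrinsic terms are symmetric because \<open>second\<close> is, by symmetry of second derivatives
  and of the ambient coefficients.\<close>

lemma rel_schouten_weyl_symmetric:
  assumes w: "weyl_chart M c D \<phi> (fst \<phi>) G" and K: "of_kind M c K" and K': "of_kind N cN K'"
  shows "bilinear (rel_schouten_weyl M c K N K' D p)"
    "rel_schouten_weyl M c K N K' D p x y = rel_schouten_weyl M c K N K' D p y x"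
proof -
  note W = weyl_chart_N[OF w]
  note G = MM.weyl_chartD(1)[OF w]
  note hM = MM.schouten_weyl_bilinear[OF w K] and hN = NN.schouten_weyl_bilinear[OF W K']
  note li = linear_iota[OF V(4)] and lm = linear_mean_curv[OF G]
  note bs = bilinear_second[OF G V(4)]
  show "bilinear (rel_schouten_weyl M c K N K' D p)"
    unfolding rel_schouten_weyl_def iota_p fund_form0_chart[OF G]
    by (rule bilinearI)
      (simp_all add: linear_add[OF li] linear_cmul[OF li] linear_add[OF lm] linear_cmul[OF lm] linear_diff[OF lm]
        linear_add[OF linear_nor] linear_cmul[OF linear_nor] bilinear_simps[OF hM(1)] bilinear_simps[OF hN(1)]
        bilinear_simps[OF bs] inner_form_simps[OF inner_c] algebra_simps)
  have s: "second G p x y = second G p y x"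
    unfolding second_def using dchart_iota_sym[OF V(4), of x y]
      MM.weyl_chartD(2)[OF w p_phi, of "\<iota> p x" "\<iota> p y"] by simp
  have "schouten_weyl M c K D p (\<iota> p x) (\<iota> p y) - schouten_weyl N cN K' (induced_conn M c N D) p x y =
      schouten_weyl M c K D p (\<iota> p y) (\<iota> p x) - schouten_weyl N cN K' (induced_conn M c N D) p y x"
    using hM(2)[of "\<iota> p x" "\<iota> p y"] hN(2)[of x y] faraday_N[OF w, of x y] by simp
  then show "rel_schouten_weyl M c K N K' D p x y = rel_schouten_weyl M c K N K' D p y x"
    unfolding rel_schouten_weyl_def iota_p fund_form0_chart[OF G] s
    using inner_formD(2)[OF inner_c, of "\<iota> p x" "\<iota> p y"] by simp
qed

end

theorem proposition4p20:
  fixes M :: "('a, real^'m) manifold" and N :: "('a, real^'n) manifold"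
    and c :: "'a \<Rightarrow> real^'m \<Rightarrow> real^'m \<Rightarrow> real"
    and K :: "('a, real^'m) kind" and K' :: "('a, real^'n) kind"
  assumes "smooth_manifold M" and "conformal_structure M c"
    and "CARD('m) \<ge> 2" and "of_kind M c K"
    and "submanifold M N" and "CARD('m) > CARD('n)"
    and "of_kind N (induced_conf M c N) K'"
    and "weyl_structure M c D"
  shows "(\<forall>p\<in>points N. bilinear (rel_schouten_weyl M c K N K' D p) \<and>
            (\<forall>x y. rel_schouten_weyl M c K N K' D p x y = rel_schouten_weyl M c K N K' D p y x)) \<and>
         (\<forall>D'. weyl_structure M c D' \<longrightarrow>
            (\<forall>p\<in>points N. \<forall>x y. rel_schouten_weyl M c K N K' D' p x y
                                 = rel_schouten_weyl M c K N K' D p x y))"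
proof (intro conjI ballI allI impI)
  fix p x y assume p: "p \<in> points N"
  \<comment> \<open>The claim is pointwise and its arguments are components in the preferred charts
    at \<open>p\<close>, so precisely these charts are fixed, anew for each point.\<close>
  interpret submanifold_at M N c "chart_at M p" "chart_at N p" p
    by unfold_locales (use assms p in auto)
  note chart = weyl_structure_chart[OF assms(1) phiM atlas_openin[OF assms(1) phiM] subset_refl _ MM.cc]
  show "bilinear (rel_schouten_weyl M c K N K' D p)"
    by (rule rel_schouten_weyl_symmetric(1)[OF chart[OF assms(8)] assms(4,7)])
  show "rel_schouten_weyl M c K N K' D p x y = rel_schouten_weyl M c K N K' D p y x"
    by (rule rel_schouten_weyl_symmetric(2)[OF chart[OF assms(8)] assms(4,7)])
  show "rel_schouten_weyl M c K N K' D' p x y = rel_schouten_weyl M c K N K' D p x y"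
    if "weyl_structure M c D'" for D'
    by (rule rel_schouten_weyl_diff[OF chart[OF assms(8)] chart[OF that] assms(4,7)])
qed

end
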